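(* For every constant integer $k\ge 3$, the $k$-BGP problem admits an $O(|V||E|)$-time $\frac k2$-approximation algorithm: there is an algorithm that, given any simple connected graph $G=(V,E)$ (with $|V|\ge k$), computes in $O(|V||E|)$ time a feasible $k$-partition of $V$ whose size is at most $\frac k2\,\mathrm{OPT}$.
   Context: For a simple connected graph $G=(V,E)$ and an integer $k\ge 2$, a feasible $k$-partition is a partition of $V$ into $k$ non-empty parts $V_1,\dots,V_k$ such that each induced subgraph $G[V_i]$ is connected; its size is $\max_i|V_i|$. The problem $k$-BGP asks for a feasible $k$-partition of minimum size; $\mathrm{OPT}$ denotes this minimum size. *)

theory Defs
  imports Complex_Main "HOL-Library.Disjoint_Sets"
begin

section \<open>Graphs and balanced connected partitions\<close>

text \<open>Edges are two-element sets of vertices, so loops and parallel edges are excluded.\<close>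

definition simple_graph :: "'a set \<Rightarrow> 'a set set \<Rightarrow> bool" where
  "simple_graph V E \<longleftrightarrow> finite V \<and> (\<forall>e\<in>E. e \<subseteq> V \<and> card e = 2)"

definition connected_graph :: "'a set \<Rightarrow> 'a set set \<Rightarrow> bool" where
  "connected_graph V E \<longleftrightarrow> V \<noteq> {} \<and> (\<forall>u\<in>V. \<forall>v\<in>V. (u, v) \<in> {(x, y). {x, y} \<in> E}\<^sup>*)"

definition induced_edges :: "'a set set \<Rightarrow> 'a set \<Rightarrow> 'a set set" where
  "induced_edges E U = {e \<in> E. e \<subseteq> U}"

text \<open>Non-emptiness of the parts is contained in \<^const>\<open>partition_on\<close>.\<close>

definition feasible_partition :: "nat \<Rightarrow> 'a set \<Rightarrow> 'a set set \<Rightarrow> 'a set set \<Rightarrow> bool" where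
  "feasible_partition k V E P \<longleftrightarrow>
     partition_on V P \<and> card P = k \<and> (\<forall>U\<in>P. connected_graph U (induced_edges E U))"

definition partition_size :: "'a set set \<Rightarrow> nat" where
  "partition_size P = Max (card ` P)"

definition OPT :: "nat \<Rightarrow> 'a set \<Rightarrow> 'a set set \<Rightarrow> nat" where
  "OPT k V E = Min (partition_size ` {P. feasible_partition k V E P})"


section \<open>Machine model\<close>

text \<open>
  A unit-cost word RAM, programmed in a structured language. A program uses finitely many
  registers and finitely many arrays, all holding natural numbers; interleaving the arrays in one
  linear memory changes running times by a constant factor only. Every operation, register access
  and memory access costs one time unit. Subtraction is truncated at zero.

  The word bound \<open>W\<close> is the largest number that fits into a machine word. An execution in which
  some value (a constant, an address or an intermediate result) exceeds \<open>W\<close> has no derivation, so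
  unit cost cannot be exploited by computing with huge numbers.
\<close>

type_synonym state = "(string \<Rightarrow> nat) \<times> (string \<Rightarrow> nat \<Rightarrow> nat)"

datatype aexp =
    Const nat
  | Reg string
  | Load string aexp
  | Plus aexp aexp
  | Minus aexp aexp
  | Times aexp aexp

datatype bexp =
    Less aexp aexp
  | Equal aexp aexp
  | Neg bexp
  | Conj bexp bexp

datatype com =
    Skip
  | Assign string aexp
  | Store string aexp aexp
  | Seq com com
  | Cond bexp com com
  | Loop bexp com

fun aval :: "state \<Rightarrow> aexp \<Rightarrow> nat" where
  "aval s (Const c) = c"
| "aval s (Reg x) = fst s x"
| "aval s (Load a e) = snd s a (aval s e)"
| "aval s (Plus e f) = aval s e + aval s f"
| "aval s (Minus e f) = aval s e - aval s f"
| "aval s (Times e f) = aval s e * aval s f"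

fun bval :: "state \<Rightarrow> bexp \<Rightarrow> bool" where
  "bval s (Less e f) \<longleftrightarrow> aval s e < aval s f"
| "bval s (Equal e f) \<longleftrightarrow> aval s e = aval s f"
| "bval s (Neg b) \<longleftrightarrow> \<not> bval s b"
| "bval s (Conj b c) \<longleftrightarrow> bval s b \<and> bval s c"

text \<open>All values occurring in the evaluation of an expression fit into a word.\<close>

fun afits :: "nat \<Rightarrow> state \<Rightarrow> aexp \<Rightarrow> bool" where
  "afits W s (Const c) \<longleftrightarrow> c \<le> W"
| "afits W s (Reg x) \<longleftrightarrow> fst s x \<le> W"
| "afits W s (Load a e) \<longleftrightarrow> afits W s e \<and> snd s a (aval s e) \<le> W"
| "afits W s (Plus e f) \<longleftrightarrow> afits W s e \<and> afits W s f \<and> aval s e + aval s f \<le> W"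
| "afits W s (Minus e f) \<longleftrightarrow> afits W s e \<and> afits W s f"
| "afits W s (Times e f) \<longleftrightarrow> afits W s e \<and> afits W s f \<and> aval s e * aval s f \<le> W"

fun bfits :: "nat \<Rightarrow> state \<Rightarrow> bexp \<Rightarrow> bool" where
  "bfits W s (Less e f) \<longleftrightarrow> afits W s e \<and> afits W s f"
| "bfits W s (Equal e f) \<longleftrightarrow> afits W s e \<and> afits W s f"
| "bfits W s (Neg b) \<longleftrightarrow> bfits W s b"
| "bfits W s (Conj b c) \<longleftrightarrow> bfits W s b \<and> bfits W s c"

fun acost :: "aexp \<Rightarrow> nat" where
  "acost (Const c) = 1"
| "acost (Reg x) = 1"
| "acost (Load a e) = acost e + 1"
| "acost (Plus e f) = acost e + acost f + 1"
| "acost (Minus e f) = acost e + acost f + 1"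
| "acost (Times e f) = acost e + acost f + 1"

fun bcost :: "bexp \<Rightarrow> nat" where
  "bcost (Less e f) = acost e + acost f + 1"
| "bcost (Equal e f) = acost e + acost f + 1"
| "bcost (Neg b) = bcost b + 1"
| "bcost (Conj b c) = bcost b + bcost c + 1"

text \<open>
  \<open>exec W c s t s'\<close>: with word bound \<open>W\<close>, program \<open>c\<close> started in state \<open>s\<close> terminates after
  \<open>t\<close> time units in state \<open>s'\<close>.
\<close>

inductive exec :: "nat \<Rightarrow> com \<Rightarrow> state \<Rightarrow> nat \<Rightarrow> state \<Rightarrow> bool" for W :: nat where
  Skip: "exec W Skip s 1 s"
| Assign: "afits W s e \<Longrightarrow>
    exec W (Assign x e) s (acost e + 1) ((fst s)(x := aval s e), snd s)"
| Store: "afits W s e \<Longrightarrow> afits W s f \<Longrightarrow>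
    exec W (Store a e f) s (acost e + acost f + 1)
      (fst s, (snd s)(a := (snd s a)(aval s e := aval s f)))"
| Seq: "exec W c s t s' \<Longrightarrow> exec W d s' t' s'' \<Longrightarrow> exec W (Seq c d) s (t + t') s''"
| CondTrue: "bfits W s b \<Longrightarrow> bval s b \<Longrightarrow> exec W c s t s' \<Longrightarrow>
    exec W (Cond b c d) s (bcost b + t + 1) s'"
| CondFalse: "bfits W s b \<Longrightarrow> \<not> bval s b \<Longrightarrow> exec W d s t s' \<Longrightarrow>
    exec W (Cond b c d) s (bcost b + t + 1) s'"
| LoopFalse: "bfits W s b \<Longrightarrow> \<not> bval s b \<Longrightarrow> exec W (Loop b c) s (bcost b + 1) s"
| LoopTrue: "bfits W s b \<Longrightarrow> bval s b \<Longrightarrow> exec W c s t s' \<Longrightarrow> exec W (Loop b c) s' t' s'' \<Longrightarrow>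
    exec W (Loop b c) s (bcost b + t + t' + 1) s''"

inductive_cases SkipE: "exec W Skip s t s'"
inductive_cases AssignE: "exec W (Assign x e) s t s'"
inductive_cases StoreE: "exec W (Store a e f) s t s'"
inductive_cases SeqE: "exec W (Seq c d) s t s'"
inductive_cases CondE: "exec W (Cond b c d) s t s'"
inductive_cases LoopE: "exec W (Loop b c) s t s'"

text \<open>
  The language is deterministic, so the existence of one terminating execution describes the
  behaviour of the program completely.
\<close>

lemma exec_deterministic:
  assumes "exec W c s t s'" "exec W c s u s''"
  shows "t = u \<and> s' = s''"
  using assms
proof (induction arbitrary: u s'' rule: exec.induct)
  case (Skip s)
  from Skip.prems show ?case by (rule SkipE) simp
next
  case (Assign s e x)
  from Assign.prems show ?case by (rule AssignE) simp
next
  case (Store s e f a)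
  from Store.prems show ?case by (rule StoreE) simp
next
  case (Seq c s t s' d t' s1)
  from Seq.prems show ?case
  proof (rule SeqE)
    fix t2 s2 t2'
    assume "u = t2 + t2'" "exec W c s t2 s2" "exec W d s2 t2' s''"
    with Seq.IH(1)[of t2 s2] Seq.IH(2)[of t2' s''] show ?thesis by simp
  qed
next
  case (CondTrue s b c t s' d)
  from CondTrue.prems show ?case
  proof (rule CondE)
    fix t2
    assume "u = Suc (bcost b + t2)" "exec W c s t2 s''"
    with CondTrue.IH[of t2 s''] show ?thesis by simp
  qed (use CondTrue.hyps(2) in simp)
next
  case (CondFalse s b d t s' c)
  from CondFalse.prems show ?case
  proof (rule CondE)
    fix t2
    assume "u = Suc (bcost b + t2)" "exec W d s t2 s''"
    with CondFalse.IH[of t2 s''] show ?thesis by simp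
  qed (use CondFalse.hyps(2) in simp)
next
  case (LoopFalse s b c)
  from LoopFalse.prems show ?case
    by (rule LoopE) (use LoopFalse.hyps(2) in simp_all)
next
  case (LoopTrue s b c t s' t' s1)
  from LoopTrue.prems show ?case
  proof (rule LoopE)
    fix t2 s2 t2'
    assume "u = Suc (bcost b + t2 + t2')" "exec W c s t2 s2" "exec W (Loop b c) s2 t2' s''"
    with LoopTrue.IH(1)[of t2 s2] LoopTrue.IH(2)[of t2' s''] show ?thesis by simp
  qed (use LoopTrue.hyps(2) in simp)
qed


section \<open>Input and output conventions\<close>

text \<open>
  A graph is presented to a program by the number \<open>n\<close> of vertices, which are the numbers below
  \<open>n\<close>, and a list containing every edge exactly once, in an arbitrary order and with arbitrarily
  ordered end points.
\<close>

definition encodes :: "nat \<Rightarrow> (nat \<times> nat) list \<Rightarrow> nat set \<Rightarrow> nat set set \<Rightarrow> bool" where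
  "encodes n es V E \<longleftrightarrow>
     V = {..<n} \<and> E = (\<lambda>(u, v). {u, v}) ` set es \<and> length es = card E"

text \<open>All registers and array cells not holding part of the input are initially zero.\<close>

definition input_state :: "nat \<Rightarrow> (nat \<times> nat) list \<Rightarrow> state" where
  "input_state n es =
     ((\<lambda>_. 0)(''n'' := n, ''m'' := length es),
      (\<lambda>_ _. 0)(''src'' := (\<lambda>i. if i < length es then fst (es ! i) else 0),
                ''dst'' := (\<lambda>i. if i < length es then snd (es ! i) else 0)))"

text \<open>The program writes the index of the part of vertex \<open>v\<close> to cell \<open>v\<close> of array \<open>part\<close>.\<close>

definition output_partition :: "nat \<Rightarrow> nat set \<Rightarrow> state \<Rightarrow> nat set set" where
  "output_partition k V s = (\<lambda>i. {v \<in> V. snd s ''part'' v = i}) ` {..<k}"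

end

theory Submission
  imports Defs
begin

text \<open>
  Let \<open>n = |V|\<close>. Every optimal partition has size at least \<open>n / k\<close>, so parts of size at most \<open>n / 2\<close>
  are harmless. Let \<open>v\<close> be the first vertex that a depth-first search finishes with a subtree of more
  than \<open>n / 2\<close> vertices, let \<open>A\<close> be the complement of this subtree and let \<open>D\<^sub>1, D\<^sub>2, \<dots>\<close> be the
  subtrees of the children of \<open>v\<close>. All these sets are connected, attached to \<open>v\<close> and of size at most
  \<open>n / 2\<close>, and no edge joins two of the \<open>D\<^sub>i\<close>. Merge into \<open>A\<close> the sets \<open>D\<^sub>i\<close> adjacent to it, one
  after the other. If \<open>A\<close> would become larger than \<open>n / 2\<close> by merging \<open>D\<^sub>i\<close>, then \<open>A\<close>, \<open>D\<^sub>i\<close> and the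
  rest (which contains \<open>v\<close>) are three connected parts of size at most \<open>n / 2\<close>. Otherwise the pieces
  are the components of \<open>G - v\<close>. The \<open>k - 1\<close> largest ones become parts and the others join \<open>v\<close>; the
  part of \<open>v\<close> is at most as large as in an optimal partition, because at most \<open>k - 1\<close> components
  can meet a part that avoids \<open>v\<close>. Missing parts are obtained by cutting the last vertex of a graph
  search off a part with at least two vertices.

  A depth-first search needs \<open>O(|V|)\<close> steps, and each of them may scan the whole edge list within
  the time bound. Therefore no adjacency structure is needed.
\<close>

section \<open>Connected sets and pieces\<close>

text \<open>The tree must come from a depth-first search because such a tree has no cross edges: the
  \<open>D\<^sub>i\<close> meet each other only through \<open>A\<close> or \<open>v\<close>. Hence
  absorbing \<open>D\<^sub>i\<close> creates no new adjacency between \<open>A\<close> and another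
  \<open>D\<^sub>l\<close>, a single pass over the edges settles all merges, and without overflow
  the outcome is exactly the set of components of \<open>G - v\<close>. The search stops early, so
  \<open>A\<close> consists of the stack below \<open>v\<close>, finished components hanging from
  it, and undiscovered vertices. Its connectedness is the delicate point. The search tree is not
  analysed as such: every pop collapses a finished subtree to one name, and the invariant speaks
  only of these names. A pop costs \<open>O(n)\<close>, which is affordable since \<open>n\<close>
  is at most twice the number of edges. Only the part of \<open>v\<close> in the component case can
  exceed \<open>n / 2\<close>, and only there is the optimum compared part by part. The assumption
  \<open>k \<ge> 3\<close> provides two selections besides the part of the root, enough to separate
  both \<open>A\<close> and \<open>D\<^sub>i\<close> after an overflow. All vertex sets are classes
  of labellings \<open>nat \<Rightarrow> nat\<close>, so that program arrays are mathematical
  objects without translation.\<close>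

text \<open>Closed subsets replace paths: connectedness is used as an induction principle and proved
  by a closure argument. The empty set counts as connected, so non-emptiness is tracked
  separately.\<close>

definition conn :: "('a \<Rightarrow> 'a \<Rightarrow> bool) \<Rightarrow> 'a set \<Rightarrow> bool" where
  "conn R U \<longleftrightarrow> (\<forall>S. S \<subseteq> U \<longrightarrow> S \<noteq> {} \<longrightarrow> (\<forall>x\<in>S. \<forall>y\<in>U. R x y \<longrightarrow> y \<in> S) \<longrightarrow> S = U)"

text \<open>Acts as an induction rule over \<open>U\<close> from the start vertex \<open>x\<close>.
  The set \<open>S\<close> may reach outside \<open>U\<close>, since the definition is applied to
  \<open>S \<inter> U\<close>.\<close>

lemma connD:
  assumes "conn R U" "x \<in> U" "x \<in> S" "\<And>x y. x \<in> S \<Longrightarrow> x \<in> U \<Longrightarrow> y \<in> U \<Longrightarrow> R x y \<Longrightarrow> y \<in> S" "y \<in> U"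
  shows "y \<in> S"
proof -
  have "S \<inter> U = U"
    using assms(1)[unfolded conn_def, rule_format, of "S \<inter> U"] assms(2-4) by blast
  then show ?thesis using assms(5) by blast
qed

text \<open>For symmetric \<open>R\<close> the complement of a closed set within \<open>U\<close> is
  closed too. If both were non-empty, both would contain \<open>v\<close>.\<close>

lemma conn_rooted:
  assumes "symp R" "v \<in> U"
    "\<And>S x. S \<subseteq> U \<Longrightarrow> x \<in> S \<Longrightarrow> (\<And>x y. x \<in> S \<Longrightarrow> y \<in> U \<Longrightarrow> R x y \<Longrightarrow> y \<in> S) \<Longrightarrow> v \<in> S"
  shows "conn R U"
  unfolding conn_def
proof (intro allI impI)
  fix S assume S: "S \<subseteq> U" "S \<noteq> {}" "\<forall>x\<in>S. \<forall>y\<in>U. R x y \<longrightarrow> y \<in> S"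
  then have "v \<in> S" using assms(3)[of S] by blast
  show "S = U"
  proof (rule ccontr)
    assume "S \<noteq> U"
    then obtain x where "x \<in> U - S" using S(1) by blast
    then have "v \<in> U - S" using assms(3)[of "U - S" x] S(3) \<open>symp R\<close>[THEN sympD] by blast
    with \<open>v \<in> S\<close> show False by blast
  qed
qed

lemma conn_empty [simp]: "conn R {}" and conn_singleton [simp]: "conn R {x}"
  unfolding conn_def by (auto simp: subset_singleton_iff)

lemma conn_star:
  assumes "symp R" "v \<in> U" "\<And>x. x \<in> U \<Longrightarrow> \<exists>C\<subseteq>U. x \<in> C \<and> v \<in> C \<and> conn R C"
  shows "conn R U"
proof (rule conn_rooted[OF assms(1,2)])
  fix S x assume S: "S \<subseteq> U" "x \<in> S" "\<And>x y. x \<in> S \<Longrightarrow> y \<in> U \<Longrightarrow> R x y \<Longrightarrow> y \<in> S"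
  from S(1,2) obtain C where "C \<subseteq> U" "x \<in> C" "v \<in> C" "conn R C" using assms(3)[of x] by blast
  then show "v \<in> S" using S by (intro connD[of R C x S v]) auto
qed

lemma conn_Un:
  assumes "symp R" "conn R A" "conn R B" "a \<in> A" "b \<in> B" "R a b"
  shows "conn R (A \<union> B)"
proof (rule conn_rooted[OF assms(1), where v = a])
  fix S x assume S: "S \<subseteq> A \<union> B" "x \<in> S" "\<And>x y. x \<in> S \<Longrightarrow> y \<in> A \<union> B \<Longrightarrow> R x y \<Longrightarrow> y \<in> S"
  have "a \<in> S" if "x \<in> A" by (rule connD[OF assms(2) that]) (use S assms(4) in auto)
  moreover have "b \<in> S" if "x \<in> B" by (rule connD[OF assms(3) that]) (use S assms(5) in auto)
  moreover have "a \<in> S" if "b \<in> S"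
    using S(3)[OF that, of a] assms(4,6) \<open>symp R\<close>[THEN sympD] by blast
  ultimately show "a \<in> S" using S(1,2) by blast
qed (use assms in auto)

lemma conn_insert:
  assumes "symp R" "conn R A" "a \<in> A" "R a v"
  shows "conn R (insert v A)"
  using conn_Un[OF assms(1,2) conn_singleton assms(3), of v v] assms(4) by simp

text \<open>Bridge to the problem definition: the vertices reachable from \<open>u\<close> form a
  closed set, and conversely a closed set absorbs every path that starts in it.\<close>

lemma connected_graph_iff_conn:
  "connected_graph U (induced_edges E U) \<longleftrightarrow> U \<noteq> {} \<and> conn (\<lambda>x y. {x, y} \<in> E) U"
proof -
  let ?r = "{(x, y). {x, y} \<in> induced_edges E U}"
  have conn: "conn (\<lambda>x y. {x, y} \<in> E) U" if *: "\<forall>u\<in>U. \<forall>v\<in>U. (u, v) \<in> ?r\<^sup>*"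
    unfolding conn_def
  proof (intro allI impI)
    fix S assume S: "S \<subseteq> U" "S \<noteq> {}" "\<forall>x\<in>S. \<forall>y\<in>U. {x, y} \<in> E \<longrightarrow> y \<in> S"
    have "v \<in> S" if "(u, v) \<in> ?r\<^sup>*" "u \<in> S" for u v
      using that by (induction rule: rtrancl_induct) (use S in \<open>auto simp: induced_edges_def\<close>)
    then show "S = U" using S(1,2) * by blast
  qed
  have "(u, v) \<in> ?r\<^sup>*" if "conn (\<lambda>x y. {x, y} \<in> E) U" "u \<in> U" "v \<in> U" for u v
  proof -
    have "v \<in> {v. (u, v) \<in> ?r\<^sup>*}"
    proof (rule connD[OF that(1,2) _ _ that(3)])
      fix x y assume "x \<in> {v. (u, v) \<in> ?r\<^sup>*}" "x \<in> U" "y \<in> U" "{x, y} \<in> E"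
      then show "y \<in> {v. (u, v) \<in> ?r\<^sup>*}"
        by (auto simp: induced_edges_def intro: rtrancl_into_rtrancl)
    qed simp
    then show ?thesis by simp
  qed
  with conn show ?thesis unfolding connected_graph_def by blast
qed

text \<open>Exchange argument: the maximum \<open>M\<close> of \<open>f\<close> on
  \<open>I - S\<close> lies below every value on \<open>S\<close>, and \<open>I - S\<close> has at
  most as many elements as \<open>S - I\<close>, so a multiple of \<open>M\<close> separates the two
  sums. It is applied to the sizes of the selected pieces.\<close>

lemma sum_le_sum_greedy:
  fixes f :: "'a \<Rightarrow> nat"
  assumes "finite I" "finite S" "card I \<le> card S" "\<And>i j. i \<in> S \<Longrightarrow> j \<in> I - S \<Longrightarrow> f j \<le> f i"
  shows "sum f I \<le> sum f S"
proof (cases "I - S = {}")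
  case True
  then show ?thesis using assms(2) by (intro sum_mono2) auto
next
  case False
  define M where "M = Max (f ` (I - S))"
  have "M \<in> f ` (I - S)" unfolding M_def using False assms(1) by (intro Max_in) auto
  then have M: "M \<le> f i" if "i \<in> S" for i using that assms(4) by auto
  have card: "card (I - S) \<le> card (S - I)"
    using assms(1-3) card_Diff_subset_Int[of I S] card_Diff_subset_Int[of S I]
    by (simp add: Int_commute)
  have "sum f (I - S) \<le> card (I - S) * M"
    using sum_bounded_above[of "I - S" f M] assms(1) unfolding M_def by simp
  also have "\<dots> \<le> card (S - I) * M" using card by simp
  also have "\<dots> \<le> sum f (S - I)" using sum_bounded_below[of "S - I" M f] M by simp
  finally have "sum f (I - S) + sum f (I \<inter> S) \<le> sum f (S - I) + sum f (S \<inter> I)"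
    by (simp add: Int_commute)
  then show ?thesis using assms(1,2)
    by (metis sum.Int_Diff add.commute)
qed

locale ngraph =
  fixes n :: nat and R :: "nat \<Rightarrow> nat \<Rightarrow> bool"
  assumes symp: "symp R" and bounded: "R x y \<Longrightarrow> x < n" and connected: "conn R {..<n}"
begin

lemma R_sym: "R x y \<Longrightarrow> R y x"
  using symp by (rule sympD)

lemma bounded': "R x y \<Longrightarrow> y < n"
  using R_sym bounded by blast

end

definition cls :: "nat \<Rightarrow> (nat \<Rightarrow> nat) \<Rightarrow> nat \<Rightarrow> nat set" where
  "cls n f i = {x. x < n \<and> f x = i}"

lemma mem_cls [simp]: "x \<in> cls n f i \<longleftrightarrow> x < n \<and> f x = i"
  by (simp add: cls_def)

lemma finite_cls [simp]: "finite (cls n f i)"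
  by (simp add: cls_def)

subsection \<open>Depth-first search\<close>

text \<open>The state of the search: \<open>st\<close> is the stack, top first, and \<open>p\<close> holds parents. A vertex \<open>x\<close>
  with \<open>h x = 0\<close> is undiscovered; otherwise \<open>h x - 1\<close> is its lowest ancestor (or itself) on
  the stack, and \<open>c x\<close> names the component of the finished vertices that contains it.\<close>

locale dfs_state = ngraph +
  fixes st :: "nat list" and h c p :: "nat \<Rightarrow> nat"
  assumes st_distinct: "distinct st"
    and st_bound: "set st \<subseteq> {..<n}"
    and st_path: "successively (\<lambda>u w. R u w \<and> p u = w) st"
    and on_stack: "w \<in> set st \<Longrightarrow> h w = Suc w \<and> c w = w"
    and hangs: "x < n \<Longrightarrow> h x \<noteq> 0 \<Longrightarrow> \<exists>w\<in>set st. h x = Suc w"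
    and no_white: "R x y \<Longrightarrow> h x \<noteq> 0 \<Longrightarrow> x \<notin> set st \<Longrightarrow> h y \<noteq> 0"
    and same_comp: "R x y \<Longrightarrow> h x \<noteq> 0 \<Longrightarrow> x \<notin> set st \<Longrightarrow> y \<notin> set st \<Longrightarrow> c x = c y"
    and no_cross: "R x y \<Longrightarrow> x \<notin> set st \<Longrightarrow> h x = Suc w \<Longrightarrow> st = ys @ w # zs \<Longrightarrow> y \<notin> set ys"
    and own: "w \<in> set st \<Longrightarrow> x < n \<Longrightarrow> h x = Suc w \<Longrightarrow> c x = w \<Longrightarrow> x = w"
    and comps: "w \<in> set st \<Longrightarrow> i \<noteq> w \<Longrightarrow> x < n \<Longrightarrow> h x = Suc w \<Longrightarrow> c x = i \<Longrightarrow>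
      i < n \<and> h i = Suc w \<and> c i = i \<and> R i w \<and>
      conn R {x. x < n \<and> h x = Suc w \<and> c x = i} \<and>
      2 * card {x. x < n \<and> h x = Suc w \<and> c x = i} \<le> n"
begin

text \<open>A finished vertex has no undiscovered neighbour (\<open>no_white\<close>), hence none is
  adjacent to the new top \<open>w\<close>, and \<open>no_cross\<close> survives.\<close>

lemma push:
  assumes st: "st = u # st'" and w: "R u w" "h w = 0"
  shows "dfs_state n R (w # st) (h(w := Suc w)) (c(w := w)) (p(w := u))"
proof -
  have wn: "w < n" using w(1) by (rule bounded')
  have wst: "w \<notin> set st" using on_stack w(2) by fastforce
  show ?thesis
  proof unfold_locales
    show "successively (\<lambda>u' w'. R u' w' \<and> (p(w := u)) u' = w') (w # st)"
    proof -
      have "successively (\<lambda>u' w'. R u' w' \<and> (p(w := u)) u' = w') st"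
        using st_path by (rule successively_mono) (use wst in auto)
      then show ?thesis using st R_sym w(1) by auto
    qed
  next
    fix x assume "x < n" "(h(w := Suc w)) x \<noteq> 0"
    then show "\<exists>w'\<in>set (w # st). (h(w := Suc w)) x = Suc w'" using hangs by auto
  next
    fix x y assume "R x y" "(h(w := Suc w)) x \<noteq> 0" "x \<notin> set (w # st)"
    then show "(h(w := Suc w)) y \<noteq> 0" using no_white by auto
  next
    fix x y assume "R x y" "(h(w := Suc w)) x \<noteq> 0" "x \<notin> set (w # st)" "y \<notin> set (w # st)"
    then show "(c(w := w)) x = (c(w := w)) y" using same_comp by auto
  next
    fix x y w' ys zs
    assume *: "R x y" "x \<notin> set (w # st)" "(h(w := Suc w)) x = Suc w'" "w # st = ys @ w' # zs"
    have nst: "x \<notin> set st" and hx: "h x = Suc w'" using *(2,3) by (auto split: if_splits)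
    then have "h y \<noteq> 0" using no_white[OF *(1) _ nst] by auto
    then have "y \<noteq> w" using w(2) by auto
    show "y \<notin> set ys"
    proof (cases ys)
      case (Cons a ys')
      then have "st = ys' @ w' # zs" "a = w" using *(4) by auto
      then show ?thesis using no_cross[OF *(1) nst hx] Cons \<open>y \<noteq> w\<close> by auto
    qed simp
  next
    fix w' x
    assume *: "w' \<in> set (w # st)" "x < n" "(h(w := Suc w)) x = Suc w'" "(c(w := w)) x = w'"
    show "x = w'"
    proof (cases "x = w")
      case False
      then have "w' \<in> set st" using * hangs[of x] by auto
      then show ?thesis using own * False by auto
    qed (use * in auto)
  next
    fix w' i x
    assume *: "w' \<in> set (w # st)" "i \<noteq> w'" "x < n" "(h(w := Suc w)) x = Suc w'" "(c(w := w)) x = i"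
    have "w \<noteq> w'"
    proof
      assume "w = w'"
      then have "h x = Suc w" "x \<noteq> w" using * by (auto split: if_splits)
      then show False using hangs[OF *(3)] wst by auto
    qed
    then have "w' \<in> set st" "x \<noteq> w" "h x = Suc w'" "c x = i" using * by (auto split: if_splits)
    note comps[OF this(1) *(2,3) this(3,4)]
    moreover have "i \<noteq> w" using calculation w(2) by auto
    moreover have "{x. x < n \<and> (h(w := Suc w)) x = Suc w' \<and> (c(w := w)) x = i} =
        {x. x < n \<and> h x = Suc w' \<and> c x = i}"
      using \<open>w \<noteq> w'\<close> w(2) by auto
    ultimately show "i < n \<and> (h(w := Suc w)) i = Suc w' \<and> (c(w := w)) i = i \<and> R i w' \<and>
      conn R {x. x < n \<and> (h(w := Suc w)) x = Suc w' \<and> (c(w := w)) x = i} \<and>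
      2 * card {x. x < n \<and> (h(w := Suc w)) x = Suc w' \<and> (c(w := w)) x = i} \<le> n"
      by auto
  qed (use st_distinct st_bound wn wst on_stack in auto)
qed

text \<open>Besides \<open>u\<close> itself, the vertices hanging from \<open>u\<close> form
  finished components, and each of them is attached to \<open>u\<close> by the vertex that names
  it.\<close>

lemma subtree_conn:
  assumes "u \<in> set st"
  shows "conn R {x. x < n \<and> h x = Suc u}"
proof (rule conn_star[OF symp, of u])
  show "u \<in> {x. x < n \<and> h x = Suc u}" using assms on_stack st_bound by auto
  then have u: "u < n" "h u = Suc u" by auto
  fix x assume x: "x \<in> {x. x < n \<and> h x = Suc u}"
  show "\<exists>C\<subseteq>{x. x < n \<and> h x = Suc u}. x \<in> C \<and> u \<in> C \<and> conn R C"
  proof (cases "c x = u")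
    case True
    then have "x = u" using own[OF assms, of x] x by auto
    then show ?thesis using x by (intro exI[of _ "{u}"]) auto
  next
    case False
    let ?D = "{y. y < n \<and> h y = Suc u \<and> c y = c x}"
    have D: "c x \<in> ?D" "conn R ?D" "R (c x) u" using comps[OF assms False] x by auto
    have "conn R (insert u ?D)" by (rule conn_insert[OF symp D(2,1,3)])
    then show ?thesis using x u by (intro exI[of _ "insert u ?D"]) auto
  qed
qed

text \<open>Everything that hung from \<open>u\<close> collapses to one finished component named
  \<open>u\<close>, which now hangs from \<open>w\<close>. The hypothesis \<open>small\<close>
  maintains the size bound in \<open>comps\<close>, so the search may pop only while subtrees are
  small.\<close>

lemma pop:
  assumes st: "st = u # w # st'" and nw: "\<And>y. R u y \<Longrightarrow> h y \<noteq> 0"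
    and small: "2 * card {x. x < n \<and> h x = Suc u} \<le> n"
    and h': "\<And>x. h' x = (if x < n \<and> h x = Suc u then Suc w else h x)"
    and c': "\<And>x. c' x = (if x < n \<and> h x = Suc u then u else c x)"
  shows "dfs_state n R (w # st') h' c' p"
proof -
  have u: "u < n" "h u = Suc u" "u \<noteq> w" "u \<notin> set (w # st')" "R u w"
    using st st_bound on_stack st_distinct st_path by auto
  have w: "w < n" "h w = Suc w" using st st_bound on_stack by auto
  have h'_0: "h' x = 0 \<longleftrightarrow> h x = 0" for x unfolding h' by auto
  have h'_w: "h' x = Suc w \<longleftrightarrow> h x = Suc w \<or> x < n \<and> h x = Suc u" for x unfolding h' by auto
  have h'_eq: "h' x = Suc w' \<longleftrightarrow> h x = Suc w'" if "w' \<noteq> w" "w' \<noteq> u" for x w'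
    unfolding h' using that by auto
  have st'_not: "h x \<noteq> Suc u" if "x \<in> set (w # st')" for x
    using that on_stack[of x] st u(4) by auto
  show ?thesis
  proof unfold_locales
    show "distinct (w # st')" "set (w # st') \<subseteq> {..<n}"
      using st_distinct st_bound st by auto
    show "successively (\<lambda>u w. R u w \<and> p u = w) (w # st')"
      using st_path st by simp
  next
    fix x assume "x \<in> set (w # st')"
    then show "h' x = Suc x \<and> c' x = x"
      using on_stack[of x] st st'_not[of x] unfolding h' c' by auto
  next
    fix x assume "x < n" "h' x \<noteq> 0"
    then show "\<exists>w'\<in>set (w # st'). h' x = Suc w'"
      using hangs[of x] st h'_0 unfolding h' by auto
  next
    fix x y assume *: "R x y" "h' x \<noteq> 0" "x \<notin> set (w # st')"
    then show "h' y \<noteq> 0" using no_white[of x y] nw st unfolding h'_0 by (cases "x = u") auto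
  next
    fix x y assume *: "R x y" "h' x \<noteq> 0" "x \<notin> set (w # st')" "y \<notin> set (w # st')"
    have n: "x < n" "y < n" using * bounded bounded' by auto
    have hx: "h x \<noteq> 0" and hy: "h y \<noteq> 0"
      using *(2) no_white[of x y] nw[of y] * st unfolding h'_0 by (cases "x = u"; auto)+
    \<comment> \<open>A finished neighbour of the top \<open>u\<close> must hang from
      \<open>u\<close>: if it hung from a deeper stack vertex, \<open>u\<close> would lie above that
      vertex, against \<open>no_cross\<close>.\<close>
    have to_u: "h z = Suc u" if z: "R z u" "h z \<noteq> 0" "z \<notin> set st" for z
    proof -
      obtain a where a: "a \<in> set st" "h z = Suc a" using hangs[of z] z bounded by blast
      then obtain ys zs where "st = ys @ a # zs" by (meson split_list)
      with no_cross[OF z(1,3) a(2) this] show ?thesis using st a by (cases ys) auto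
    qed
    consider "x = u" | "y = u" "x \<noteq> u" | "x \<noteq> u" "y \<noteq> u" by blast
    then show "c' x = c' y"
    proof cases
      case 1
      then have "h y = Suc u" using to_u[of y] u hy * st R_sym by (cases "y = u") auto
      then show ?thesis using 1 u n unfolding c' by auto
    next
      case 2
      then have "h x = Suc u" using to_u[of x] hx * st by auto
      then show ?thesis using 2 u n unfolding c' by auto
    next
      case 3
      then have c: "c x = c y" and nst: "x \<notin> set st" "y \<notin> set st" using same_comp[of x y] * hx st by auto
      obtain a b where a: "a \<in> set st" "h x = Suc a" and b: "b \<in> set st" "h y = Suc b"
        using hangs n hx hy by meson
      \<comment> \<open>The name of a component is a vertex hanging from the same stack vertex
        (\<open>comps\<close>). Equal names therefore give equal values of \<open>h\<close>, and the
        pop renames both end points or neither.\<close>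
      have "c x \<noteq> a" using own[OF a(1) n(1) a(2)] nst a(1) by auto
      from comps[OF a(1) this n(1) a(2) refl] have "h (c x) = h x" using a by simp
      moreover have "c y \<noteq> b" using own[OF b(1) n(2) b(2)] nst b(1) by auto
      from comps[OF b(1) this n(2) b(2) refl] have "h (c y) = h y" using b by simp
      ultimately show ?thesis using c unfolding c' using n by auto
    qed
  next
    fix x y w' ys zs
    assume *: "R x y" "x \<notin> set (w # st')" "h' x = Suc w'" "w # st' = ys @ w' # zs"
    show "y \<notin> set ys"
    proof (cases ys)
      case (Cons a ys')
      then have "w' \<in> set st'" using *(4) by auto
      then have "w' \<noteq> w" "w' \<noteq> u" using st_distinct st by auto
      then have hx: "h x = Suc w'" using *(3) h'_eq by auto
      then have "x \<notin> set st" using * u \<open>w' \<noteq> u\<close> st by auto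
      from no_cross[OF *(1) this hx, of "u # ys" zs] show ?thesis using st *(4) by auto
    qed simp
  next
    fix w' x assume *: "w' \<in> set (w # st')" "x < n" "h' x = Suc w'" "c' x = w'"
    then have "h x \<noteq> Suc u" using u(4) unfolding c' by auto
    then show "x = w'" using own[of w' x] * st unfolding h' c' by auto
  next
    fix w' i x assume *: "w' \<in> set (w # st')" "i \<noteq> w'" "x < n" "h' x = Suc w'" "c' x = i"
    show "i < n \<and> h' i = Suc w' \<and> c' i = i \<and> R i w' \<and>
      conn R {x. x < n \<and> h' x = Suc w' \<and> c' x = i} \<and>
      2 * card {x. x < n \<and> h' x = Suc w' \<and> c' x = i} \<le> n"
    proof (cases "h x = Suc u")
      case True
      then have "i = u" "w' = w" using * unfolding h' c' by auto
      \<comment> \<open>The name \<open>u\<close> is still fresh below \<open>w\<close>: a component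
        of that name would force \<open>u\<close> to hang from \<open>w\<close>, but
        \<open>u\<close> hangs from itself.\<close>
      have not_u: "c y \<noteq> u" if "y < n" "h y = Suc w" for y
      proof
        assume "c y = u"
        from comps[OF _ _ that this] show False using u st by auto
      qed
      have "{x. x < n \<and> h' x = Suc w \<and> c' x = u} = {x. x < n \<and> h x = Suc u}"
        using not_u u unfolding h' c' by auto
      then show ?thesis unfolding \<open>i = u\<close> \<open>w' = w\<close>
        using subtree_conn[of u] st small u unfolding h' c' by auto
    next
      case False
      then have x: "h x = Suc w'" "c x = i" using * unfolding h' c' by auto
      have i: "i < n \<and> h i = Suc w' \<and> c i = i \<and> R i w' \<and>
        conn R {x. x < n \<and> h x = Suc w' \<and> c x = i} \<and>
        2 * card {x. x < n \<and> h x = Suc w' \<and> c x = i} \<le> n"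
        by (rule comps[OF _ *(2,3) x]) (use * st in auto)
      have "i \<noteq> u" "w' \<noteq> u" using i * u by auto
      then have "{x. x < n \<and> h' x = Suc w' \<and> c' x = i} = {x. x < n \<and> h x = Suc w' \<and> c x = i}"
        unfolding h' c' by auto
      then show ?thesis using i \<open>w' \<noteq> u\<close> unfolding h' c' by auto
    qed
  qed
qed

end

text \<open>With root 0 the all-zero array \<open>c\<close> already satisfies the invariant; at
  undiscovered vertices its value is irrelevant.\<close>

lemma (in ngraph) dfs_init:
  assumes "0 < n"
  shows "dfs_state n R [0] ((\<lambda>_. 0)(0 := 1)) (\<lambda>_. 0) p"
proof unfold_locales
  fix x y w :: nat and ys zs :: "nat list"
  assume "[0] = ys @ w # zs"
  then show "y \<notin> set ys" by (cases ys) auto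
qed (use assms in \<open>auto split: if_splits\<close>)

subsection \<open>Pieces around a root\<close>

text \<open>A labelling of the vertices by piece names: \<open>v\<close> names the piece of the root \<open>v\<close> itself and
  \<open>n\<close> the piece \<open>A\<close> outside the subtree of \<open>v\<close>.\<close>

definition star_pieces :: "nat \<Rightarrow> (nat \<Rightarrow> nat \<Rightarrow> bool) \<Rightarrow> nat \<Rightarrow> (nat \<Rightarrow> nat) \<Rightarrow> bool" where
  "star_pieces n R v C \<longleftrightarrow> v < n \<and> C v = v \<and> (\<forall>x<n. C x \<le> n) \<and> (\<forall>i. conn R (cls n C i)) \<and>
    (\<forall>i. i \<noteq> v \<longrightarrow> cls n C i \<noteq> {} \<longrightarrow> (\<exists>a\<in>cls n C i. \<exists>b\<in>cls n C v. R a b)) \<and>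
    (\<forall>i. i \<noteq> v \<longrightarrow> 2 * card (cls n C i) \<le> n)"

text \<open>The last clause is the absence of cross edges between subtrees. It exempts
  \<open>A\<close> (named \<open>n\<close>) and the root, through which the subtrees may still be
  linked.\<close>

definition subtree_pieces :: "nat \<Rightarrow> (nat \<Rightarrow> nat \<Rightarrow> bool) \<Rightarrow> nat \<Rightarrow> (nat \<Rightarrow> nat) \<Rightarrow> bool" where
  "subtree_pieces n R v C \<longleftrightarrow> star_pieces n R v C \<and> (\<forall>x<n. C x = v \<longrightarrow> x = v) \<and>
    (\<forall>x y. R x y \<longrightarrow> C x \<notin> {n, v} \<longrightarrow> C y \<notin> {n, v} \<longrightarrow> C x = C y)"

text \<open>The final inequality keeps the remainder small and also shows that the absorbing branch
  of the edge loop cannot fire any more.\<close>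

definition three_pieces :: "nat \<Rightarrow> (nat \<Rightarrow> nat \<Rightarrow> bool) \<Rightarrow> nat \<Rightarrow> (nat \<Rightarrow> nat) \<Rightarrow> nat \<Rightarrow> bool" where
  "three_pieces n R v C i \<longleftrightarrow> star_pieces n R v C \<and> 2 * card (cls n C v) \<le> n \<and> i \<noteq> n \<and> i \<noteq> v \<and>
     (\<forall>x<n. C x \<in> {n, i, v}) \<and> n < 2 * (card (cls n C n) + card (cls n C i))"

text \<open>The two outcomes of the merging: the pieces other than \<open>{v}\<close> are the
  components of \<open>G - v\<close>, or every piece has at most \<open>n / 2\<close> vertices and
  at most two pieces avoid the root.\<close>

definition final_pieces :: "nat \<Rightarrow> (nat \<Rightarrow> nat \<Rightarrow> bool) \<Rightarrow> nat \<Rightarrow> (nat \<Rightarrow> nat) \<Rightarrow> bool" where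
  "final_pieces n R v C \<longleftrightarrow> star_pieces n R v C \<and>
    ((\<forall>x<n. C x = v \<longrightarrow> x = v) \<and> (\<forall>x y. R x y \<longrightarrow> x \<noteq> v \<longrightarrow> y \<noteq> v \<longrightarrow> C x = C y) \<or>
     2 * card (cls n C v) \<le> n \<and> (\<exists>i. \<forall>x<n. C x \<in> {n, i, v}))"

lemma cls_cong: "(\<And>x. x < n \<Longrightarrow> f x = g x) \<Longrightarrow> cls n f i = cls n g i"
  by (auto simp: cls_def)

lemma card_cls_compl: "card {x. x < n \<and> f x \<noteq> i} = n - card (cls n f i)"
proof -
  have "{x. x < n \<and> f x \<noteq> i} = {..<n} - cls n f i" by auto
  then show ?thesis by (simp add: card_Diff_subset subset_eq)
qed

context dfs_state
begin

text \<open>The work lies in the connectedness of the complement \<open>A\<close> of the subtree: a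
  non-empty subset closed in \<open>A\<close> meets the stack below \<open>v\<close> and then
  contains the parent of \<open>v\<close>. The size bound on \<open>A\<close> is the complement of
  \<open>large\<close>, and those on the children's subtrees are the invariant
  \<open>comps\<close>.\<close>

lemma subtree_pieces_centroid:
  assumes st: "st = v # st'" and nw: "\<And>y. R v y \<Longrightarrow> h y \<noteq> 0"
    and large: "n < 2 * card {x. x < n \<and> h x = Suc v}"
    and C: "\<And>x. x < n \<Longrightarrow> C x = (if h x = Suc v then c x else n)"
  shows "subtree_pieces n R v C"
proof -
  have v: "v < n" "h v = Suc v" "c v = v" "v \<in> set st" "v \<notin> set st'"
    using st st_bound on_stack st_distinct by auto
  have cn: "c x < n" if "x < n" "h x = Suc v" for x
    using comps[OF v(4) _ that refl] v(1) by (cases "c x = v") auto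
  have Cv: "x = v" if "x < n" "C x = v" for x
    using own[OF v(4), of x] that C[of x] v(1) by (auto split: if_splits)
  define A where "A = {x. x < n \<and> h x \<noteq> Suc v}"
  have A: "cls n C n = A" unfolding A_def using cn C by (auto split: if_splits) (metis less_irrefl)
  have D: "cls n C i = {x. x < n \<and> h x = Suc v \<and> c x = i}" if "i \<noteq> n" for i
    using that C by (auto split: if_splits)
  have st'_h: "h w = Suc w" "w \<noteq> v" "w < n" if "w \<in> set st'" for w
    using that on_stack[of w] st v(5) st_bound by auto
  have back_to_stack: "\<exists>w\<in>set st'. w \<in> S" if S: "S \<subseteq> A" "S \<noteq> {}"
    "\<And>x y. x \<in> S \<Longrightarrow> y \<in> A \<Longrightarrow> R x y \<Longrightarrow> y \<in> S" for S
  proof (rule ccontr)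
    assume no: "\<not> ?thesis"
    \<comment> \<open>From a finished vertex, closure leads through its component to the naming
      vertex and on to a stack vertex, which \<open>S\<close> avoids by assumption.\<close>
    have white: "h x = 0" if x: "x \<in> S" for x
    proof (rule ccontr)
      assume "h x \<noteq> 0"
      have xA: "x < n" "h x \<noteq> Suc v" using x S(1) A_def by auto
      with hangs \<open>h x \<noteq> 0\<close> obtain w where w: "w \<in> set st" "h x = Suc w" by blast
      then have "w \<in> set st'" using st xA by auto
      have "x \<noteq> w" using no x \<open>w \<in> set st'\<close> by auto
      let ?D = "{y. y < n \<and> h y = Suc w \<and> c y = c x}"
      have "c x \<noteq> w" using own[OF w(1) xA(1) w(2)] \<open>x \<noteq> w\<close> by auto
      from comps[OF w(1) this xA(1) w(2) refl]
      have D: "conn R ?D" "c x \<in> ?D" "R (c x) w" by auto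
      have "c x \<in> S"
      proof (rule connD[OF D(1) _ x _ D(2)])
        fix a b assume "a \<in> S" "b \<in> ?D" "R a b"
        then show "b \<in> S" using S(3)[of a b] st'_h[OF \<open>w \<in> set st'\<close>] A_def by auto
      qed (use xA w in auto)
      then have "w \<in> S" using S(3) D(3) st'_h[OF \<open>w \<in> set st'\<close>] A_def by auto
      then show False using no \<open>w \<in> set st'\<close> by blast
    qed
    obtain x where "x \<in> S" using S(2) by blast
    \<comment> \<open>A set of undiscovered vertices closed in \<open>A\<close> is closed in the
      whole graph, because neither \<open>v\<close> nor a finished vertex below it has an
      undiscovered neighbour. Connectedness of the graph then puts \<open>v\<close> into
      \<open>S\<close>, although \<open>v\<close> is not in \<open>A\<close>.\<close>
    have "v \<in> S"
    proof (rule connD[OF connected _ \<open>x \<in> S\<close>])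
      fix a b assume ab: "a \<in> S" "a \<in> {..<n}" "b \<in> {..<n}" "R a b"
      have "h a = 0" using white ab by blast
      show "b \<in> S"
      proof (rule S(3)[OF ab(1) _ ab(4)])
        have "b \<noteq> v" using nw[OF R_sym, of a] ab \<open>h a = 0\<close> by auto
        moreover have "h b \<noteq> Suc v" if "b \<noteq> v"
        proof
          assume "h b = Suc v"
          then have "b \<notin> set st" using on_stack[of b] that by auto
          then show False using no_white[OF R_sym[OF ab(4)]] \<open>h b = Suc v\<close> \<open>h a = 0\<close> by auto
        qed
        ultimately show "b \<in> A" unfolding A_def using ab by auto
      qed
    qed (use \<open>x \<in> S\<close> S(1) A_def v in auto)
    then show False using S(1) v A_def by auto
  qed
  \<comment> \<open>The stack below \<open>v\<close> is a path inside \<open>A\<close>, so a closed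
    set climbs along it up to the head of \<open>st'\<close>, the parent of
    \<open>v\<close>.\<close>
  have path_closed: "hd st' \<in> S" if "w \<in> set st'" "w \<in> S" 
    "\<And>x y. x \<in> S \<Longrightarrow> y \<in> A \<Longrightarrow> R x y \<Longrightarrow> y \<in> S" for S w
  proof -
    have "set st' \<subseteq> A" using st'_h A_def by auto
    moreover have "successively (\<lambda>u w. R u w) st'"
      using st_path st by (auto simp: successively_Cons intro: successively_mono)
    ultimately show ?thesis using that(1,2)
    proof (induction st' arbitrary: w)
      case (Cons a st')
      show ?case
      proof (cases "w = a")
        case False
        then have "w \<in> set st'" "st' \<noteq> []" using Cons.prems by auto
        then have "hd st' \<in> S" using Cons by (auto simp: successively_Cons)
        moreover have "R (hd st') a" using Cons.prems(2) \<open>st' \<noteq> []\<close> R_sym by (auto simp: successively_Cons)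
        ultimately show ?thesis using that(3) Cons.prems(1) by auto
      qed (use Cons in auto)
    qed simp
  qed
  have A_conn: "conn R A" and A_adj: "A \<noteq> {} \<Longrightarrow> \<exists>a\<in>A. R a v"
  proof -
    have *: "st' \<noteq> []" if "A \<noteq> {}" using back_to_stack[of A] that by auto
    have hd: "hd st' \<in> A" "R (hd st') v" if "A \<noteq> {}"
      using *[OF that] st'_h[of "hd st'"] st_path st R_sym unfolding A_def
      by (auto simp: successively_Cons)
    show "conn R A"
    proof (cases "A = {}")
      case False
      show ?thesis
      proof (rule conn_rooted[OF symp hd(1)[OF False]])
        fix S x assume S: "S \<subseteq> A" "x \<in> S" "\<And>x y. x \<in> S \<Longrightarrow> y \<in> A \<Longrightarrow> R x y \<Longrightarrow> y \<in> S"
        then obtain w where "w \<in> set st'" "w \<in> S" using back_to_stack[of S] by auto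
        then show "hd st' \<in> S" using path_closed[of w S] S(3) by blast
      qed
    qed simp
    show "\<exists>a\<in>A. R a v" if "A \<noteq> {}" using hd that by blast
  qed
  have "2 * card A \<le> n"
    using large card_cls_compl[of n h "Suc v"] unfolding A_def cls_def by auto
  have piece: "i \<in> cls n C i \<and> R i v \<and> conn R (cls n C i) \<and> 2 * card (cls n C i) \<le> n"
    if i: "i \<noteq> n" "i \<noteq> v" "cls n C i \<noteq> {}" for i
  proof -
    obtain x where "x < n" "h x = Suc v" "c x = i" using i(3) unfolding D[OF i(1)] by blast
    from comps[OF v(4) i(2) this] show ?thesis unfolding D[OF i(1)] by blast
  qed
  have conn: "conn R (cls n C i)" for i
  proof (cases "i = n \<or> i = v \<or> cls n C i = {}")
    case True
    have "C v = v" using v C by simp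
    then have "x \<in> cls n C v \<longleftrightarrow> x \<in> {v}" for x using Cv[of x] v(1) by auto
    then have "cls n C v = {v}" by blast
    then show ?thesis using True A A_conn by auto
  qed (use piece in blast)
  have adj: "\<exists>a\<in>cls n C i. R a v" if "i \<noteq> v" "cls n C i \<noteq> {}" for i
    using A A_adj piece[OF _ that] that(2) by (cases "i = n") auto
  have small: "2 * card (cls n C i) \<le> n" if "i \<noteq> v" for i
    using A \<open>2 * card A \<le> n\<close> piece[OF _ that]
    by (cases "i = n"; cases "cls n C i = {}") simp_all
  have same: "C x = C y" if "R x y" "C x \<notin> {n, v}" "C y \<notin> {n, v}" for x y
  proof -
    have xy: "x < n" "y < n" using that bounded bounded' by auto
    have h: "h x = Suc v" "h y = Suc v" using that xy C by (auto split: if_splits)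
    then have "x \<notin> set st" "y \<notin> set st" using that on_stack C xy v by force+
    then show ?thesis using same_comp[OF that(1)] h C xy by auto
  qed
  have "\<forall>x<n. C x \<le> n" using C cn by (auto simp: less_imp_le)
  moreover have "C v = v" using v C by simp
  moreover have "v \<in> cls n C v" using v(1) \<open>C v = v\<close> by simp
  then have "\<exists>a\<in>cls n C i. \<exists>b\<in>cls n C v. R a b" if "i \<noteq> v" "cls n C i \<noteq> {}" for i
    using adj[OF that] by blast
  ultimately show ?thesis unfolding subtree_pieces_def star_pieces_def
    using conn small same Cv v(1) by (intro conjI allI impI) blast+
qed

end

context ngraph
begin

text \<open>The edge \<open>R x y\<close> keeps the enlarged \<open>A\<close> connected. The clause
  on cross edges needs no new argument, because it exempts the name \<open>n\<close>.\<close>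

lemma subtree_pieces_absorb:
  assumes C: "subtree_pieces n R v C" and i: "i \<noteq> n" "i \<noteq> v"
    and e: "R x y" "C x = n" "C y = i"
    and small: "2 * (card (cls n C n) + card (cls n C i)) \<le> n"
    and C': "\<And>x. x < n \<Longrightarrow> C' x = (if C x = i then n else C x)"
  shows "subtree_pieces n R v C'"
proof -
  have xy: "x \<in> cls n C n" "y \<in> cls n C i" using e bounded bounded' by auto
  have v: "v < n" "C v = v" using C unfolding subtree_pieces_def star_pieces_def by auto
  have cls_C': "cls n C' j = cls n (\<lambda>x. if C x = i then n else C x) j" for j
    by (rule cls_cong[OF C'])
  have n: "cls n C' n = cls n C n \<union> cls n C i" unfolding cls_C' using i by (auto split: if_splits)
  have "cls n C' i = {}" unfolding cls_C' using i by (auto split: if_splits)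
  have j: "cls n C' j = cls n C j" if "j \<noteq> n" "j \<noteq> i" for j
    unfolding cls_C' using that by (auto split: if_splits)
  have "conn R (cls n C' n)" unfolding n
    by (rule conn_Un[OF symp _ _ xy e(1)])
      (use C in \<open>auto simp: subtree_pieces_def star_pieces_def\<close>)
  then have conn: "conn R (cls n C' j)" for j
    using j[of j] \<open>cls n C' i = {}\<close> C
    by (cases "j = n"; cases "j = i") (auto simp: subtree_pieces_def star_pieces_def)
  have "card (cls n C' n) = card (cls n C n) + card (cls n C i)"
    unfolding n by (rule card_Un_disjoint) (use i in auto)
  then have card: "2 * card (cls n C' j) \<le> n" if "j \<noteq> v" for j
    using j[of j] \<open>cls n C' i = {}\<close> C small that
    by (cases "j = n"; cases "j = i") (auto simp: subtree_pieces_def star_pieces_def)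
  have nv: "cls n C' v = cls n C v" using j[of v] v(1) i by simp
  have adj_C: "\<exists>a\<in>cls n C j. \<exists>b\<in>cls n C v. R a b" if "j \<noteq> v" "cls n C j \<noteq> {}" for j
    using C that unfolding subtree_pieces_def star_pieces_def by blast
  have adj: "\<exists>a\<in>cls n C' j. \<exists>b\<in>cls n C' v. R a b" if "j \<noteq> v" "cls n C' j \<noteq> {}" for j
  proof (cases "j = n")
    case True
    show ?thesis using adj_C[of n] that(1) xy(1) unfolding nv True n by blast
  next
    case False
    then have "j \<noteq> i" using that \<open>cls n C' i = {}\<close> by blast
    then show ?thesis using adj_C[OF that(1)] that(2) unfolding nv j[OF False \<open>j \<noteq> i\<close>] by blast
  qed
  have "C' v = v" using C' v i by auto
  moreover have "\<forall>x<n. C' x \<le> n" using C C' unfolding subtree_pieces_def star_pieces_def by auto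
  moreover have "\<forall>x<n. C' x = v \<longrightarrow> x = v" using C C' v unfolding subtree_pieces_def by auto
  moreover have "C' a = C' b" if "R a b" "C' a \<notin> {n, v}" "C' b \<notin> {n, v}" for a b
    using C that C' bounded[OF that(1)] bounded'[OF that(1)] unfolding subtree_pieces_def
    by (auto split: if_splits)
  ultimately show ?thesis unfolding subtree_pieces_def star_pieces_def
    using conn card adj v by auto
qed

text \<open>All vertices outside \<open>A\<close> and the piece \<open>i\<close> are recoloured
  \<open>v\<close>. They form a star of connected pieces attached to \<open>v\<close>, as the old
  root piece is the single vertex \<open>v\<close>.\<close>

lemma three_pieces_overflow:
  assumes C: "subtree_pieces n R v C" and i: "i \<noteq> n" "i \<noteq> v" and ne: "cls n C i \<noteq> {}"
    and large: "n < 2 * (card (cls n C n) + card (cls n C i))"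
    and C': "\<And>x. x < n \<Longrightarrow> C' x = (if C x \<noteq> n \<and> C x \<noteq> i then v else C x)"
  shows "three_pieces n R v C' i"
proof -
  have v: "v < n" "C v = v" "cls n C v = {v}"
    using C unfolding subtree_pieces_def star_pieces_def by auto
  have cls_C': "cls n C' j = cls n (\<lambda>x. if C x \<noteq> n \<and> C x \<noteq> i then v else C x) j" for j
    by (rule cls_cong[OF C'])
  have ni: "cls n C' j = cls n C j" if "j = n \<or> j = i" for j
    unfolding cls_C' using that i v(1) by (auto split: if_splits)
  have rest: "cls n C' j = {}" if "j \<noteq> n" "j \<noteq> i" "j \<noteq> v" for j
    unfolding cls_C' using that by (auto split: if_splits)
  have cv: "cls n C' v = {..<n} - (cls n C n \<union> cls n C i)"
    unfolding cls_C' using i v(1) by (auto split: if_splits)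
  have "card (cls n C n \<union> cls n C i) = card (cls n C n) + card (cls n C i)"
    by (rule card_Un_disjoint) (use i in auto)
  moreover have "card (cls n C' v) = card {..<n} - card (cls n C n \<union> cls n C i)"
    unfolding cv by (rule card_Diff_subset) auto
  ultimately have small: "2 * card (cls n C' v) \<le> n" using large by simp
  have adj: "\<exists>a\<in>cls n C j. R a v" if "j \<noteq> v" "cls n C j \<noteq> {}" for j
    using C that v(3) unfolding subtree_pieces_def star_pieces_def by auto
  have vC': "v \<in> cls n C' v" using cv v i by auto
  have "conn R (cls n C' v)"
  proof (rule conn_star[OF symp vC'])
    fix x assume x: "x \<in> cls n C' v"
    show "\<exists>D\<subseteq>cls n C' v. x \<in> D \<and> v \<in> D \<and> conn R D"
    proof (cases "x = v")
      case False
      then have Cx: "C x \<noteq> v" "C x \<noteq> n" "C x \<noteq> i" "x < n"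
        using x cv v(3) by auto
      then have "x \<in> cls n C (C x)" by simp
      with adj[of "C x"] Cx obtain a where "a \<in> cls n C (C x)" "R a v" by blast
      then have "conn R (insert v (cls n C (C x)))"
        using C by (intro conn_insert[OF symp]) (auto simp: subtree_pieces_def star_pieces_def)
      moreover have "insert v (cls n C (C x)) \<subseteq> cls n C' v"
        using Cx vC' unfolding cv by auto
      ultimately show ?thesis
        using Cx(4) by (intro exI[of _ "insert v (cls n C (C x))"]) simp
    qed (use vC' in \<open>auto intro!: exI[of _ "{v}"]\<close>)
  qed
  then have conn: "conn R (cls n C' j)" for j
    using ni[of j] rest[of j] C 
    by (cases "j = n \<or> j = i"; cases "j = v") (auto simp: subtree_pieces_def star_pieces_def)
  have adj': "\<exists>a\<in>cls n C' j. \<exists>b\<in>cls n C' v. R a b" if "j \<noteq> v" "cls n C' j \<noteq> {}" for j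
    using adj[of j] ni[of j] rest[of j] that vC' by blast
  have card: "2 * card (cls n C' j) \<le> n" if "j \<noteq> v" for j
    using ni[of j] rest[of j] C that unfolding subtree_pieces_def star_pieces_def
    by (cases "j = n \<or> j = i") auto
  have "\<forall>x<n. C' x \<le> n" "C' v = v"
    using C C' v i unfolding subtree_pieces_def star_pieces_def by auto
  then show ?thesis unfolding three_pieces_def star_pieces_def
    using conn adj' card small v i large C' ni by auto
qed

text \<open>The edge loop has no early exit: when the overflow branch fires again, its relabelling
  must change nothing.\<close>

lemma three_pieces_stable:
  assumes C: "three_pieces n R v C i"
    and C': "\<And>x. x < n \<Longrightarrow> C' x = (if C x \<noteq> n \<and> C x \<noteq> i then v else C x)"
  shows "three_pieces n R v C' i"
proof -
  have "C' x = C x" if "x < n" for x using C' C that unfolding three_pieces_def by auto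
  moreover from this have "cls n C' j = cls n C j" for j by (rule cls_cong)
  moreover have "v < n" using C unfolding three_pieces_def star_pieces_def by auto
  ultimately show ?thesis using C unfolding three_pieces_def star_pieces_def by auto
qed

end

subsection \<open>Selecting the largest pieces\<close>

text \<open>After \<open>j\<close> selections, \<open>pt x\<close> is the part of \<open>x\<close>, with \<open>0\<close> for the part of the root, and
  the working copy \<open>c\<close> of the piece names \<open>C\<close> has all selected pieces merged into the piece of \<open>v\<close>.\<close>

definition selection ::
  "nat \<Rightarrow> nat \<Rightarrow> (nat \<Rightarrow> nat) \<Rightarrow> nat \<Rightarrow> (nat \<Rightarrow> nat) \<Rightarrow> (nat \<Rightarrow> nat) \<Rightarrow> bool" where
  "selection n v C j pt c \<longleftrightarrow>
    (\<forall>x<n. pt x \<le> j) \<and>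
    (\<forall>x<n. pt x \<noteq> 0 \<longrightarrow> C x \<noteq> v \<and> cls n C (C x) = cls n pt (pt x)) \<and>
    (\<forall>x<n. c x = (if pt x = 0 then C x else v)) \<and>
    (\<forall>x<n. \<forall>y<n. pt x \<noteq> 0 \<longrightarrow> pt y = 0 \<longrightarrow> C y \<noteq> v \<longrightarrow>
       card (cls n C (C y)) \<le> card (cls n C (C x))) \<and>
    (j \<le> card (C ` {x. x < n \<and> pt x \<noteq> 0}) \<or> (\<forall>y<n. pt y = 0 \<longrightarrow> C y = v))"

lemma cls_eqI: "(\<And>x. x < n \<Longrightarrow> f x = i \<longleftrightarrow> g x = j) \<Longrightarrow> cls n f i = cls n g j"
  by (auto simp: cls_def)

lemma selection_init:
  "(\<And>x. x < n \<Longrightarrow> pt x = 0) \<Longrightarrow> (\<And>x. x < n \<Longrightarrow> c x = C x) \<Longrightarrow> selection n v C 0 pt c"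
  unfolding selection_def by auto

lemma selection_same:
  assumes "selection n v C j pt c" "x < n" "y < n" "pt x \<noteq> 0" "C y = C x"
  shows "pt y = pt x"
proof -
  have "cls n C (C x) = cls n pt (pt x)" using assms unfolding selection_def by blast
  moreover have "y \<in> cls n C (C x)" using assms by simp
  ultimately show ?thesis by simp
qed

text \<open>In the working copy \<open>c\<close> the selected pieces have disappeared into the name
  \<open>v\<close>, so the class of \<open>b\<close> is exactly an unselected piece, and a largest
  one. If this class is empty, every piece has been selected, the step is void and the part
  \<open>Suc j\<close> stays empty until the refinement.\<close>

lemma selection_step:
  assumes s: "selection n v C j pt c" and b: "b \<noteq> v" and C: "\<And>x. x < n \<Longrightarrow> C x \<le> n"
    and max: "\<And>i. i \<le> n \<Longrightarrow> i \<noteq> v \<Longrightarrow> card (cls n c i) \<le> card (cls n c b)"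
    and pt': "\<And>x. x < n \<Longrightarrow> pt' x = (if c x = b then Suc j else pt x)"
    and c': "\<And>x. x < n \<Longrightarrow> c' x = (if c x = b then v else c x)"
  shows "selection n v C (Suc j) pt' c'"
proof -
  have s1: "pt x \<le> j" if "x < n" for x using s that unfolding selection_def by blast
  have s2: "C x \<noteq> v" "cls n C (C x) = cls n pt (pt x)" if "x < n" "pt x \<noteq> 0" for x
    using s that unfolding selection_def by blast+
  have s3: "c x = (if pt x = 0 then C x else v)" if "x < n" for x
    using s that unfolding selection_def by blast
  have s4: "card (cls n C (C y)) \<le> card (cls n C (C x))"
    if "x < n" "y < n" "pt x \<noteq> 0" "pt y = 0" "C y \<noteq> v" for x y
    using s that unfolding selection_def by blast
  have s5: "j \<le> card (C ` {x. x < n \<and> pt x \<noteq> 0}) \<or> (\<forall>y<n. pt y = 0 \<longrightarrow> C y = v)"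
    using s unfolding selection_def by blast
  have cb: "c x = b \<longleftrightarrow> pt x = 0 \<and> C x = b" if "x < n" for x using s3[OF that] b by auto
  show ?thesis
  proof (cases "cls n c b = {}")
    case True
    have all: "C x = v" if x: "x < n" "pt x = 0" for x
    proof (rule ccontr)
      assume "C x \<noteq> v"
      have "cls n c (C x) = {}"
        using max[OF C[OF x(1)] \<open>C x \<noteq> v\<close>] True by simp
      moreover have "x \<in> cls n c (C x)" using s3[OF x(1)] x by simp
      ultimately show False by blast
    qed
    have eq: "pt' x = pt x" "c' x = c x" if "x < n" for x
      using True that pt'[OF that] c'[OF that] by auto
    have "cls n pt' i = cls n pt i" for i by (rule cls_cong) (rule eq)
    then show ?thesis unfolding selection_def using s1 s2 s3 s4 all by (auto simp: eq le_SucI)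
  next
    case False
    \<comment> \<open>Pieces are selected as a whole: one unselected vertex in the piece
      \<open>b\<close> shows that all of its vertices are unselected.\<close>
    have sub: "cls n C b = cls n c b"
    proof
      show "cls n c b \<subseteq> cls n C b" using cb unfolding cls_def by blast
      show "cls n C b \<subseteq> cls n c b"
      proof
        fix x assume x: "x \<in> cls n C b"
        obtain y where y: "y \<in> cls n c b" using False by blast
        have "pt x = 0"
        proof (rule ccontr)
          assume "pt x \<noteq> 0"
          moreover have "y < n" "C y = b" "pt y = 0" using y cb unfolding cls_def by blast+
          ultimately show False using selection_same[OF s, of x y] x by simp
        qed
        then show "x \<in> cls n c b" using x cb unfolding cls_def by blast
      qed
    qed
    have in_b: "c x = b \<longleftrightarrow> C x = b" if "x < n" for x
      using sub that unfolding cls_def by blast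
    have new: "cls n pt' (Suc j) = cls n C b"
    proof -
      have "pt' x = Suc j \<longleftrightarrow> c x = b" if "x < n" for x using pt'[OF that] s1[OF that] by auto
      then show ?thesis unfolding sub by (rule cls_eqI)
    qed
    have old: "cls n pt' i = cls n pt i" if "i \<noteq> 0" "i \<noteq> Suc j" for i
    proof -
      have "pt' x = i \<longleftrightarrow> pt x = i" if x: "x < n" for x
        using pt'[OF x] cb[OF x] \<open>i \<noteq> 0\<close> \<open>i \<noteq> Suc j\<close> by auto
      then show ?thesis by (rule cls_eqI)
    qed
    have pt0: "pt' x \<noteq> 0 \<longleftrightarrow> pt x \<noteq> 0 \<or> C x = b" if "x < n" for x
      using pt'[OF that] in_b[OF that] by auto
    show ?thesis unfolding selection_def
    proof (intro conjI allI impI)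
      fix x assume x: "x < n"
      show "pt' x \<le> Suc j" using pt'[OF x] s1[OF x] by auto
      show "c' x = (if pt' x = 0 then C x else v)"
        using c'[OF x] pt'[OF x] s3[OF x] by auto
      assume "pt' x \<noteq> 0"
      then have "pt x \<noteq> 0 \<or> C x = b" using pt0[OF x] by blast
      then show "C x \<noteq> v" using b s2(1)[OF x] by auto
      show "cls n C (C x) = cls n pt' (pt' x)"
      proof (cases "C x = b")
        case True
        then show ?thesis using new pt'[OF x] in_b[OF x] by simp
      next
        case False
        then have "pt x \<noteq> 0" "pt' x = pt x" using \<open>pt x \<noteq> 0 \<or> C x = b\<close> pt'[OF x] in_b[OF x] by auto
        then show ?thesis using s2(2)[OF x] old[of "pt x"] s1[OF x] by simp
      qed
    next
      fix x y assume *: "x < n" "y < n" "pt' x \<noteq> 0" "pt' y = 0" "C y \<noteq> v"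
      have y: "pt y = 0" "C y \<noteq> b" using pt0[OF *(2)] *(4) by auto
      show "card (cls n C (C y)) \<le> card (cls n C (C x))"
      proof (cases "pt x = 0")
        case True
        then have "C x = b" using pt0 * by auto
        have "cls n c (C y) = cls n C (C y)"
        proof -
          have "c z = C y \<longleftrightarrow> C z = C y" if z: "z < n" for z
          proof
            assume "C z = C y"
            have "pt z = 0"
            proof (rule ccontr)
              assume "pt z \<noteq> 0"
              then show False using selection_same[OF s z *(2)] \<open>C z = C y\<close> y(1) by simp
            qed
            then show "c z = C y" using s3[OF z] \<open>C z = C y\<close> by simp
          qed (use s3[OF z] *(5) in \<open>auto split: if_splits\<close>)
          then show ?thesis by (rule cls_eqI)
        qed
        then show ?thesis using max[OF C[OF *(2)] *(5)] sub \<open>C x = b\<close> by simp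
      qed (use s4 * y in auto)
    next
      let ?S = "C ` {x. x < n \<and> pt x \<noteq> 0}" and ?S' = "C ` {x. x < n \<and> pt' x \<noteq> 0}"
      show "Suc j \<le> card ?S' \<or> (\<forall>y<n. pt' y = 0 \<longrightarrow> C y = v)"
        using s5
      proof
        assume "j \<le> card ?S"
        obtain y where y: "y < n" "C y = b" "pt y = 0" using False cb unfolding cls_def by blast
        have "b \<notin> ?S"
        proof
          assume "b \<in> ?S"
          then obtain x where x: "x < n" "pt x \<noteq> 0" "C x = b" by auto
          then show False using selection_same[OF s x(1) y(1) x(2)] x y by simp
        qed
        moreover have "?S' = insert b ?S"
        proof -
          have "{x. x < n \<and> pt' x \<noteq> 0} = {x. x < n \<and> pt x \<noteq> 0} \<union> {x. x < n \<and> C x = b}"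
            using pt0 by auto
          then show ?thesis using y by auto
        qed
        ultimately show ?thesis using \<open>j \<le> card ?S\<close> by simp
      qed (use pt0 in blast)
    qed
  qed
qed

text \<open>Twice the size is compared with every feasible partition instead of \<open>OPT\<close>,
  so nothing about the attainment of a minimum is needed before the very end, and all bounds stay in
  the natural numbers.\<close>

definition ratio_le :: "nat \<Rightarrow> (nat \<Rightarrow> nat \<Rightarrow> bool) \<Rightarrow> nat \<Rightarrow> nat \<Rightarrow> bool" where
  "ratio_le n R k m \<longleftrightarrow> (\<forall>Q. partition_on {..<n} Q \<longrightarrow> card Q = k \<longrightarrow> (\<forall>U\<in>Q. conn R U) \<longrightarrow>
     2 * m \<le> k * partition_size Q)"

lemma ratio_le_mono: "ratio_le n R k m \<Longrightarrow> m' \<le> m \<Longrightarrow> ratio_le n R k m'"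
  unfolding ratio_le_def by fastforce

lemma partition_size_ge:
  assumes "partition_on {..<n::nat} Q" "U \<in> Q"
  shows "card U \<le> partition_size Q"
proof -
  have "finite Q" using assms(1) finite_elements by blast
  then show ?thesis unfolding partition_size_def using assms(2) by simp
qed

lemma partition_size_average:
  assumes "partition_on {..<n::nat} Q"
  shows "n \<le> card Q * partition_size Q"
proof -
  have "n = card (\<Union>Q)" unfolding partition_onD1[OF assms, symmetric] by simp
  also have "\<dots> \<le> (\<Sum>U\<in>Q. card U)" by (rule card_Union_le_sum_card)
  also have "\<dots> \<le> card Q * partition_size Q"
    using sum_bounded_above[of Q card] partition_size_ge[OF assms] by simp
  finally show ?thesis .
qed

context ngraph
begin

text \<open>The \<open>k\<close> parts of \<open>Q\<close> cover \<open>n\<close> vertices, whence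
  \<open>2 * m \<le> n \<le> k * partition_size Q\<close>.\<close>

lemma ratio_le_half: "2 * m \<le> n \<Longrightarrow> ratio_le n R k m"
  unfolding ratio_le_def using partition_size_average order_trans by blast

text \<open>Let \<open>Q0\<close> be the part of \<open>Q\<close> containing \<open>v\<close>. Each
  of the \<open>j\<close> other parts is connected and avoids \<open>v\<close>, so it lies in one
  component of \<open>G - v\<close>. These at most \<open>j\<close> components cover the complement
  of \<open>Q0\<close> and are together no larger than the selected ones, so the root part has at
  most as many vertices as \<open>Q0\<close>.\<close>

lemma root_part_le:
  assumes C: "\<And>x. x < n \<Longrightarrow> C x = v \<Longrightarrow> x = v"
    "\<And>x y. R x y \<Longrightarrow> x \<noteq> v \<Longrightarrow> y \<noteq> v \<Longrightarrow> C x = C y" and v: "v < n"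
    and s: "selection n v C j pt c" and j: "j \<le> card (C ` {x. x < n \<and> pt x \<noteq> 0})"
    and Q: "partition_on {..<n} Q" "card Q = Suc j" "\<And>U. U \<in> Q \<Longrightarrow> conn R U"
  shows "card (cls n pt 0) \<le> partition_size Q"
proof -
  let ?f = "\<lambda>i. card (cls n C i)" and ?S = "C ` {x. x < n \<and> pt x \<noteq> 0}"
  obtain Q0 where Q0: "Q0 \<in> Q" "v \<in> Q0" using partition_onD1[OF Q(1)] v by blast
  \<comment> \<open>A representative of each part, needed only to read off the component that
    contains the part.\<close>
  define r where "r U = (SOME x. x \<in> U)" for U :: "nat set"
  have finQ: "finite Q" using Q(1) finite_elements by blast
  have r: "r U \<in> U" if "U \<in> Q" for U
    unfolding r_def using partition_onD3[OF Q(1)] that by (metis some_in_eq)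
  have Un: "x < n" if "U \<in> Q" "x \<in> U" for U x using partition_onD1[OF Q(1)] that by blast
  have v_notin: "v \<notin> U" if "U \<in> Q - {Q0}" for U
    using Q0 that partition_onD2[OF Q(1)] unfolding disjoint_def by blast
  have same: "C y = C (r U)" if U: "U \<in> Q - {Q0}" "y \<in> U" for U y
  proof -
    have "y \<in> {y. C y = C (r U)}"
    proof (rule connD[OF Q(3) _ _ _ U(2)])
      fix a b assume "a \<in> {y. C y = C (r U)}" "a \<in> U" "b \<in> U" "R a b"
      then show "b \<in> {y. C y = C (r U)}" using C(2)[of a b] v_notin[OF U(1)] by (cases "a = v"; cases "b = v") auto
    qed (use r U in auto)
    then show ?thesis by simp
  qed
  let ?I = "(\<lambda>U. C (r U)) ` (Q - {Q0})"
  have "card ?I \<le> card (Q - {Q0})" by (rule card_image_le) (use finQ in simp)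
  also have "\<dots> = j" using Q(2) Q0(1) finQ by simp
  finally have "card ?I \<le> card ?S" using j by simp
  have "{..<n} - Q0 \<subseteq> (\<Union>i\<in>?I. cls n C i)"
  proof
    fix x assume x: "x \<in> {..<n} - Q0"
    then obtain U where "U \<in> Q - {Q0}" "x \<in> U" using partition_onD1[OF Q(1)] by blast
    then show "x \<in> (\<Union>i\<in>?I. cls n C i)" using same[of U x] x by auto
  qed
  then have "card ({..<n} - Q0) \<le> card (\<Union>i\<in>?I. cls n C i)"
    using finQ by (intro card_mono) auto
  also have "\<dots> \<le> sum ?f ?I" by (rule card_UN_le) (use finQ in simp)
  \<comment> \<open>A component in \<open>?I - ?S\<close> is represented by an unselected vertex, so
    the selection invariant bounds its size by that of every selected component.\<close>
  also have "\<dots> \<le> sum ?f ?S"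
  proof (rule sum_le_sum_greedy)
    fix i i' assume "i \<in> ?S" "i' \<in> ?I - ?S"
    then obtain x U where x: "x < n" "pt x \<noteq> 0" "i = C x" and U: "U \<in> Q - {Q0}" "i' = C (r U)"
      by blast
    have rU: "r U < n" "r U \<noteq> v" using r[of U] Un[of U] U(1) v_notin[OF U(1)] by auto
    then have "C (r U) \<noteq> v" using C(1) by blast
    moreover have "pt (r U) = 0" using \<open>i' \<in> ?I - ?S\<close> U(2) rU(1) by blast
    ultimately show "?f i' \<le> ?f i" using s x rU(1) U(2) unfolding selection_def by blast
  qed (use finQ \<open>card ?I \<le> card ?S\<close> in auto)
  also have "\<dots> = card (\<Union>i\<in>?S. cls n C i)"
    by (rule card_UN_disjoint[symmetric]) auto
  also have "(\<Union>i\<in>?S. cls n C i) = {x. x < n \<and> pt x \<noteq> 0}"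
  proof -
    have "pt y \<noteq> 0" if "x < n" "pt x \<noteq> 0" "y < n" "C y = C x" for x y
      using selection_same[OF s that(1,3,2,4)] that(2) by simp
    then show ?thesis by auto
  qed
  finally have "card ({..<n} - Q0) \<le> n - card (cls n pt 0)" unfolding card_cls_compl .
  moreover have "Q0 \<subseteq> {..<n}" using Un[OF Q0(1)] by auto
  then have "card ({..<n} - Q0) = n - card Q0"
    by (simp add: card_Diff_subset finite_subset[of _ "{..<n}"])
  moreover have "card (cls n pt 0) \<le> n"
    using card_mono[of "{..<n}" "cls n pt 0"] by (simp add: cls_def subset_eq)
  moreover have "card Q0 \<le> n" using card_mono[of "{..<n}" Q0] \<open>Q0 \<subseteq> {..<n}\<close> by simp
  ultimately show ?thesis using partition_size_ge[OF Q(1) Q0(1)] by linarith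
qed

text \<open>Part \<open>i \<noteq> 0\<close> is a piece of at most \<open>n / 2\<close> vertices.
  For the root part there are three cases: nothing is left to select, so it is the root piece; the
  pieces are components, so \<open>root_part_le\<close> applies; after an overflow, two selections
  already exhaust both outer pieces.\<close>

lemma selection_ratio_le:
  assumes C: "final_pieces n R v C" and s: "selection n v C j pt c" and j: "2 \<le> j"
  shows "ratio_le n R (Suc j) (card (cls n pt i))"
proof (cases "i = 0")
  case False
  have star: "star_pieces n R v C" using C unfolding final_pieces_def by blast
  show ?thesis
  proof (cases "cls n pt i = {}")
    case empty: False
    then obtain x where x: "x < n" "pt x = i" unfolding cls_def by blast
    then have "C x \<noteq> v" "cls n C (C x) = cls n pt i"
      using s False unfolding selection_def by blast+
    moreover from this have "2 * card (cls n C (C x)) \<le> n"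
      using star unfolding star_pieces_def by blast
    ultimately show ?thesis by (simp add: ratio_le_half)
  qed (simp add: ratio_le_half)
next
  case True
  have star: "star_pieces n R v C" using C unfolding final_pieces_def by blast
  have v: "v < n" "C v = v" using star unfolding star_pieces_def by auto
  let ?S = "C ` {x. x < n \<and> pt x \<noteq> 0}"
  have s2: "C x \<noteq> v \<and> cls n C (C x) = cls n pt (pt x)" if "x < n" "pt x \<noteq> 0" for x
    using s that unfolding selection_def by blast
  \<comment> \<open>Covers the root part \<open>{v}\<close>: for small \<open>n\<close> its size 1
    need not be at most \<open>n / 2\<close>, but \<open>2 \<le> Suc j\<close> suffices.\<close>
  have pos: "2 \<le> Suc j * partition_size Q" if Q: "partition_on {..<n} Q" for Q
  proof -
    obtain U where U: "U \<in> Q" "v \<in> U" using partition_onD1[OF Q] v by blast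
    moreover have "finite U" using partition_onD1[OF Q] U(1)
      by (metis Sup_upper finite_lessThan finite_subset)
    ultimately have "0 < card U" by (auto simp: card_gt_0_iff)
    then have "1 \<le> partition_size Q" using partition_size_ge[OF Q U(1)] by simp
    then show ?thesis using mult_le_mono[of 2 "Suc j" 1] j by simp
  qed
  have "2 * card (cls n pt 0) \<le> Suc j * partition_size Q"
    if Q: "partition_on {..<n} Q" "card Q = Suc j" "\<forall>U\<in>Q. conn R U" for Q
  proof (cases "\<forall>y<n. pt y = 0 \<longrightarrow> C y = v")
    case True
    have "cls n pt 0 = cls n C v" by (rule cls_eqI) (use True s2 in blast)
    moreover have "cls n C v = {v}" if "\<forall>x<n. C x = v \<longrightarrow> x = v"
      unfolding cls_def using that v by blast
    then have "2 * card (cls n C v) = 2 \<or> 2 * card (cls n C v) \<le> n"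
      using C unfolding final_pieces_def by auto
    ultimately show ?thesis
      using pos[OF Q(1)] partition_size_average[OF Q(1), unfolded Q(2)] by (metis order_trans)
  next
    case False
    then have S: "j \<le> card ?S" using s unfolding selection_def by blast
    show ?thesis
    proof (cases "(\<forall>x<n. C x = v \<longrightarrow> x = v) \<and> (\<forall>x y. R x y \<longrightarrow> x \<noteq> v \<longrightarrow> y \<noteq> v \<longrightarrow> C x = C y)")
      case True
      have "card (cls n pt 0) \<le> partition_size Q"
        by (rule root_part_le[OF _ _ v(1) s S Q(1,2)]) (use True Q(3) in blast)+
      then show ?thesis using mult_le_mono[of 2 "Suc j"] j by simp
    next
      case not_single: False
      then obtain a where a: "\<forall>x<n. C x \<in> {n, a, v}" using C unfolding final_pieces_def by blast
      have "?S \<subseteq> {n, a}" using a s2 by blast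
      \<comment> \<open>Here \<open>2 \<le> j\<close> matters: at least two distinct names have been
        selected out of only two candidates, so no outer piece remains.\<close>
      moreover have "card {n, a} \<le> card ?S" using S j card_insert_le_m1[of 2 "{a}" n] by simp
      ultimately have "?S = {n, a}" by (simp add: card_seteq)
      have "C y = v" if y: "y < n" "pt y = 0" for y
      proof (rule ccontr)
        assume "C y \<noteq> v"
        then have "C y \<in> ?S" using a y(1) \<open>?S = {n, a}\<close> by blast
        then obtain x where x: "x < n" "pt x \<noteq> 0" "C y = C x" by blast
        then show False using selection_same[OF s x(1) y(1) x(2)] y(2) by simp
      qed
      then show ?thesis using False by blast
    qed
  qed
  then show ?thesis unfolding ratio_le_def True by blast
qed

text \<open>The root part is the root piece together with complete unselected pieces, each of which
  has an edge to the root piece.\<close>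

lemma selection_conn:
  assumes star: "star_pieces n R v C" and s: "selection n v C j pt c"
  shows "conn R (cls n pt i)"
proof (cases "i = 0")
  case False
  show ?thesis
  proof (cases "cls n pt i = {}")
    case empty: False
    then obtain x where x: "x < n" "pt x = i" unfolding cls_def by blast
    then have "cls n C (C x) = cls n pt i" using s False unfolding selection_def by blast
    moreover have "conn R (cls n C (C x))" using star unfolding star_pieces_def by blast
    ultimately show ?thesis by simp
  qed simp
next
  case True
  have v: "v < n" "C v = v" using star unfolding star_pieces_def by auto
  have s2: "C x \<noteq> v \<and> cls n C (C x) = cls n pt (pt x)" if "x < n" "pt x \<noteq> 0" for x
    using s that unfolding selection_def by blast
  have sub: "cls n C (C x) \<subseteq> cls n pt 0" if x: "x < n" "pt x = 0" for x
  proof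
    fix y assume y: "y \<in> cls n C (C x)"
    then show "y \<in> cls n pt 0"
      using selection_same[OF s _ x(1), of y] x(2) by (cases "pt y = 0") auto
  qed
  have "pt v = 0" using s2[of v] v by auto
  then have subv: "cls n C v \<subseteq> cls n pt 0" using sub[of v] v by auto
  show ?thesis unfolding True
  proof (rule conn_star[OF symp, where v = v])
    fix x assume x: "x \<in> cls n pt 0"
    show "\<exists>D\<subseteq>cls n pt 0. x \<in> D \<and> v \<in> D \<and> conn R D"
    proof (cases "C x = v")
      case True
      have "x \<in> cls n C v" "v \<in> cls n C v" using x v True by auto
      moreover have "conn R (cls n C v)" using star unfolding star_pieces_def by blast
      ultimately show ?thesis using subv by blast
    next
      case False
      have xx: "x \<in> cls n C (C x)" using x by simp
      then obtain a b where ab: "a \<in> cls n C (C x)" "b \<in> cls n C v" "R a b"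
        using star False unfolding star_pieces_def by blast
      have "conn R (cls n C (C x) \<union> cls n C v)"
        by (rule conn_Un[OF symp _ _ ab]) (use star in \<open>auto simp: star_pieces_def\<close>)
      moreover have "v \<in> cls n C v" using v by simp
      moreover have "cls n C (C x) \<subseteq> cls n pt 0" using sub x by simp
      ultimately show ?thesis using subv xx
        by (intro exI[of _ "cls n C (C x) \<union> cls n C v"]) blast
    qed
  qed (use v \<open>pt v = 0\<close> in simp)
qed

end

subsection \<open>Splitting parts\<close>

context ngraph
begin

definition partial_parts :: "nat \<Rightarrow> nat \<Rightarrow> (nat \<Rightarrow> nat) \<Rightarrow> bool" where
  "partial_parts k j pt \<longleftrightarrow> (\<forall>x<n. pt x < k) \<and> (\<forall>i. conn R (cls n pt i)) \<and>
    (\<forall>i. ratio_le n R k (card (cls n pt i))) \<and> (\<forall>i<j. cls n pt i \<noteq> {})"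

text \<open>The set of visited vertices is \<open>cls n q 1\<close>, \<open>y\<close> is the start
  and \<open>z\<close> the vertex visited last. Connectedness without \<open>z\<close> is recorded
  because \<open>z\<close> is going to be cut off.\<close>

definition search :: "(nat \<Rightarrow> nat) \<Rightarrow> nat \<Rightarrow> nat \<Rightarrow> (nat \<Rightarrow> nat) \<Rightarrow> nat \<Rightarrow> bool" where
  "search pt l y q z \<longleftrightarrow> cls n q 1 \<subseteq> cls n pt l \<and> y \<in> cls n q 1 \<and> z \<in> cls n q 1 \<and> conn R (cls n q 1) \<and>
     conn R (cls n q 1 - {z}) \<and> (z = y \<longrightarrow> cls n q 1 = {y}) \<and> (\<forall>x<n. q x \<le> 1)"

lemma search_init:
  assumes "y < n" "pt y = l" "\<And>x. x < n \<Longrightarrow> q x = (if x = y then 1 else 0)"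
  shows "search pt l y q y"
proof -
  have "cls n q 1 = {y}" using assms by (auto split: if_splits)
  then show ?thesis unfolding search_def using assms by auto
qed

text \<open>Removing the newest vertex restores the previous visited set, which was
  connected.\<close>

lemma search_insert:
  assumes s: "search pt l y q z" and e: "R x w" "q x = 1" "q w = 0" "pt w = l"
  shows "search pt l y (q(w := 1)) w"
proof -
  have w: "w < n" using e bounded' by auto
  have eq: "cls n (q(w := 1)) 1 = insert w (cls n q 1)" using w by (auto split: if_splits)
  have "conn R (insert w (cls n q 1))"
    by (rule conn_insert[OF symp _ _ e(1)]) (use s e bounded[OF e(1)] in \<open>auto simp: search_def\<close>)
  moreover have "insert w (cls n q 1) - {w} = cls n q 1" using e by auto
  ultimately show ?thesis using s w e unfolding search_def eq by auto
qed

lemma search_complete: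
  assumes s: "search pt l y q z" and c: "conn R (cls n pt l)"
    and no: "\<And>x w. R x w \<Longrightarrow> q x = 1 \<Longrightarrow> q w \<noteq> 0 \<or> pt w \<noteq> l"
  shows "cls n q 1 = cls n pt l"
proof
  show "cls n pt l \<subseteq> cls n q 1"
  proof
    fix w assume w: "w \<in> cls n pt l"
    show "w \<in> cls n q 1"
    proof (rule connD[OF c _ _ _ w])
      fix a b assume ab: "a \<in> cls n q 1" "b \<in> cls n pt l" "R a b"
      have "q b \<le> 1" using s ab unfolding search_def by auto
      then show "b \<in> cls n q 1" using no[OF ab(3)] ab by auto
    qed (use s in \<open>auto simp: search_def\<close>)
  qed
qed (use s in \<open>auto simp: search_def\<close>)

text \<open>The class \<open>l\<close> minus its last visited vertex stays connected. Having at
  least two vertices, it was not exhausted by the start \<open>y\<close>, so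
  \<open>z \<noteq> y\<close> and \<open>y\<close> remains. Neither of the two new parts exceeds the
  old one in size.\<close>

lemma partial_parts_split:
  assumes p: "partial_parts k j pt" and j: "j < k" "cls n pt j = {}"
    and s: "search pt l y q z" "cls n q 1 = cls n pt l" and two: "2 \<le> card (cls n pt l)"
  shows "partial_parts k (Suc j) (pt(z := j))"
proof -
  have "z \<in> cls n pt l" "y \<in> cls n pt l" using s(1) unfolding search_def by blast+
  then have z: "z < n" "pt z = l" "y < n" "pt y = l" by simp_all
  have "z \<noteq> y" using s two unfolding search_def by auto
  have "l \<noteq> j" using z j by auto
  have l: "cls n (pt(z := j)) l = cls n pt l - {z}"
    using \<open>l \<noteq> j\<close> by (auto split: if_splits)
  have jj: "cls n (pt(z := j)) j = {z}"
    using j(2) z unfolding cls_def by (auto split: if_splits)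
  have i: "cls n (pt(z := j)) i = cls n pt i" if "i \<noteq> l" "i \<noteq> j" for i
    by (rule cls_eqI) (use that z in auto)
  have conn: "conn R (cls n (pt(z := j)) i)" for i
  proof -
    have *: "conn R (cls n pt l - {z})" "conn R (cls n pt i)"
      using s p unfolding search_def partial_parts_def by auto
    consider "i = l" | "i = j" | "i \<noteq> l" "i \<noteq> j" by blast
    then show ?thesis by cases (simp_all only: l jj i conn_singleton * simp_thms)
  qed
  have "ratio_le n R k (card (cls n (pt(z := j)) i))" for i
  proof -
    have W: "ratio_le n R k (card (cls n pt a))" for a using p unfolding partial_parts_def by blast
    consider "i = l" | "i = j" | "i \<noteq> l" "i \<noteq> j" by blast
    then show ?thesis
    proof cases
      case 1
      then show ?thesis unfolding 1 l by (intro ratio_le_mono[OF W[of l]] card_mono) auto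
    next
      case 2
      show ?thesis unfolding 2 jj by (rule ratio_le_mono[OF W[of l]]) (use two in simp)
    qed (simp add: i W)
  qed
  moreover have "cls n (pt(z := j)) i \<noteq> {}" if i_le: "i < Suc j" for i
  proof -
    consider "i = l" | "i = j" | "i \<noteq> l" "i \<noteq> j" "i < j" using i_le by linarith
    then show ?thesis
    proof cases
      case 1
      have "y \<in> cls n pt l - {z}" using z \<open>z \<noteq> y\<close> by simp
      then show ?thesis unfolding 1 l by blast
    next
      case 3
      then show ?thesis unfolding i[OF 3(1,2)] using p unfolding partial_parts_def by blast
    qed (simp add: jj)
  qed
  moreover have "\<forall>x<n. (pt(z := j)) x < k" using p j unfolding partial_parts_def by simp
  ultimately show ?thesis using conn unfolding partial_parts_def by blast
qed

text \<open>Pigeonhole: if all classes had at most one vertex, \<open>pt\<close> would embed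
  \<open>n \<ge> k\<close> vertices into the \<open>k - 1\<close> part numbers other than
  \<open>j\<close>.\<close>

lemma partial_parts_two:
  assumes p: "partial_parts k j pt" and "j < k" "cls n pt j = {}" "k \<le> n"
  shows "\<exists>i<n. 2 \<le> card (cls n pt (pt i))"
proof (rule ccontr)
  assume no: "\<not> ?thesis"
  have "inj_on pt {..<n}"
  proof (rule inj_onI)
    fix x y assume xy: "x \<in> {..<n}" "y \<in> {..<n}" "pt x = pt y"
    show "x = y"
    proof (rule ccontr)
      assume "x \<noteq> y"
      have "card {x, y} \<le> card (cls n pt (pt x))" by (rule card_mono) (use xy in auto)
      then show False using no xy \<open>x \<noteq> y\<close> by auto
    qed
  qed
  moreover have "pt ` {..<n} \<subseteq> {..<k} - {j}"
    using p assms(3) unfolding partial_parts_def by (auto simp: cls_def)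
  ultimately have "n \<le> card ({..<k} - {j})"
    using card_inj_on_le[of pt "{..<n}" "{..<k} - {j}"] by simp
  then show False using assms(2,4) by simp
qed

end

section \<open>Programs\<close>

text \<open>Termination, time and postcondition in one predicate. The time is only an upper bound,
  so budgets can be rounded up freely.\<close>

definition runs :: "nat \<Rightarrow> com \<Rightarrow> state \<Rightarrow> nat \<Rightarrow> (state \<Rightarrow> bool) \<Rightarrow> bool" where
  "runs W c s T Q \<longleftrightarrow> (\<exists>t s'. exec W c s t s' \<and> t \<le> T \<and> Q s')"

lemma runs_mono:
  "runs W c s T Q \<Longrightarrow> T \<le> T' \<Longrightarrow> (\<And>s'. Q s' \<Longrightarrow> Q' s') \<Longrightarrow> runs W c s T' Q'"
  unfolding runs_def by (meson order_trans)

lemma runs_Skip: "Q s \<Longrightarrow> 1 \<le> T \<Longrightarrow> runs W Skip s T Q"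
  unfolding runs_def using exec.Skip by blast

lemma runs_Assign:
  "afits W s e \<Longrightarrow> acost e + 1 \<le> T \<Longrightarrow> Q ((fst s)(x := aval s e), snd s) \<Longrightarrow>
   runs W (Assign x e) s T Q"
  unfolding runs_def using exec.Assign by blast

lemma runs_Store:
  "afits W s e \<Longrightarrow> afits W s f \<Longrightarrow> acost e + acost f + 1 \<le> T \<Longrightarrow>
   Q (fst s, (snd s)(a := (snd s a)(aval s e := aval s f))) \<Longrightarrow>
   runs W (Store a e f) s T Q"
  unfolding runs_def using exec.Store by blast

lemma runs_Seq:
  "runs W c s T1 (\<lambda>s'. runs W d s' T2 Q) \<Longrightarrow> T1 + T2 \<le> T \<Longrightarrow> runs W (Seq c d) s T Q"
  unfolding runs_def by (meson add_mono exec.Seq order_trans)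

lemma runs_Cond:
  assumes "bfits W s b" "bval s b \<Longrightarrow> runs W c s T' Q" "\<not> bval s b \<Longrightarrow> runs W d s T' Q"
    "bcost b + T' + 1 \<le> T"
  shows "runs W (Cond b c d) s T Q"
proof (cases "bval s b")
  case True
  with assms(2) obtain t s' where "exec W c s t s'" "t \<le> T'" "Q s'" unfolding runs_def by blast
  with exec.CondTrue[OF assms(1) True] assms(4) show ?thesis
    unfolding runs_def by (meson add_le_mono le_refl order_trans)
next
  case False
  with assms(3) obtain t s' where "exec W d s t s'" "t \<le> T'" "Q s'" unfolding runs_def by blast
  with exec.CondFalse[OF assms(1) False] assms(4) show ?thesis
    unfolding runs_def by (meson add_le_mono le_refl order_trans)
qed

text \<open>The continuation receives whatever budget is left, so straight-line code is processed
  forwards without choosing intermediate times.\<close>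

lemma runs_Seq_Assign:
  "afits W s e \<Longrightarrow> acost e + 1 \<le> T \<Longrightarrow>
   runs W d ((fst s)(x := aval s e), snd s) (T - (acost e + 1)) Q \<Longrightarrow> runs W (Seq (Assign x e) d) s T Q"
  by (rule runs_Seq[OF runs_Assign[OF _ order_refl]]) auto

lemma runs_Seq_Store:
  "afits W s e \<Longrightarrow> afits W s f \<Longrightarrow> acost e + acost f + 1 \<le> T \<Longrightarrow>
   runs W d (fst s, (snd s)(a := (snd s a)(aval s e := aval s f))) (T - (acost e + acost f + 1)) Q \<Longrightarrow> runs W (Seq (Store a e f) d) s T Q"
  by (rule runs_Seq[OF runs_Store[OF _ _ order_refl]]) auto

text \<open>The index \<open>j\<close> of the invariant bounds the number of remaining iterations.\<close>

lemma runs_Loop: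
  assumes "I j s"
    "\<And>j s. I j s \<Longrightarrow> bfits W s b"
    "\<And>j s. I j s \<Longrightarrow> bval s b \<Longrightarrow> runs W c s T (\<lambda>s'. \<exists>j'<j. I j' s')"
    "\<And>j s. I j s \<Longrightarrow> \<not> bval s b \<Longrightarrow> Q s"
    "Suc j * (T + bcost b + 1) \<le> T'"
  shows "runs W (Loop b c) s T' Q"
  using assms(1,5)
proof (induction j arbitrary: s T' rule: less_induct)
  case (less j)
  show ?case
  proof (cases "bval s b")
    case False
    have "exec W (Loop b c) s (bcost b + 1) s"
      using exec.LoopFalse assms(2)[OF less.prems(1)] False by blast
    moreover have "bcost b + 1 \<le> T'" using less.prems(2) by simp
    ultimately show ?thesis unfolding runs_def using assms(4)[OF less.prems(1) False] by blast
  next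
    case True
    from assms(3)[OF less.prems(1) True] obtain t s' j' where
      1: "exec W c s t s'" "t \<le> T" "j' < j" "I j' s'" unfolding runs_def by blast
    from less.IH[OF 1(3,4) order_refl] obtain t' s'' where
      2: "exec W (Loop b c) s' t' s''" "t' \<le> Suc j' * (T + bcost b + 1)" "Q s''"
      unfolding runs_def by blast
    have "Suc j' * (T + bcost b + 1) \<le> j * (T + bcost b + 1)"
      using 1(3) by (intro mult_le_mono1) simp
    then have "bcost b + t + t' + 1 \<le> T'" using 1(2) 2(2) less.prems(2) by simp
    then show ?thesis unfolding runs_def
      using exec.LoopTrue[OF assms(2)[OF less.prems(1)] True 1(1) 2(1)] 2(3) by blast
  qed
qed

section \<open>Counting loops and the scanning primitives built from them\<close>

definition For :: "string \<Rightarrow> string \<Rightarrow> com \<Rightarrow> com" where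
  "For x y c = Seq (Assign x (Const 0))
     (Loop (Less (Reg x) (Reg y)) (Seq c (Assign x (Plus (Reg x) (Const 1)))))"

text \<open>The body must leave the counter unchanged, and the invariant is stated after the
  increment. An iteration costs \<open>T\<close> plus 4 for the increment and 4 for the guard; the
  loop rule charges \<open>N + 1\<close> iterations, and the initialisation adds 2.\<close>

lemma runs_For:
  assumes "fst s y = N" "N \<le> W" "1 \<le> W" "x \<noteq> y"
    "I 0 ((fst s)(x := 0), snd s)"
    "\<And>i s. i < N \<Longrightarrow> I i s \<Longrightarrow> fst s x = i \<Longrightarrow> fst s y = N \<Longrightarrow>
       runs W c s T (\<lambda>s'. fst s' x = i \<and> fst s' y = N \<and> I (Suc i) ((fst s')(x := Suc i), snd s'))"
    "\<And>s. I N s \<Longrightarrow> fst s x = N \<Longrightarrow> fst s y = N \<Longrightarrow> Q s"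
    "N * (T + 8) + T + 10 \<le> T'"
  shows "runs W (For x y c) s T' Q"
  unfolding For_def
proof (rule runs_Seq_Assign)
  show "runs W (Loop (Less (Reg x) (Reg y)) (Seq c (Assign x (Plus (Reg x) (Const 1)))))
     ((fst s)(x := aval s (Const 0)), snd s) (T' - (acost (Const 0) + 1)) Q"
  proof (rule runs_Loop[where
        I = "\<lambda>j s. fst s x \<le> N \<and> j = N - fst s x \<and> fst s y = N \<and> I (fst s x) s" and T = "T + 4"])
    fix j s
    assume *: "fst s x \<le> N \<and> j = N - fst s x \<and> fst s y = N \<and> I (fst s x) s"
      and "bval s (Less (Reg x) (Reg y))"
    then have "fst s x < N" by simp
    show "runs W (Seq c (Assign x (Plus (Reg x) (Const 1)))) s (T + 4) (\<lambda>s'. \<exists>j'<j.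
        fst s' x \<le> N \<and> j' = N - fst s' x \<and> fst s' y = N \<and> I (fst s' x) s')"
      by (rule runs_Seq[OF runs_mono[OF assms(6)[OF \<open>fst s x < N\<close>], OF _ _ _ order_refl]])
        (use * \<open>fst s x < N\<close> assms(2-4) in \<open>auto intro!: runs_Assign\<close>)
  next
    show "Suc N * (T + 4 + bcost (Less (Reg x) (Reg y)) + 1) \<le> T' - (acost (Const 0) + 1)"
      using assms(8) by (simp add: algebra_simps)
  qed (use assms in auto)
qed (use assms in auto)

lemma card_less_Suc_Collect:
  "card {j. j < Suc i \<and> B j} = (if B i then Suc (card {j. j < i \<and> B j}) else card {j. j < i \<and> B j})"
proof -
  have "{j. j < Suc i \<and> B j} = (if B i then insert i {j. j < i \<and> B j} else {j. j < i \<and> B j})"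
    by (auto simp: less_Suc_eq)
  then show ?thesis by simp
qed

lemma card_less_Collect_le: "card {j. j < (i::nat) \<and> B j} \<le> i"
  using card_mono[of "{..<i}" "{j. j < i \<and> B j}"] by auto

definition Count :: "string \<Rightarrow> bexp \<Rightarrow> com" where
  "Count r b = Seq (Assign r (Const 0))
     (For ''x'' ''n'' (Cond b (Assign r (Plus (Reg r) (Const 1))) Skip))"

text \<open>The test is evaluated for arbitrary contents \<open>k\<close> of the counting register,
  so its value must not depend on the running count.\<close>

lemma runs_Count:
  assumes "fst s ''n'' = n" "n \<le> W" "1 \<le> W" "r \<noteq> ''x''" "r \<noteq> ''n''"
    "\<And>i k. i < n \<Longrightarrow> bfits W ((fst s)(r := k, ''x'' := i), snd s) b"
    "\<And>i k. i < n \<Longrightarrow> bval ((fst s)(r := k, ''x'' := i), snd s) b = B i"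
    "Q ((fst s)(r := card {i. i < n \<and> B i}, ''x'' := n), snd s)"
    "Suc n * (bcost b + 20) \<le> T"
  shows "runs W (Count r b) s T Q"
  unfolding Count_def
proof (rule runs_Seq_Assign[rotated 2], rule runs_For[where N = n and T = "bcost b + 5" and
      I = "\<lambda>i s'. s' = ((fst s)(r := card {j. j < i \<and> B j}, ''x'' := i), snd s)"])
  fix i s'
  assume i: "i < n" and s': "s' = ((fst s)(r := card {j. j < i \<and> B j}, ''x'' := i), snd s)"
  have *: "Suc (card {j. j < i \<and> B j}) \<le> W"
    using card_less_Collect_le[of i B] i assms(2) by simp
  show "runs W (Cond b (Assign r (Plus (Reg r) (Const 1))) Skip) s' (bcost b + 5)
         (\<lambda>s'. fst s' ''x'' = i \<and> fst s' ''n'' = n \<and>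
            ((fst s')(''x'' := Suc i), snd s') =
              ((fst s)(r := card {j. j < Suc i \<and> B j}, ''x'' := Suc i), snd s))"
    by (rule runs_Cond[where T' = 4])
      (use * assms(1,4,5) assms(6,7)[OF i] in
        \<open>auto intro!: runs_Assign runs_Skip simp: s' card_less_Suc_Collect\<close>)
next
  show "n * (bcost b + 5 + 8) + (bcost b + 5) + 10 \<le> T - (acost (Const 0) + 1)"
    using assms(9) by (simp add: algebra_simps)
qed (use assms in auto)

definition Fill :: "bexp \<Rightarrow> string \<Rightarrow> string \<Rightarrow> com" where
  "Fill b a z = For ''x'' ''n'' (Cond b (Store a (Reg ''x'') (Reg z)) Skip)"

text \<open>The test may read the array being overwritten: cell \<open>i\<close> keeps its old value
  until iteration \<open>i\<close>, hence the quantification over all \<open>g\<close> that agree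
  with the old array at \<open>i\<close>.\<close>

lemma runs_Fill:
  assumes "fst s ''n'' = n" "n \<le> W" "1 \<le> W" "z \<noteq> ''x''" "fst s z \<le> W"
    "\<And>i g. i < n \<Longrightarrow> g i = snd s a i \<Longrightarrow> bfits W ((fst s)(''x'' := i), (snd s)(a := g)) b"
    "\<And>i g. i < n \<Longrightarrow> g i = snd s a i \<Longrightarrow> bval ((fst s)(''x'' := i), (snd s)(a := g)) b = B i"
    "Q ((fst s)(''x'' := n), (snd s)(a := \<lambda>i. if i < n \<and> B i then fst s z else snd s a i))"
    "Suc n * (bcost b + 20) \<le> T"
  shows "runs W (Fill b a z) s T Q"
  unfolding Fill_def
proof (rule runs_For[where N = n and T = "bcost b + 4" and
      I = "\<lambda>i s'. s' = ((fst s)(''x'' := i),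
             (snd s)(a := \<lambda>j. if j < i \<and> B j then fst s z else snd s a j))"])
  fix i s'
  assume i: "i < n" and s': "s' = ((fst s)(''x'' := i),
             (snd s)(a := \<lambda>j. if j < i \<and> B j then fst s z else snd s a j))"
  have b: "bfits W s' b" "bval s' b = B i"
    unfolding s' using assms(6,7)[OF i] by simp_all
  show "runs W (Cond b (Store a (Reg ''x'') (Reg z)) Skip) s' (bcost b + 4)
         (\<lambda>s'. fst s' ''x'' = i \<and> fst s' ''n'' = n \<and>
            ((fst s')(''x'' := Suc i), snd s') = ((fst s)(''x'' := Suc i),
             (snd s)(a := \<lambda>j. if j < Suc i \<and> B j then fst s z else snd s a j)))"
    by (rule runs_Cond[where T' = 3])
      (use b i assms(1-5) in
        \<open>auto intro!: runs_Store runs_Skip simp: s' fun_eq_iff less_Suc_eq\<close>)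
next
  show "n * (bcost b + 4 + 8) + (bcost b + 4) + 10 \<le> T"
    using assms(9) by (simp add: algebra_simps)
qed (use assms in auto)

definition Find :: "bexp \<Rightarrow> com" where
  "Find b = Seq (Assign ''w'' (Reg ''n''))
     (For ''e'' ''m'' (Cond b (Assign ''w'' (Load ''dst'' (Reg ''e''))) Skip))"

text \<open>The scan runs to the end and keeps the last match; the result \<open>n\<close>, which is
  no vertex, signals failure. Callers may rely only on getting some match.\<close>

lemma runs_Find:
  assumes "fst s ''n'' = n" "n \<le> W" "fst s ''m'' = m" "m \<le> W" "1 \<le> W"
    "\<And>i. i < m \<Longrightarrow> snd s ''dst'' i \<le> W"
    "\<And>i k. i < m \<Longrightarrow> bfits W ((fst s)(''w'' := k, ''e'' := i), snd s) b"
    "\<And>i k. i < m \<Longrightarrow> bval ((fst s)(''w'' := k, ''e'' := i), snd s) b = B i"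
    "\<And>w. (w = n \<and> (\<forall>i<m. \<not> B i)) \<or> (\<exists>i<m. B i \<and> w = snd s ''dst'' i) \<Longrightarrow>
       Q ((fst s)(''w'' := w, ''e'' := m), snd s)"
    "Suc m * (bcost b + 20) \<le> T"
  shows "runs W (Find b) s T Q"
  unfolding Find_def
proof (rule runs_Seq_Assign[rotated 2], rule runs_For[where N = m and T = "bcost b + 4" and
      I = "\<lambda>i s'. \<exists>w. s' = ((fst s)(''w'' := w, ''e'' := i), snd s) \<and>
        ((w = n \<and> (\<forall>j<i. \<not> B j)) \<or> (\<exists>j<i. B j \<and> w = snd s ''dst'' j))"])
  fix i s'
  assume i: "i < m" and "\<exists>w. s' = ((fst s)(''w'' := w, ''e'' := i), snd s) \<and>
        ((w = n \<and> (\<forall>j<i. \<not> B j)) \<or> (\<exists>j<i. B j \<and> w = snd s ''dst'' j))"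
  then obtain w where s': "s' = ((fst s)(''w'' := w, ''e'' := i), snd s)"
    and w: "(w = n \<and> (\<forall>j<i. \<not> B j)) \<or> (\<exists>j<i. B j \<and> w = snd s ''dst'' j)" by blast
  show "runs W (Cond b (Assign ''w'' (Load ''dst'' (Reg ''e''))) Skip) s' (bcost b + 4)
         (\<lambda>s'. fst s' ''e'' = i \<and> fst s' ''m'' = m \<and>
            (\<exists>w. ((fst s')(''e'' := Suc i), snd s') = ((fst s)(''w'' := w, ''e'' := Suc i), snd s) \<and>
        ((w = n \<and> (\<forall>j<Suc i. \<not> B j)) \<or> (\<exists>j<Suc i. B j \<and> w = snd s ''dst'' j))))"
  proof (rule runs_Cond[where T' = 3])
    assume "bval s' b"
    then have "B i" using assms(8)[OF i] s' by simp
    then show "runs W (Assign ''w'' (Load ''dst'' (Reg ''e''))) s' 3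
         (\<lambda>s'. fst s' ''e'' = i \<and> fst s' ''m'' = m \<and>
            (\<exists>w. ((fst s')(''e'' := Suc i), snd s') = ((fst s)(''w'' := w, ''e'' := Suc i), snd s) \<and>
        ((w = n \<and> (\<forall>j<Suc i. \<not> B j)) \<or> (\<exists>j<Suc i. B j \<and> w = snd s ''dst'' j))))"
      by (intro runs_Assign) (use i assms(3,4,6) in \<open>auto simp: s' fun_eq_iff\<close>)
  next
    assume "\<not> bval s' b"
    then have "\<not> B i" using assms(8)[OF i] s' by simp
    then show "runs W Skip s' 3
         (\<lambda>s'. fst s' ''e'' = i \<and> fst s' ''m'' = m \<and>
            (\<exists>w. ((fst s')(''e'' := Suc i), snd s') = ((fst s)(''w'' := w, ''e'' := Suc i), snd s) \<and>
        ((w = n \<and> (\<forall>j<Suc i. \<not> B j)) \<or> (\<exists>j<Suc i. B j \<and> w = snd s ''dst'' j))))"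
      using w assms(3) by (intro runs_Skip) (auto simp: s' fun_eq_iff less_Suc_eq)
  qed (use assms(7)[OF i] s' in auto)
next
  show "m * (bcost b + 4 + 8) + (bcost b + 4) + 10 \<le> T - (acost (Reg ''n'') + 1)"
    using assms(10) by (simp add: algebra_simps)
next
  fix s'
  assume "\<exists>w. s' = ((fst s)(''w'' := w, ''e'' := m), snd s) \<and>
    ((w = n \<and> (\<forall>j<m. \<not> B j)) \<or> (\<exists>j<m. B j \<and> w = snd s ''dst'' j))"
  then show "Q s'" using assms(9) by blast
qed (use assms(1-5,10) in \<open>auto intro!: exI[of _ n]\<close>)

section \<open>The elementary steps of the algorithm with their effects and costs\<close>

definition push_prog :: com where
  "push_prog = Seq (Store ''p'' (Reg ''w'') (Reg ''u''))
    (Seq (Store ''h'' (Reg ''w'') (Plus (Reg ''w'') (Const 1)))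
    (Seq (Store ''c'' (Reg ''w'') (Reg ''w''))
    (Assign ''u'' (Reg ''w''))))"

lemma runs_push:
  assumes "fst s ''u'' \<le> W" "Suc (fst s ''w'') \<le> W"
    "Q ((fst s)(''u'' := fst s ''w''), (snd s)
       (''p'' := (snd s ''p'')(fst s ''w'' := fst s ''u''),
        ''h'' := (snd s ''h'')(fst s ''w'' := Suc (fst s ''w'')),
        ''c'' := (snd s ''c'')(fst s ''w'' := fst s ''w'')))"
  shows "runs W push_prog s 20 Q"
  unfolding push_prog_def using assms by (auto intro!: runs_Seq_Store runs_Assign)

text \<open>The order matters: both fills test \<open>h\<close>, so \<open>c\<close> is rewritten
  before \<open>h\<close>. Register \<open>''f''\<close> reports that the subtree of
  \<open>u\<close> is large, in which case nothing is popped.\<close>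

definition pop_prog :: com where
  "pop_prog = Seq (Assign ''a'' (Plus (Reg ''u'') (Const 1)))
    (Seq (Count ''r'' (Equal (Load ''h'' (Reg ''x'')) (Reg ''a'')))
    (Cond (Less (Reg ''n'') (Plus (Reg ''r'') (Reg ''r'')))
      (Assign ''f'' (Const 1))
      (Seq (Assign ''b'' (Load ''p'' (Reg ''u'')))
      (Seq (Assign ''t'' (Plus (Reg ''b'') (Const 1)))
      (Seq (Fill (Equal (Load ''h'' (Reg ''x'')) (Reg ''a'')) ''c'' ''u'')
      (Seq (Fill (Equal (Load ''h'' (Reg ''x'')) (Reg ''a'')) ''h'' ''t'')
      (Assign ''u'' (Reg ''b''))))))))"

text \<open>Scratch registers are hidden in an arbitrary \<open>\<rho>\<close> of which only the
  relevant contents are known. The parent is constrained only for a small subtree, because the root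
  of the search has none. Each test costs 4, so each of the three scans costs at most
  \<open>24 * Suc n\<close>.\<close>

lemma runs_pop:
  assumes n: "fst s ''n'' = n" "2 * n \<le> W" "1 \<le> W"
    and u: "fst s ''u'' = u" "u < n" and h: "\<And>x. x < n \<Longrightarrow> snd s ''h'' x \<le> W"
    and r: "r = card {x. x < n \<and> snd s ''h'' x = Suc u}"
    and found: "\<And>\<rho>. n < 2 * r \<Longrightarrow> \<rho> ''n'' = n \<Longrightarrow> \<rho> ''m'' = fst s ''m'' \<Longrightarrow> \<rho> ''u'' = u \<Longrightarrow>
      \<rho> ''f'' = 1 \<Longrightarrow> Q (\<rho>, snd s)"
    and pw: "2 * r \<le> n \<Longrightarrow> snd s ''p'' u < W"
    and pop: "\<And>\<rho>. 2 * r \<le> n \<Longrightarrow> \<rho> ''n'' = n \<Longrightarrow> \<rho> ''m'' = fst s ''m'' \<Longrightarrow> \<rho> ''u'' = snd s ''p'' u \<Longrightarrow>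
      \<rho> ''f'' = fst s ''f'' \<Longrightarrow> Q (\<rho>, (snd s)
       (''c'' := \<lambda>x. if x < n \<and> snd s ''h'' x = Suc u then u else snd s ''c'' x,
        ''h'' := \<lambda>x. if x < n \<and> snd s ''h'' x = Suc u then Suc (snd s ''p'' u) else snd s ''h'' x))"
  shows "runs W pop_prog s (72 * Suc n + 50) Q"
proof -
  have r_le: "r \<le> n" unfolding r by (rule card_less_Collect_le)
  have F: "fst s ''n'' = n" "fst s ''u'' = u" "n \<le> W" "Suc 0 \<le> W" "u \<le> W" "Suc u \<le> W" "r + r \<le> W" "r \<le> W"
    "\<And>i. i < n \<Longrightarrow> i \<le> W"
    using n u r_le by auto
  have P: "Suc (snd s ''p'' u) \<le> W" "snd s ''p'' u \<le> W" if "r + r \<le> n" using pw that by auto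
  show ?thesis
    unfolding pop_prog_def
    apply (rule runs_Seq_Assign, simp add: F, simp)
    apply (rule runs_Seq[where ?T1.0 = "24 * Suc n" and ?T2.0 = "48 * Suc n + 40"])
     apply (rule runs_Count[where n = n and B = "\<lambda>x. snd s ''h'' x = Suc u"])
             apply (simp_all add: F h flip: r)
    apply (rule runs_Cond[where T' = "48 * Suc n + 30"])
       apply (simp add: F)
      apply (rule runs_Assign, simp add: F, simp, simp only: fst_conv snd_conv, rule found; simp add: F)
    apply (rule runs_Seq_Assign, simp add: F P, simp, simp add: F)
    apply (rule runs_Seq_Assign, simp add: F P, simp, simp add: F)
    apply (rule runs_Seq[where ?T1.0 = "24 * Suc n" and ?T2.0 = "24 * Suc n + 20"])
     apply (rule runs_Fill[where n = n and B = "\<lambda>x. snd s ''h'' x = Suc u"])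
             apply (simp_all add: F h cong: if_cong)
    apply (rule runs_Seq[where ?T1.0 = "24 * Suc n" and ?T2.0 = "20"])
     apply (rule runs_Fill[where n = n and B = "\<lambda>x. snd s ''h'' x = Suc u"])
             apply (simp_all add: F h P cong: if_cong)
    apply (rule runs_Assign, simp add: F P, simp, simp only: fst_conv snd_conv, rule pop; simp add: F)
    done
qed


text \<open>The reversed copy of every edge is appended, so that a scan by source vertex finds all
  neighbours.\<close>

definition sym_prog :: com where
  "sym_prog = Seq
    (For ''e'' ''m'' (Seq (Store ''src'' (Plus (Reg ''m'') (Reg ''e'')) (Load ''dst'' (Reg ''e'')))
      (Store ''dst'' (Plus (Reg ''m'') (Reg ''e'')) (Load ''src'' (Reg ''e'')))))
    (Assign ''m'' (Plus (Reg ''m'') (Reg ''m'')))"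

lemma runs_sym:
  assumes m: "fst s ''m'' = m" "2 * m \<le> W" "1 \<le> W"
    and W: "\<And>i. i < m \<Longrightarrow> snd s ''src'' i \<le> W" "\<And>i. i < m \<Longrightarrow> snd s ''dst'' i \<le> W"
    and Q: "Q ((fst s)(''e'' := m, ''m'' := 2 * m), (snd s)
      (''src'' := \<lambda>j. if m \<le> j \<and> j < 2 * m then snd s ''dst'' (j - m) else snd s ''src'' j,
       ''dst'' := \<lambda>j. if m \<le> j \<and> j < 2 * m then snd s ''src'' (j - m) else snd s ''dst'' j))"
  shows "runs W sym_prog s (40 * Suc m) Q"
proof -
  let ?S = "\<lambda>i. ((fst s)(''e'' := i), (snd s)
      (''src'' := \<lambda>j. if m \<le> j \<and> j < m + i then snd s ''dst'' (j - m) else snd s ''src'' j,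
       ''dst'' := \<lambda>j. if m \<le> j \<and> j < m + i then snd s ''src'' (j - m) else snd s ''dst'' j))"
  have F: "fst s ''m'' = m" "m + m \<le> W" "m \<le> W" "Suc 0 \<le> W" using m by auto
  have step: "runs W (Seq (Store ''src'' (Plus (Reg ''m'') (Reg ''e'')) (Load ''dst'' (Reg ''e'')))
      (Store ''dst'' (Plus (Reg ''m'') (Reg ''e'')) (Load ''src'' (Reg ''e'')))) (?S i) 12
      (\<lambda>s'. fst s' ''e'' = i \<and> fst s' ''m'' = m \<and> ((fst s')(''e'' := Suc i), snd s') = ?S (Suc i))"
    if i: "i < m" for i
    apply (rule runs_Seq_Store)
       apply (use F i in simp)
      apply (use F W i in simp)
     apply simp
    apply (rule runs_Store)
       apply (use F i in simp)
      apply (use F W i in simp)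
     apply simp
    apply (use F i in \<open>auto simp: fun_eq_iff less_Suc_eq\<close>)
    done
  show ?thesis unfolding sym_prog_def
  proof (rule runs_Seq[where ?T1.0 = "20 * m + 22" and ?T2.0 = 5])
    show "runs W (For ''e'' ''m'' (Seq (Store ''src'' (Plus (Reg ''m'') (Reg ''e'')) (Load ''dst'' (Reg ''e'')))
      (Store ''dst'' (Plus (Reg ''m'') (Reg ''e'')) (Load ''src'' (Reg ''e''))))) s (20 * m + 22)
      (\<lambda>s'. runs W (Assign ''m'' (Plus (Reg ''m'') (Reg ''m''))) s' 5 Q)"
    proof (rule runs_For[where N = m and T = 12 and I = "\<lambda>i s'. s' = ?S i"])
      show "((fst s)(''e'' := 0), snd s) = ?S 0" by (auto simp: fun_eq_iff)
      fix s' assume "s' = ?S m"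
      then show "runs W (Assign ''m'' (Plus (Reg ''m'') (Reg ''m''))) s' 5 Q"
        using Q F by (auto intro!: runs_Assign simp: mult_2)
    qed (use F step in auto)
  qed simp
qed

definition label_is :: "string \<Rightarrow> string \<Rightarrow> bexp" where
  "label_is a r = Equal (Load a (Reg ''x'')) (Reg r)"

definition piece_body :: com where
  "piece_body = Cond (Conj (Equal (Load ''c'' (Load ''src'' (Reg ''e''))) (Reg ''n''))
      (Conj (Neg (Equal (Load ''c'' (Load ''dst'' (Reg ''e''))) (Reg ''n'')))
        (Neg (Equal (Load ''c'' (Load ''dst'' (Reg ''e''))) (Reg ''u'')))))
    (Seq (Assign ''i'' (Load ''c'' (Load ''dst'' (Reg ''e''))))
    (Seq (Count ''a'' (label_is ''c'' ''n''))
    (Seq (Count ''b'' (label_is ''c'' ''i''))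
    (Cond (Less (Reg ''n'') (Plus (Plus (Reg ''a'') (Reg ''b'')) (Plus (Reg ''a'') (Reg ''b''))))
      (Fill (Conj (Neg (label_is ''c'' ''n'')) (Neg (label_is ''c'' ''i''))) ''c'' ''u'')
      (Fill (label_is ''c'' ''i'') ''c'' ''n'')))))
    Skip"

text \<open>The factor 79 is 24 + 24 for the two counts and 31 for the fill with the longer test.
  The bound \<open>4 * n \<le> W\<close> is needed for the doubled sum of the two counts.\<close>

lemma runs_piece:
  fixes s :: state
  defines "c \<equiv> snd s ''c''"
  defines "x \<equiv> snd s ''src'' (fst s ''e'')" and "y \<equiv> snd s ''dst'' (fst s ''e'')"
  assumes n: "fst s ''n'' = n" "4 * n \<le> W" "1 \<le> W" "fst s ''e'' \<le> W"
    and u: "fst s ''u'' = u" "u < n" and c: "\<And>x. x < n \<Longrightarrow> c x \<le> n"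
    and xy: "x < n" "y < n"
    and skip: "\<not> (c x = n \<and> c y \<noteq> n \<and> c y \<noteq> u) \<Longrightarrow> Q s"
    and large: "\<And>\<rho>. c x = n \<Longrightarrow> c y \<noteq> n \<Longrightarrow> c y \<noteq> u \<Longrightarrow>
      n < 2 * (card {z. z < n \<and> c z = n} + card {z. z < n \<and> c z = c y}) \<Longrightarrow>
      \<rho> ''n'' = n \<Longrightarrow> \<rho> ''m'' = fst s ''m'' \<Longrightarrow> \<rho> ''u'' = u \<Longrightarrow> \<rho> ''e'' = fst s ''e'' \<Longrightarrow>
      Q (\<rho>, (snd s)(''c'' := \<lambda>z. if z < n \<and> c z \<noteq> n \<and> c z \<noteq> c y then u else c z))"
    and small: "\<And>\<rho>. c x = n \<Longrightarrow> c y \<noteq> n \<Longrightarrow> c y \<noteq> u \<Longrightarrow>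
      2 * (card {z. z < n \<and> c z = n} + card {z. z < n \<and> c z = c y}) \<le> n \<Longrightarrow>
      \<rho> ''n'' = n \<Longrightarrow> \<rho> ''m'' = fst s ''m'' \<Longrightarrow> \<rho> ''u'' = u \<Longrightarrow> \<rho> ''e'' = fst s ''e'' \<Longrightarrow>
      Q (\<rho>, (snd s)(''c'' := \<lambda>z. if z < n \<and> c z = c y then n else c z))"
  shows "runs W piece_body s (79 * Suc n + 60) Q"
proof -
  define a where "a = card {z. z < n \<and> c z = n}"
  define b where "b = card {z. z < n \<and> c z = c y}"
  have ab: "a \<le> n" "b \<le> n" unfolding a_def b_def by (rule card_less_Collect_le)+
  have F: "fst s ''n'' = n" "fst s ''u'' = u" "n \<le> W" "Suc 0 \<le> W" "u \<le> W" "fst s ''e'' \<le> W"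
    "snd s ''src'' (fst s ''e'') = x" "snd s ''dst'' (fst s ''e'') = y" "snd s ''c'' = c" "x \<le> W" "y \<le> W"
    "\<And>i. i < n \<Longrightarrow> i \<le> W" "\<And>i. i < n \<Longrightarrow> c i \<le> W" "c x \<le> W" "c y \<le> W" "a \<le> W" "b \<le> W" "a + b \<le> W"
    "a + b + (a + b) \<le> W"
    using n u xy ab c[of x] c[of y] order_trans[OF c, of _ W] unfolding c_def x_def y_def by auto
  show ?thesis
    unfolding piece_body_def
    apply (rule runs_Cond[where T' = "79 * Suc n + 30"])
       apply (simp add: F)
      apply (simp add: F)
      apply (rule runs_Seq_Assign, simp add: F, simp, simp add: F)
      apply (rule runs_Seq[where ?T1.0 = "24 * Suc n" and ?T2.0 = "55 * Suc n + 25"])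
       apply (rule runs_Count[where n = n and B = "\<lambda>z. c z = n"])
               apply (simp_all add: F label_is_def flip: a_def)
     apply (rule runs_Seq[where ?T1.0 = "24 * Suc n" and ?T2.0 = "31 * Suc n + 20"])
      apply (rule runs_Count[where n = n and B = "\<lambda>z. c z = c y"])
              apply (simp_all add: F label_is_def flip: b_def)
     apply (rule runs_Cond[where T' = "31 * Suc n"])
        apply (simp add: F)
       apply (rule runs_Fill[where n = n and B = "\<lambda>z. c z \<noteq> n \<and> c z \<noteq> c y"])
               apply (simp_all add: F cong: if_cong)
      apply (rule large; simp add: F flip: a_def b_def)
     apply (rule runs_Fill[where n = n and B = "\<lambda>z. c z = c y"])
             apply (simp_all add: F cong: if_cong)
     apply (rule small; simp add: F flip: a_def b_def)
    apply (rule runs_Skip)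
     apply (rule skip, simp_all)
    done
qed

text \<open>The candidates are all names up to and including \<open>n\<close>, since
  \<open>n\<close> names the piece \<open>A\<close>. Starting with \<open>b = n\<close> guarantees a
  name other than the root even if no class is non-empty.\<close>

definition select_body :: com where
  "select_body = Seq (Assign ''b'' (Reg ''n'')) (Seq (Assign ''a'' (Const 0))
    (Seq (Assign ''l'' (Plus (Reg ''n'') (Const 1)))
    (Seq (For ''i'' ''l'' (Cond (Equal (Reg ''i'') (Reg ''u'')) Skip
       (Seq (Count ''r'' (label_is ''c'' ''i''))
       (Cond (Less (Reg ''a'') (Reg ''r''))
         (Seq (Assign ''a'' (Reg ''r'')) (Assign ''b'' (Reg ''i''))) Skip))))
    (Seq (Assign ''t'' (Plus (Reg ''j'') (Const 1)))
    (Seq (Fill (label_is ''c'' ''b'') ''part'' ''t'') (Fill (label_is ''c'' ''b'') ''c'' ''u''))))))"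

lemma runs_select:
  fixes s :: state
  defines "c \<equiv> snd s ''c''"
  assumes n: "fst s ''n'' = n" "2 * n + 2 \<le> W"
    and u: "fst s ''u'' = u" "u < n" and j: "Suc (fst s ''j'') \<le> W"
    and c: "\<And>x. x < n \<Longrightarrow> c x \<le> n"
    and Q: "\<And>\<rho> b. b \<le> n \<Longrightarrow> b \<noteq> u \<Longrightarrow>
      (\<And>i. i \<le> n \<Longrightarrow> i \<noteq> u \<Longrightarrow> card {z. z < n \<and> c z = i} \<le> card {z. z < n \<and> c z = b}) \<Longrightarrow>
      \<rho> ''n'' = n \<Longrightarrow> \<rho> ''m'' = fst s ''m'' \<Longrightarrow> \<rho> ''u'' = u \<Longrightarrow> \<rho> ''j'' = fst s ''j'' \<Longrightarrow>
      \<rho> ''k'' = fst s ''k'' \<Longrightarrow>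
      Q (\<rho>, (snd s)
        (''part'' := \<lambda>z. if z < n \<and> c z = b then Suc (fst s ''j'') else snd s ''part'' z,
         ''c'' := \<lambda>z. if z < n \<and> c z = b then u else c z))"
  shows "runs W select_body s (250 * (Suc n * Suc n)) Q"
proof -
  have F: "fst s ''n'' = n" "fst s ''u'' = u" "n \<le> W" "Suc 0 \<le> W" "Suc n \<le> W" "u \<le> W" "fst s ''j'' \<le> W"
    "Suc (fst s ''j'') \<le> W" "\<And>i. i < n \<Longrightarrow> i \<le> W" "\<And>i. i < n \<Longrightarrow> c i \<le> W" "snd s ''c'' = c"
    using n u j order_trans[OF c, of _ W] unfolding c_def by auto
  \<comment> \<open>The register \<open>''a''\<close> is only bounded by the size of the class
    \<open>b\<close>, not equal to it, because initially it is 0. Being an upper bound for all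
    classes tried, it still yields maximality of \<open>b\<close>.\<close>
  define P where "P i \<sigma> \<longleftrightarrow> snd \<sigma> = snd s \<and> fst \<sigma> ''n'' = n \<and> fst \<sigma> ''m'' = fst s ''m'' \<and> fst \<sigma> ''u'' = u \<and>
    fst \<sigma> ''j'' = fst s ''j'' \<and> fst \<sigma> ''k'' = fst s ''k'' \<and> fst \<sigma> ''b'' \<le> n \<and> fst \<sigma> ''b'' \<noteq> u \<and>
    fst \<sigma> ''a'' \<le> card {z. z < n \<and> c z = fst \<sigma> ''b''} \<and>
    (\<forall>l<i. l \<noteq> u \<longrightarrow> card {z. z < n \<and> c z = l} \<le> fst \<sigma> ''a'')" for i and \<sigma> :: state
  have step: "runs W (Cond (Equal (Reg ''i'') (Reg ''u'')) Skip
       (Seq (Count ''r'' (label_is ''c'' ''i''))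
       (Cond (Less (Reg ''a'') (Reg ''r''))
         (Seq (Assign ''a'' (Reg ''r'')) (Assign ''b'' (Reg ''i''))) Skip))) \<sigma> (24 * Suc n + 40)
       (\<lambda>\<sigma>'. fst \<sigma>' ''i'' = i \<and> fst \<sigma>' ''l'' = Suc n \<and> P (Suc i) ((fst \<sigma>')(''i'' := Suc i), snd \<sigma>'))"
    if i: "i < Suc n" and \<sigma>: "P i \<sigma>" "fst \<sigma> ''i'' = i" "fst \<sigma> ''l'' = Suc n" for i \<sigma>
  proof -
    have S: "snd \<sigma> = snd s" "fst \<sigma> ''n'' = n" "fst \<sigma> ''m'' = fst s ''m''" "fst \<sigma> ''u'' = u"
      "fst \<sigma> ''j'' = fst s ''j''" "fst \<sigma> ''k'' = fst s ''k''" "fst \<sigma> ''b'' \<le> n" "fst \<sigma> ''b'' \<noteq> u"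
      "fst \<sigma> ''i'' = i" "fst \<sigma> ''l'' = Suc n"
      and Sa: "fst \<sigma> ''a'' \<le> card {z. z < n \<and> c z = fst \<sigma> ''b''}"
      and Smax: "\<And>l. l < i \<Longrightarrow> l \<noteq> u \<Longrightarrow> card {z. z < n \<and> c z = l} \<le> fst \<sigma> ''a''"
      using \<sigma> unfolding P_def by blast+
    define r where "r = card {z. z < n \<and> c z = i}"
    have le: "fst \<sigma> ''a'' \<le> W" "r \<le> W" "i \<le> W" "fst \<sigma> ''b'' \<le> W"
      using S(7) Sa i F(3) card_less_Collect_le[of n "\<lambda>z. c z = fst \<sigma> ''b''"]
        card_less_Collect_le[of n "\<lambda>z. c z = i"] unfolding r_def by linarith+
    have max_u: "\<forall>l<Suc i. l \<noteq> u \<longrightarrow> card {z. z < n \<and> c z = l} \<le> fst \<sigma> ''a''" if "i = u"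
      using Smax that unfolding less_Suc_eq by blast
    have max_le: "\<forall>l<Suc i. l \<noteq> u \<longrightarrow> card {z. z < n \<and> c z = l} \<le> fst \<sigma> ''a''" if "\<not> fst \<sigma> ''a'' < r"
      using Smax that unfolding less_Suc_eq r_def by auto
    have max_r: "\<forall>l<Suc i. l \<noteq> u \<longrightarrow> card {z. z < n \<and> c z = l} \<le> r" if "fst \<sigma> ''a'' < r"
      using Smax less_imp_le[OF that] order_trans unfolding less_Suc_eq r_def by blast
    have r_def': "r \<le> card {z. z < n \<and> c z = i}" unfolding r_def by simp
    show ?thesis
      apply (rule runs_Cond[where T' = "24 * Suc n + 30"])
         apply (simp add: S F le)
        apply (rule runs_Skip)
         apply (use max_u Sa in \<open>simp add: P_def S\<close>)
        apply simp
       apply (rule runs_Seq[where ?T1.0 = "24 * Suc n" and ?T2.0 = "20"])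
        apply (rule runs_Count[where n = n and B = "\<lambda>z. c z = i"])
                apply (simp_all add: label_is_def S F le flip: r_def)
      apply (rule runs_Cond[where T' = 10])
         apply (simp add: S F le)
        apply (rule runs_Seq_Assign, simp add: S F le, simp, simp add: S)
        apply (rule runs_Assign, simp add: S F le, simp)
        apply (use i max_r r_def' in \<open>simp add: P_def S\<close>)
       apply (rule runs_Skip)
        apply (use max_le Sa in \<open>simp add: P_def S\<close>)
       apply simp_all
      done
  qed
  have rest: "runs W (Seq (Assign ''t'' (Plus (Reg ''j'') (Const 1)))
    (Seq (Fill (label_is ''c'' ''b'') ''part'' ''t'') (Fill (label_is ''c'' ''b'') ''c'' ''u''))) \<sigma> (48 * Suc n + 20) Q"
    if "P (Suc n) \<sigma>" for \<sigma>
  proof -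
    have S: "snd \<sigma> = snd s" "fst \<sigma> ''n'' = n" "fst \<sigma> ''m'' = fst s ''m''" "fst \<sigma> ''u'' = u"
      "fst \<sigma> ''j'' = fst s ''j''" "fst \<sigma> ''k'' = fst s ''k''" "fst \<sigma> ''b'' \<le> n" "fst \<sigma> ''b'' \<noteq> u"
      and Sa: "fst \<sigma> ''a'' \<le> card {z. z < n \<and> c z = fst \<sigma> ''b''}"
      and Smax: "\<And>l. l < Suc n \<Longrightarrow> l \<noteq> u \<Longrightarrow> card {z. z < n \<and> c z = l} \<le> fst \<sigma> ''a''"
      using that unfolding P_def by blast+
    have le: "fst \<sigma> ''b'' \<le> W" using S(7) F(3) by simp
    show ?thesis
      apply (rule runs_Seq_Assign, simp add: S F, simp, simp add: S)
      apply (rule runs_Seq[where ?T1.0 = "24 * Suc n" and ?T2.0 = "24 * Suc n"])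
       apply (rule runs_Fill[where n = n and B = "\<lambda>z. c z = fst \<sigma> ''b''"])
               apply (simp_all add: label_is_def S F le cong: if_cong)
      apply (rule runs_Fill[where n = n and B = "\<lambda>z. c z = fst \<sigma> ''b''"])
              apply (simp_all add: S F le cong: if_cong)
      apply (rule Q)
             apply (simp_all add: S)
      apply (rule order_trans[OF Smax Sa], simp_all)
      done
  qed
  define q where "q = Suc n * Suc n"
  have q: "n \<le> q" "1 \<le> q" "n * n + 2 * n + 1 = q" unfolding q_def by simp_all
  have mult: "Suc n * (24 * Suc n + 40 + 8) = 24 * q + 48 * Suc n"
    unfolding q_def by (simp add: algebra_simps)
  show ?thesis
    unfolding select_body_def q_def[symmetric]
    apply (rule runs_Seq_Assign, simp add: F, use q in simp, simp add: F)
    apply (rule runs_Seq_Assign, simp add: F, use q in simp, simp add: F)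
    apply (rule runs_Seq_Assign, simp add: F, use q in simp, simp add: F)
    apply (rule runs_Seq[where ?T1.0 = "24 * q + 72 * Suc n + 50" and ?T2.0 = "48 * Suc n + 20"])
     apply (rule runs_For[where N = "Suc n" and T = "24 * Suc n + 40" and I = P])
            apply (simp add: F)
           apply (simp add: F)
          apply (simp add: F)
         apply simp
        apply (use u in \<open>simp add: P_def F\<close>)
       apply (rule step; assumption)
      apply (erule rest[unfolded One_nat_def])
     apply (unfold mult)
     apply (use q in simp_all)
    done
qed

definition search_step :: com where
  "search_step = Seq (Find (Conj (Equal (Load ''q'' (Load ''src'' (Reg ''e''))) (Const 1))
      (Conj (Equal (Load ''q'' (Load ''dst'' (Reg ''e''))) (Const 0))
        (Equal (Load ''part'' (Load ''dst'' (Reg ''e''))) (Reg ''l'')))))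
    (Cond (Less (Reg ''w'') (Reg ''n''))
      (Seq (Store ''q'' (Reg ''w'') (Const 1)) (Assign ''z'' (Reg ''w''))) Skip)"

text \<open>One scan of the edge list either adds a single vertex or certifies that no edge leaves
  the visited set within the class \<open>l\<close>.\<close>

lemma runs_search_step:
  fixes s :: state
  defines "src \<equiv> snd s ''src''" and "dst \<equiv> snd s ''dst''" and "q \<equiv> snd s ''q''" and "pt \<equiv> snd s ''part''"
  assumes n: "fst s ''n'' = n" "fst s ''m'' = m" "n \<le> W" "m \<le> W" "1 \<le> W" "fst s ''l'' = l" "l \<le> W"
    and e: "\<And>i. i < m \<Longrightarrow> src i < n" "\<And>i. i < m \<Longrightarrow> dst i < n"
    and x: "\<And>x. x < n \<Longrightarrow> q x \<le> 1" "\<And>x. x < n \<Longrightarrow> pt x \<le> W"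
    and complete: "\<And>\<rho>. (\<And>i. i < m \<Longrightarrow> q (src i) = 1 \<Longrightarrow> q (dst i) = 0 \<Longrightarrow> pt (dst i) \<noteq> l) \<Longrightarrow>
      (\<And>r. r \<notin> {''w'', ''e''} \<Longrightarrow> \<rho> r = fst s r) \<Longrightarrow> Q (\<rho>, snd s)"
    and step: "\<And>\<rho> i. i < m \<Longrightarrow> q (src i) = 1 \<Longrightarrow> q (dst i) = 0 \<Longrightarrow> pt (dst i) = l \<Longrightarrow>
      (\<And>r. r \<notin> {''w'', ''e'', ''z''} \<Longrightarrow> \<rho> r = fst s r) \<Longrightarrow> \<rho> ''z'' = dst i \<Longrightarrow>
      Q (\<rho>, (snd s)(''q'' := q(dst i := 1)))"
  shows "runs W search_step s (40 * Suc m + 20) Q"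
proof -
  have F: "fst s ''n'' = n" "fst s ''m'' = m" "n \<le> W" "m \<le> W" "Suc 0 \<le> W" "fst s ''l'' = l" "l \<le> W"
    "snd s ''src'' = src" "snd s ''dst'' = dst" "snd s ''q'' = q" "snd s ''part'' = pt"
    "\<And>i. i < m \<Longrightarrow> i \<le> W" "\<And>i. i < m \<Longrightarrow> src i \<le> W" "\<And>i. i < m \<Longrightarrow> dst i \<le> W"
    "\<And>i. i < m \<Longrightarrow> q (src i) \<le> W" "\<And>i. i < m \<Longrightarrow> q (dst i) \<le> W" "\<And>i. i < m \<Longrightarrow> pt (dst i) \<le> W"
    using n order_trans[OF less_imp_le[OF e(1)] n(3)] order_trans[OF less_imp_le[OF e(2)] n(3)]
      order_trans[OF x(1)[OF e(1)] n(5)] order_trans[OF x(1)[OF e(2)] n(5)] x(2)[OF e(2)]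
    unfolding src_def dst_def q_def pt_def by simp_all
  let ?B = "\<lambda>i. q (src i) = 1 \<and> q (dst i) = 0 \<and> pt (dst i) = l"
  have cont: "runs W (Cond (Less (Reg ''w'') (Reg ''n''))
      (Seq (Store ''q'' (Reg ''w'') (Const 1)) (Assign ''z'' (Reg ''w''))) Skip)
      ((fst s)(''w'' := w, ''e'' := m), snd s) 20 Q"
    if w: "(w = n \<and> (\<forall>i<m. \<not> ?B i)) \<or> (\<exists>i<m. ?B i \<and> w = dst i)" for w
    using w
  proof
    assume a: "w = n \<and> (\<forall>i<m. \<not> ?B i)"
    show ?thesis
      apply (rule runs_Cond[where T' = 10])
         apply (use a F in simp)
        apply (use a F in simp)
       apply (rule runs_Skip)
        apply (rule complete)
         apply (use a F in auto)
      done
  next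
    assume "\<exists>i<m. ?B i \<and> w = dst i"
    then obtain i where i: "i < m" "q (src i) = 1" "q (dst i) = 0" "pt (dst i) = l" "w = dst i" by blast
    have "w < n" using i e by simp
    show ?thesis
      apply (rule runs_Cond[where T' = 10])
         apply (use \<open>w < n\<close> F in simp)
        apply (rule runs_Seq_Store)
           apply (use \<open>w < n\<close> F in simp)
          apply (use \<open>w < n\<close> F in simp)
         apply simp
        apply (rule runs_Assign)
          apply (use \<open>w < n\<close> F in simp)
         apply simp
        apply (simp add: F i(5))
        apply (rule step[OF i(1-4), simplified])
         apply simp
        apply simp
       apply (use \<open>w < n\<close> F in simp_all)
      done
  qed
  show ?thesis unfolding search_step_def
    apply (rule runs_Seq[where ?T1.0 = "40 * Suc m" and ?T2.0 = 20])
     apply (rule runs_Find[where n = n and m = m and B = ?B])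
              apply (simp_all add: F)[8]
      apply (rule cont, simp only: F)
     apply simp_all
    done
qed

definition pick_prog :: com where
  "pick_prog = For ''i'' ''n'' (Seq (Assign ''l'' (Load ''part'' (Reg ''i'')))
    (Seq (Count ''r'' (label_is ''part'' ''l''))
    (Cond (Less (Const 1) (Reg ''r'')) (Assign ''y'' (Reg ''i'')) Skip)))"

lemma runs_pick:
  fixes s :: state
  defines "pt \<equiv> snd s ''part''"
  assumes n: "fst s ''n'' = n" "n \<le> W" "1 \<le> W" and pt: "\<And>x. x < n \<Longrightarrow> pt x \<le> W"
    and ex: "\<exists>i<n. 2 \<le> card {z. z < n \<and> pt z = pt i}"
    and Q: "\<And>\<rho>. \<rho> ''y'' < n \<Longrightarrow> 2 \<le> card {z. z < n \<and> pt z = pt (\<rho> ''y'')} \<Longrightarrow>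
      \<rho> ''n'' = n \<Longrightarrow> \<rho> ''m'' = fst s ''m'' \<Longrightarrow> \<rho> ''j'' = fst s ''j'' \<Longrightarrow> \<rho> ''k'' = fst s ''k'' \<Longrightarrow> Q (\<rho>, snd s)"
  shows "runs W pick_prog s (100 * (Suc n * Suc n)) Q"
proof -
  define N where "N i = card {z. z < n \<and> pt z = pt i}" for i
  have N: "N i \<le> W" for i using card_less_Collect_le[of n "\<lambda>z. pt z = pt i"] n(2) unfolding N_def by simp
  \<comment> \<open>Register \<open>''y''\<close> is unconstrained until the first candidate has
    been seen; the hypothesis \<open>ex\<close> guarantees one by the end.\<close>
  define P where "P i \<sigma> \<longleftrightarrow> snd \<sigma> = snd s \<and> fst \<sigma> ''n'' = n \<and> fst \<sigma> ''m'' = fst s ''m'' \<and>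
    fst \<sigma> ''j'' = fst s ''j'' \<and> fst \<sigma> ''k'' = fst s ''k'' \<and>
    ((\<exists>l<i. 2 \<le> N l) \<longrightarrow> fst \<sigma> ''y'' < n \<and> 2 \<le> N (fst \<sigma> ''y''))" for i and \<sigma> :: state
  have F: "n \<le> W" "Suc 0 \<le> W" "snd s ''part'' = pt" "\<And>i. i < n \<Longrightarrow> i \<le> W"
    using n unfolding pt_def by auto
  have step: "runs W (Seq (Assign ''l'' (Load ''part'' (Reg ''i'')))
    (Seq (Count ''r'' (label_is ''part'' ''l''))
    (Cond (Less (Const 1) (Reg ''r'')) (Assign ''y'' (Reg ''i'')) Skip))) \<sigma> (24 * Suc n + 20)
       (\<lambda>\<sigma>'. fst \<sigma>' ''i'' = i \<and> fst \<sigma>' ''n'' = n \<and> P (Suc i) ((fst \<sigma>')(''i'' := Suc i), snd \<sigma>'))"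
    if i: "i < n" and \<sigma>: "P i \<sigma>" "fst \<sigma> ''i'' = i" for i \<sigma>
  proof -
    have S: "snd \<sigma> = snd s" "fst \<sigma> ''n'' = n" "fst \<sigma> ''m'' = fst s ''m''"
      "fst \<sigma> ''j'' = fst s ''j''" "fst \<sigma> ''k'' = fst s ''k''" "fst \<sigma> ''i'' = i"
      and Sy: "(\<exists>l<i. 2 \<le> N l) \<longrightarrow> fst \<sigma> ''y'' < n \<and> 2 \<le> N (fst \<sigma> ''y'')"
      using \<sigma> unfolding P_def by blast+
    have le: "i \<le> W" "pt i \<le> W" "N i \<le> W" using i pt F N by simp_all
    have no: "(\<exists>l<Suc i. 2 \<le> N l) \<longrightarrow> fst \<sigma> ''y'' < n \<and> 2 \<le> N (fst \<sigma> ''y'')" if "\<not> Suc 0 < N i"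
    proof -
      have "\<not> 2 \<le> N i" using that by simp
      then show ?thesis using Sy unfolding less_Suc_eq by blast
    qed
    show ?thesis
      apply (rule runs_Seq_Assign, simp add: S F le, simp, simp add: S F)
      apply (rule runs_Seq[where ?T1.0 = "24 * Suc n" and ?T2.0 = 12])
       apply (rule runs_Count[where n = n and B = "\<lambda>z. pt z = pt i"])
               apply (simp_all add: label_is_def S F le pt flip: N_def)
      apply (rule runs_Cond[where T' = 5])
         apply (simp add: S F le)
        apply (rule runs_Assign, simp add: S F le, simp)
        apply (use i in \<open>simp add: P_def S\<close>)
       apply (rule runs_Skip)
        apply (use no in \<open>simp add: P_def S\<close>)
       apply simp_all
      done
  qed
  have "n * (24 * Suc n + 20 + 8) + (24 * Suc n + 20) + 10 \<le> 100 * (Suc n * Suc n)"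
    by (simp add: algebra_simps)
  then show ?thesis unfolding pick_prog_def
    apply (intro runs_For[where N = n and T = "24 * Suc n + 20" and I = P])
           apply (use n in simp_all)[4]
       apply (use n in \<open>simp add: P_def\<close>)
      apply (rule step; assumption)
     subgoal premises prems for \<sigma>
     proof -
       have \<sigma>: "\<sigma> = (fst \<sigma>, snd s)" using prems(2) unfolding P_def by (simp add: prod_eq_iff)
       have "Q (fst \<sigma>, snd s)"
         by (rule Q) (use prems(2) ex in \<open>auto simp: P_def N_def\<close>)
       then show ?thesis using \<sigma> by simp
     qed
    apply assumption
    done
qed

subsection \<open>Correctness of the phases\<close>

text \<open>As \<open>R\<close> is symmetric, the last clause demands both orientations of every
  edge; this holds after \<open>sym_prog\<close>. Later phases preserve it because they leave
  \<open>''src''\<close> and \<open>''dst''\<close> alone.\<close>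

definition env :: "nat \<Rightarrow> nat \<Rightarrow> (nat \<Rightarrow> nat \<Rightarrow> bool) \<Rightarrow> state \<Rightarrow> bool" where
  "env n m R s \<longleftrightarrow> fst s ''n'' = n \<and> fst s ''m'' = m \<and>
     (\<forall>i<m. R (snd s ''src'' i) (snd s ''dst'' i)) \<and>
     (\<forall>x y. R x y \<longrightarrow> (\<exists>i<m. snd s ''src'' i = x \<and> snd s ''dst'' i = y))"

section \<open>The depth-first search phase\<close>

definition dfs_body :: com where
  "dfs_body = Seq (Find (Conj (Equal (Load ''src'' (Reg ''e'')) (Reg ''u''))
      (Equal (Load ''h'' (Load ''dst'' (Reg ''e''))) (Const 0))))
    (Cond (Less (Reg ''w'') (Reg ''n'')) push_prog pop_prog)"

definition dfs_prog :: com where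
  "dfs_prog = Seq (Store ''h'' (Const 0) (Const 1)) (Loop (Equal (Reg ''f'') (Const 0)) dfs_body)"

text \<open>Here \<open>m\<close> is the length of the doubled edge list, and
  \<open>n \<le> m\<close> reflects that every vertex has an incident edge.\<close>

locale word_graph = ngraph +
  fixes m W :: nat
  assumes n2: "2 \<le> n" and n_le_m: "n \<le> m" and mW: "m + 2 \<le> W" and nW: "4 * n + 4 \<le> W"
begin

lemma le_W: "x < n \<Longrightarrow> x \<le> W"
  using nW by simp

lemma nm_pos: "1 \<le> n * m"
  using mult_le_mono[of 1 n 1 m] n2 n_le_m by simp

abbreviation "G \<equiv> env n m R"

lemma envD:
  assumes "G s"
  shows "fst s ''n'' = n" "fst s ''m'' = m" "i < m \<Longrightarrow> R (snd s ''src'' i) (snd s ''dst'' i)"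
    "i < m \<Longrightarrow> snd s ''src'' i < n" "i < m \<Longrightarrow> snd s ''dst'' i < n"
    "R x y \<Longrightarrow> \<exists>i<m. snd s ''src'' i = x \<and> snd s ''dst'' i = y"
  using assms bounded bounded' unfolding env_def by blast+

lemma env_frame:
  assumes "G s" "\<rho> ''n'' = n" "\<rho> ''m'' = m" "M ''src'' = snd s ''src''" "M ''dst'' = snd s ''dst''"
  shows "G (\<rho>, M)"
  using assms unfolding env_def by simp

definition dfs_at :: "nat list \<Rightarrow> state \<Rightarrow> bool" where
  "dfs_at st s \<longleftrightarrow> G s \<and> st \<noteq> [] \<and> fst s ''u'' = hd st \<and>
     dfs_state n R st (snd s ''h'') (snd s ''c'') (snd s ''p'')"

definition centroid_found :: "nat list \<Rightarrow> state \<Rightarrow> bool" where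
  "centroid_found st s \<longleftrightarrow> (\<forall>y. R (hd st) y \<longrightarrow> snd s ''h'' y \<noteq> 0) \<and>
     n < 2 * card {x. x < n \<and> snd s ''h'' x = Suc (hd st)}"

text \<open>An undiscovered vertex pays for one push and one later pop, a vertex on the stack for
  its pop. The successor keeps the value 0 for the stopped search.\<close>

definition potential :: "nat list \<Rightarrow> state \<Rightarrow> nat" where
  "potential st s = Suc (2 * card {x. x < n \<and> snd s ''h'' x = 0} + length st)"

definition dfs_inv :: "nat \<Rightarrow> state \<Rightarrow> bool" where
  "dfs_inv j s \<longleftrightarrow> (\<exists>st. dfs_at st s \<and>
     (fst s ''f'' = 0 \<and> j = potential st s \<or> fst s ''f'' = 1 \<and> j = 0 \<and> centroid_found st s))"

lemma dfs_inv_push: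
  assumes inv: "dfs_at st s" and f: "fst s ''f'' = 0"
    and w: "R (fst s ''u'') (fst s ''w'')" "snd s ''h'' (fst s ''w'') = 0"
  shows "runs W push_prog s 20 (\<lambda>s'. \<exists>j'<potential st s. dfs_inv j' s')"
proof -
  let ?w = "fst s ''w''" and ?h = "snd s ''h''"
  obtain u st' where st: "st = u # st'" "fst s ''u'' = u"
    using inv unfolding dfs_at_def by (cases st) auto
  interpret dfs_state n R st ?h "snd s ''c''" "snd s ''p''"
    using inv unfolding dfs_at_def by blast
  have wn: "?w < n" "u < n" using w bounded bounded' st by auto
  have env: "G s" using inv unfolding dfs_at_def by blast
  define s' where "s' = ((fst s)(''u'' := fst s ''w''), (snd s)
       (''p'' := (snd s ''p'')(fst s ''w'' := fst s ''u''),
        ''h'' := (snd s ''h'')(fst s ''w'' := Suc (fst s ''w'')),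
        ''c'' := (snd s ''c'')(fst s ''w'' := fst s ''w'')))"
  have "dfs_state n R (?w # st) (?h(?w := Suc ?w)) ((snd s ''c'')(?w := ?w)) ((snd s ''p'')(?w := u))"
    by (rule push[OF st(1)]) (use w st in auto)
  moreover have "G s'" unfolding s'_def by (rule env_frame[OF env]) (use envD[OF env] in simp_all)
  ultimately have at: "dfs_at (?w # st) s'" unfolding dfs_at_def s'_def using st by simp
  have "{x. x < n \<and> ?h x = 0} = insert ?w {x. x < n \<and> snd s' ''h'' x = 0}"
    using wn w unfolding s'_def by (auto split: if_splits)
  moreover have "?w \<notin> {x. x < n \<and> snd s' ''h'' x = 0}" unfolding s'_def by simp
  ultimately have "card {x. x < n \<and> ?h x = 0} = Suc (card {x. x < n \<and> snd s' ''h'' x = 0})"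
    by simp
  then have "potential (?w # st) s' < potential st s" unfolding potential_def by simp
  moreover have "dfs_inv (potential (?w # st) s') s'"
    unfolding dfs_inv_def using at f by (intro exI[of _ "?w # st"]) (simp add: s'_def)
  ultimately show ?thesis
    by (intro runs_push) (use wn st nW in \<open>auto simp: s'_def\<close>)
qed

text \<open>Either the subtree is large and the search stops at index 0, or a genuine pop shortens
  the stack.\<close>

lemma dfs_inv_pop:
  assumes inv: "dfs_at st s" and f: "fst s ''f'' = 0"
    and nw: "\<And>y. R (fst s ''u'') y \<Longrightarrow> snd s ''h'' y \<noteq> 0"
  shows "runs W pop_prog s (72 * Suc n + 50) (\<lambda>s'. \<exists>j'<potential st s. dfs_inv j' s')"
proof -
  let ?h = "snd s ''h''" and ?p = "snd s ''p''"
  obtain u st' where st: "st = u # st'" "fst s ''u'' = u"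
    using inv unfolding dfs_at_def by (cases st) auto
  interpret dfs_state n R st ?h "snd s ''c''" ?p
    using inv unfolding dfs_at_def by blast
  have un: "u < n" using st st_bound by auto
  have env: "G s" using inv unfolding dfs_at_def by blast
  have hW: "?h x \<le> W" if "x < n" for x
    using hangs[OF that] st_bound nW by (cases "?h x = 0") auto
  \<comment> \<open>The root of the search is never popped: when only \<open>u\<close> is on the
    stack and all its neighbours are discovered, connectedness makes every vertex hang from
    \<open>u\<close>, so its subtree is large.\<close>
  have parent: "\<exists>st''. st' = ?p u # st'' \<and> ?p u < n" if small: "2 * card {x. x < n \<and> ?h x = Suc u} \<le> n"
  proof (cases st')
    case Nil
    have "{x. x < n \<and> ?h x = Suc u} = {..<n}"
    proof -
      have nz: "x \<in> {x. ?h x \<noteq> 0}" if "x < n" for x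
      proof (rule connD[OF connected])
        show "u \<in> {..<n}" using un by simp
        show "u \<in> {x. ?h x \<noteq> 0}" using on_stack st by simp
        fix a b assume "a \<in> {x. ?h x \<noteq> 0}" "R a b"
        then show "b \<in> {x. ?h x \<noteq> 0}" using no_white[of a b] nw st Nil by (cases "a = u") auto
      qed (use that in simp)
      then show ?thesis using hangs st Nil by fastforce
    qed
    then show ?thesis using small un by simp
  next
    case (Cons w st'')
    then have "?p u = w" "w < n" using st_path st_bound st by auto
    then show ?thesis using Cons by simp
  qed
  show ?thesis
  proof (rule runs_pop[where n = n and u = u, OF _ _ _ _ un hW refl])
    fix \<rho> :: "string \<Rightarrow> nat"
    assume large: "n < 2 * card {x. x < n \<and> ?h x = Suc u}"
      and \<rho>: "\<rho> ''n'' = n" "\<rho> ''m'' = fst s ''m''" "\<rho> ''u'' = u" "\<rho> ''f'' = 1"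
    have "dfs_at st (\<rho>, snd s)" using inv \<rho> st env_frame[OF env, of \<rho> "snd s"] envD[OF env]
      unfolding dfs_at_def by simp
    moreover have "centroid_found st (\<rho>, snd s)"
      unfolding centroid_found_def using large nw st by simp
    ultimately have "dfs_inv 0 (\<rho>, snd s)" unfolding dfs_inv_def using \<rho> by auto
    then show "\<exists>j'<potential st s. dfs_inv j' (\<rho>, snd s)" unfolding potential_def by blast
  next
    fix \<rho> :: "string \<Rightarrow> nat"
    assume small: "2 * card {x. x < n \<and> ?h x = Suc u} \<le> n"
      and \<rho>: "\<rho> ''n'' = n" "\<rho> ''m'' = fst s ''m''" "\<rho> ''u'' = ?p u" "\<rho> ''f'' = fst s ''f''"
    from parent[OF small] obtain st'' where p: "st' = ?p u # st''" "?p u < n" by blast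
    define h' where "h' x = (if x < n \<and> ?h x = Suc u then Suc (?p u) else ?h x)" for x
    define c' where "c' x = (if x < n \<and> ?h x = Suc u then u else snd s ''c'' x)" for x
    let ?s' = "(\<rho>, (snd s)(''c'' := c', ''h'' := h'))"
    have "dfs_state n R (?p u # st'') h' c' ?p"
      by (rule pop[of u]) (use st p nw small in \<open>auto simp: h'_def c'_def\<close>)
    moreover have "G ?s'" by (rule env_frame[OF env]) (use envD[OF env] \<rho> in simp_all)
    ultimately have "dfs_at st' ?s'" unfolding dfs_at_def using \<rho> p by simp
    moreover have "potential st' ?s' < potential st s"
    proof -
      have "{x. x < n \<and> h' x = 0} = {x. x < n \<and> ?h x = 0}" unfolding h'_def by auto
      then show ?thesis unfolding potential_def using st by simp
    qed
    ultimately have "\<exists>j'<potential st s. dfs_inv j' ?s'"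
      using \<rho> f unfolding dfs_inv_def by auto
    then show "\<exists>j'<potential st s. dfs_inv j' (\<rho>, (snd s)
       (''c'' := \<lambda>x. if x < n \<and> ?h x = Suc u then u else snd s ''c'' x,
        ''h'' := \<lambda>x. if x < n \<and> ?h x = Suc u then Suc (?p u) else ?h x))"
      unfolding h'_def c'_def .
  next
    assume "2 * card {x. x < n \<and> ?h x = Suc u} \<le> n"
    then show "?p u < W" using parent nW by fastforce
  qed (use env nW st envD[OF env] in auto)
qed

lemma runs_dfs_body:
  assumes inv: "dfs_inv j s" and f: "fst s ''f'' = 0"
  shows "runs W dfs_body s (300 * m) (\<lambda>s'. \<exists>j'<j. dfs_inv j' s')"
proof -
  obtain st where at: "dfs_at st s" and j: "j = potential st s"
    using inv f unfolding dfs_inv_def by auto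
  have env: "G s" and u: "fst s ''u'' = hd st" "st \<noteq> []" using at unfolding dfs_at_def by auto
  interpret dfs_state n R st "snd s ''h''" "snd s ''c''" "snd s ''p''"
    using at unfolding dfs_at_def by blast
  have un: "fst s ''u'' < n" using subsetD[OF st_bound hd_in_set[OF u(2)]] u(1) by simp
  have hW: "snd s ''h'' x \<le> W" if "x < n" for x
    using hangs[OF that] st_bound nW by (cases "snd s ''h'' x = 0") auto
  note e = envD[OF env]
  have W: "n \<le> W" "m \<le> W" "Suc 0 \<le> W" "fst s ''u'' \<le> W" "\<And>i. i < m \<Longrightarrow> i \<le> W"
    "\<And>i. i < m \<Longrightarrow> snd s ''src'' i \<le> W" "\<And>i. i < m \<Longrightarrow> snd s ''dst'' i \<le> W"
    "\<And>i. i < m \<Longrightarrow> snd s ''h'' (snd s ''dst'' i) \<le> W"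
    using nW mW un hW[OF e(5)] le_W[OF e(4)] le_W[OF e(5)] by simp_all
  let ?B = "\<lambda>i. snd s ''src'' i = fst s ''u'' \<and> snd s ''h'' (snd s ''dst'' i) = 0"
  have "runs W (Cond (Less (Reg ''w'') (Reg ''n'')) push_prog pop_prog)
      ((fst s)(''w'' := w, ''e'' := m), snd s) (72 * Suc n + 60) (\<lambda>s'. \<exists>j'<j. dfs_inv j' s')"
    if w: "(w = n \<and> (\<forall>i<m. \<not> ?B i)) \<or> (\<exists>i<m. ?B i \<and> w = snd s ''dst'' i)" for w
  proof -
    let ?s = "((fst s)(''w'' := w, ''e'' := m), snd s)"
    have "G ?s" by (rule env_frame[OF env]) (use e in simp_all)
    then have at': "dfs_at st ?s" using at unfolding dfs_at_def by simp
    have j': "j = potential st ?s" unfolding j potential_def by simp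
    have wW: "w \<le> W" using w W by auto
    show ?thesis
    proof (rule runs_Cond[where T' = "72 * Suc n + 55"])
      assume "bval ?s (Less (Reg ''w'') (Reg ''n''))"
      then have "w < n" using e by simp
      then obtain i where i: "i < m" "?B i" "w = snd s ''dst'' i" using w by auto
      show "runs W push_prog ?s (72 * Suc n + 55) (\<lambda>s'. \<exists>j'<j. dfs_inv j' s')"
        unfolding j' by (rule runs_mono[OF dfs_inv_push[OF at']]) (use f e(3)[OF i(1)] i in auto)
    next
      assume "\<not> bval ?s (Less (Reg ''w'') (Reg ''n''))"
      then have no: "\<forall>i<m. \<not> ?B i" using w e by auto
      have "snd s ''h'' y \<noteq> 0" if "R (fst s ''u'') y" for y using e(6)[OF that] no by auto
      then show "runs W pop_prog ?s (72 * Suc n + 55) (\<lambda>s'. \<exists>j'<j. dfs_inv j' s')"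
        unfolding j' by (intro runs_mono[OF dfs_inv_pop[OF at']]) (use f in auto)
    qed (use e W wW in auto)
  qed
  note cont = this
  show ?thesis unfolding dfs_body_def
    apply (rule runs_Seq[where ?T1.0 = "30 * Suc m" and ?T2.0 = "72 * Suc n + 60"])
     apply (rule runs_Find[where n = n and m = m and B = ?B])
              apply (simp_all add: e W)[8]
      apply (erule cont)
     apply (use n_le_m n2 in simp_all)
    done
qed

lemma runs_dfs:
  assumes env: "G s" and init: "fst s ''u'' = 0" "fst s ''f'' = 0" "snd s ''h'' = (\<lambda>_. 0)" "snd s ''c'' = (\<lambda>_. 0)"
    and Q: "\<And>s' st. dfs_at st s' \<Longrightarrow> centroid_found st s' \<Longrightarrow> Q s'"
  shows "runs W dfs_prog s (1000 * (n * m)) Q"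
proof -
  let ?s = "(fst s, (snd s)(''h'' := (\<lambda>_. 0)(0 := Suc 0)))"
  have "G ?s" by (rule env_frame[OF env]) (use envD[OF env] in simp_all)
  moreover have "dfs_state n R [0] ((\<lambda>_. 0)(0 := 1)) (\<lambda>_. 0) (snd s ''p'')"
    by (rule dfs_init) (use n2 in simp)
  ultimately have at: "dfs_at [0] ?s" unfolding dfs_at_def using init by simp
  have inv: "dfs_inv (potential [0] ?s) ?s" unfolding dfs_inv_def using at init by auto
  have "{x. x < n \<and> snd ?s ''h'' x = 0} = {1..<n}" by auto
  \<comment> \<open>There are \<open>n - 1\<close> undiscovered vertices and one stack entry, so the
    potential is \<open>2 * (n - 1) + 2\<close>.\<close>
  then have pot: "potential [0] ?s = 2 * n" unfolding potential_def using n2 by simp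
  have "Suc (2 * n) * (300 * m + bcost (Equal (Reg ''f'') (Const 0)) + 1) \<le> (3 * n) * (304 * m)"
    using n2 n_le_m by (intro mult_le_mono) auto
  also have "\<dots> = 912 * (n * m)" by simp
  finally have T: "Suc (2 * n) * (300 * m + bcost (Equal (Reg ''f'') (Const 0)) + 1) \<le> 1000 * (n * m) - 3"
    using nm_pos by linarith
  have T3: "3 \<le> 1000 * (n * m)" using nm_pos by linarith
  have loop: "runs W (Loop (Equal (Reg ''f'') (Const 0)) dfs_body) ?s (1000 * (n * m) - 3) Q"
  proof (rule runs_Loop[where I = dfs_inv and T = "300 * m", OF inv])
    fix j \<sigma> assume "dfs_inv j \<sigma>" "\<not> bval \<sigma> (Equal (Reg ''f'') (Const 0))"
    then obtain st where "dfs_at st \<sigma>" "centroid_found st \<sigma>" unfolding dfs_inv_def by auto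
    then show "Q \<sigma>" by (rule Q)
  next
    fix j \<sigma> assume "dfs_inv j \<sigma>"
    then show "bfits W \<sigma> (Equal (Reg ''f'') (Const 0))" using mW unfolding dfs_inv_def by auto
  next
    fix j \<sigma> assume "dfs_inv j \<sigma>" "bval \<sigma> (Equal (Reg ''f'') (Const 0))"
    then show "runs W dfs_body \<sigma> (300 * m) (\<lambda>s'. \<exists>j'<j. dfs_inv j' s')"
      using runs_dfs_body by simp
  qed (use T pot in simp)
  show ?thesis unfolding dfs_prog_def
    by (rule runs_Seq_Store) (use mW T3 loop init in \<open>simp_all add: numeral_3_eq_3\<close>)
qed

end

section \<open>Forming the pieces around the root and selecting the largest ones\<close>

definition pieces_prog :: com where
  "pieces_prog = Seq (Assign ''a'' (Plus (Reg ''u'') (Const 1)))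
    (Seq (Fill (Neg (label_is ''h'' ''a'')) ''c'' ''n'') (For ''e'' ''m'' piece_body))"

definition select_prog :: "nat \<Rightarrow> com" where
  "select_prog K = Seq (Assign ''t'' (Const 0)) (Seq (Fill (Equal (Const 0) (Const 0)) ''part'' ''t'')
    (Seq (Assign ''k'' (Const K)) (For ''j'' ''k'' select_body)))"

context word_graph
begin

text \<open>With no edge from \<open>A\<close> to a subtree piece left, and no cross edges between
  subtree pieces, the labelling is constant along every edge of \<open>G - v\<close>.\<close>

lemma final_pieces_subtree:
  assumes C: "subtree_pieces n R v C"
    and edges: "\<And>x y. R x y \<Longrightarrow> C x = n \<Longrightarrow> C y \<in> {n, v}"
  shows "final_pieces n R v C"
proof -
  have one: "\<forall>x<n. C x = v \<longrightarrow> x = v" using C unfolding subtree_pieces_def by blast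
  have "C x = C y" if xy: "R x y" "x \<noteq> v" "y \<noteq> v" for x y
  proof -
    have "C x \<noteq> v" "C y \<noteq> v" using one xy bounded bounded' by blast+
    moreover have "C x = n \<longleftrightarrow> C y = n"
      using edges[OF xy(1)] edges[OF R_sym[OF xy(1)]] calculation by auto
    moreover have "C x \<notin> {n, v} \<Longrightarrow> C y \<notin> {n, v} \<Longrightarrow> C x = C y"
      using C xy(1) unfolding subtree_pieces_def by blast
    ultimately show ?thesis by (cases "C x = n") auto
  qed
  then show ?thesis using C one unfolding final_pieces_def subtree_pieces_def by blast
qed

lemma final_pieces_three: "three_pieces n R v C i \<Longrightarrow> final_pieces n R v C"
  unfolding three_pieces_def final_pieces_def by blast

definition pieces_inv :: "nat \<Rightarrow> nat \<Rightarrow> state \<Rightarrow> bool" where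
  "pieces_inv v i s \<longleftrightarrow> G s \<and> fst s ''u'' = v \<and>
     (subtree_pieces n R v (snd s ''c'') \<and>
      (\<forall>j<i. snd s ''c'' (snd s ''src'' j) = n \<longrightarrow> snd s ''c'' (snd s ''dst'' j) \<in> {n, v}) \<or>
      (\<exists>a. three_pieces n R v (snd s ''c'') a))"

text \<open>A single pass suffices: an absorption can endanger only earlier edges whose source lies
  in the absorbed piece, and without cross edges these lead into that piece, \<open>A\<close> or
  \<open>v\<close>.\<close>

lemma runs_piece_inv:
  assumes inv: "pieces_inv v i s" and i: "i < m" "fst s ''e'' = i"
  shows "runs W piece_body s (79 * Suc n + 60)
    (\<lambda>s'. fst s' ''e'' = i \<and> fst s' ''m'' = m \<and> pieces_inv v (Suc i) ((fst s')(''e'' := Suc i), snd s'))"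
proof -
  have env: "G s" and u: "fst s ''u'' = v" using inv unfolding pieces_inv_def by blast+
  note e = envD[OF env]
  let ?C = "snd s ''c''" and ?x = "snd s ''src'' i" and ?y = "snd s ''dst'' i"
  have star: "star_pieces n R v ?C"
    using inv unfolding pieces_inv_def subtree_pieces_def three_pieces_def by blast
  have v: "v < n" "?C v = v" "\<And>x. x < n \<Longrightarrow> ?C x \<le> n" using star unfolding star_pieces_def by blast+
  have cases: "(subtree_pieces n R v ?C \<and>
      (\<forall>j<i. ?C (snd s ''src'' j) = n \<longrightarrow> ?C (snd s ''dst'' j) \<in> {n, v})) \<or>
      (\<exists>a. three_pieces n R v ?C a)"
    using inv unfolding pieces_inv_def by blast
  show ?thesis
  proof (rule runs_piece[where n = n and u = v])
    assume "\<not> (?C (snd s ''src'' (fst s ''e'')) = n \<and> ?C (snd s ''dst'' (fst s ''e'')) \<noteq> n \<and>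
      ?C (snd s ''dst'' (fst s ''e'')) \<noteq> v)"
    then have now: "?C ?x = n \<longrightarrow> ?C ?y \<in> {n, v}" using i by auto
    have "G ((fst s)(''e'' := Suc i), snd s)" by (rule env_frame[OF env]) (use e in simp_all)
    then show "fst s ''e'' = i \<and> fst s ''m'' = m \<and> pieces_inv v (Suc i) ((fst s)(''e'' := Suc i), snd s)"
      using cases now i e u unfolding pieces_inv_def less_Suc_eq by auto
  next
    fix \<rho> :: "string \<Rightarrow> nat"
    assume x: "?C (snd s ''src'' (fst s ''e'')) = n" and y: "?C (snd s ''dst'' (fst s ''e'')) \<noteq> n"
        "?C (snd s ''dst'' (fst s ''e'')) \<noteq> v"
      and large: "n < 2 * (card {z. z < n \<and> ?C z = n} + card {z. z < n \<and> ?C z = ?C (snd s ''dst'' (fst s ''e''))})"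
      and \<rho>: "\<rho> ''n'' = n" "\<rho> ''m'' = fst s ''m''" "\<rho> ''u'' = v" "\<rho> ''e'' = fst s ''e''"
    let ?C' = "\<lambda>z. if z < n \<and> ?C z \<noteq> n \<and> ?C z \<noteq> ?C (snd s ''dst'' (fst s ''e'')) then v else ?C z"
    have "\<exists>a. three_pieces n R v ?C' a"
      using cases
    proof
      assume "subtree_pieces n R v ?C \<and>
        (\<forall>j<i. ?C (snd s ''src'' j) = n \<longrightarrow> ?C (snd s ''dst'' j) \<in> {n, v})"
      then show ?thesis
        by (intro exI[of _ "?C ?y"] three_pieces_overflow[of v ?C])
          (use y large i e(5) in \<open>auto simp: cls_def\<close>)
    next
      assume "\<exists>a. three_pieces n R v ?C a"
      then obtain a where a: "three_pieces n R v ?C a" by blast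
      then have "?C ?y = a" using y i e(5) unfolding three_pieces_def by blast
      then show ?thesis
        by (intro exI[of _ a] three_pieces_stable[OF a]) (use i in auto)
    qed
    moreover have "G (\<rho>(''e'' := Suc i), (snd s)(''c'' := ?C'))"
      by (rule env_frame[OF env]) (use e \<rho> in simp_all)
    ultimately show "fst (\<rho>, (snd s)(''c'' := ?C')) ''e'' = i \<and> fst (\<rho>, (snd s)(''c'' := ?C')) ''m'' = m \<and>
      pieces_inv v (Suc i) ((fst (\<rho>, (snd s)(''c'' := ?C')))(''e'' := Suc i), snd (\<rho>, (snd s)(''c'' := ?C')))"
      unfolding pieces_inv_def using \<rho> e i by simp
  next
    fix \<rho> :: "string \<Rightarrow> nat"
    assume x: "?C (snd s ''src'' (fst s ''e'')) = n" and y: "?C (snd s ''dst'' (fst s ''e'')) \<noteq> n"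
        "?C (snd s ''dst'' (fst s ''e'')) \<noteq> v"
      and small: "2 * (card {z. z < n \<and> ?C z = n} + card {z. z < n \<and> ?C z = ?C (snd s ''dst'' (fst s ''e''))}) \<le> n"
      and \<rho>: "\<rho> ''n'' = n" "\<rho> ''m'' = fst s ''m''" "\<rho> ''u'' = v" "\<rho> ''e'' = fst s ''e''"
    let ?C' = "\<lambda>z. if z < n \<and> ?C z = ?C (snd s ''dst'' (fst s ''e'')) then n else ?C z"
    \<comment> \<open>Excludes the overflow state: there the target piece is the third one, and
      \<open>three_pieces\<close> records that together with \<open>A\<close> it exceeds
      \<open>n / 2\<close>.\<close>
    have sub: "subtree_pieces n R v ?C"
      and old: "\<And>j. j < i \<Longrightarrow> ?C (snd s ''src'' j) = n \<Longrightarrow> ?C (snd s ''dst'' j) \<in> {n, v}"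
    proof -
      have "\<not> three_pieces n R v ?C a" for a
      proof
        assume a: "three_pieces n R v ?C a"
        then have "?C ?y = a" using y i e(5) unfolding three_pieces_def by blast
        then show False using a small i unfolding three_pieces_def cls_def by auto
      qed
      then show "subtree_pieces n R v ?C"
        "\<And>j. j < i \<Longrightarrow> ?C (snd s ''src'' j) = n \<Longrightarrow> ?C (snd s ''dst'' j) \<in> {n, v}" using cases by blast+
    qed
    have "subtree_pieces n R v ?C'"
      by (rule subtree_pieces_absorb[OF sub, of "?C ?y" ?x ?y])
        (use x y i e(3)[OF i(1)] small in \<open>auto simp: cls_def\<close>)
    moreover have "?C' (snd s ''dst'' j) \<in> {n, v}" if j: "j < Suc i" "?C' (snd s ''src'' j) = n" for j
    proof (rule ccontr)
      assume *: "?C' (snd s ''dst'' j) \<notin> {n, v}"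
      have jm: "j < m" using j i by simp
      have d: "?C (snd s ''dst'' j) \<noteq> ?C ?y" "?C (snd s ''dst'' j) \<notin> {n, v}"
        using * e(5)[OF jm] i by (auto split: if_splits)
      have "j \<noteq> i" using d by auto
      then have "?C (snd s ''src'' j) \<noteq> n" using old[of j] d j by auto
      \<comment> \<open>The source became part of \<open>A\<close> only now, so it lies in the
        absorbed piece, and the absence of cross edges puts the target there as well.\<close>
      then have "?C (snd s ''src'' j) = ?C ?y" using j(2) i by (auto split: if_splits)
      moreover from this have "?C (snd s ''src'' j) \<notin> {n, v}" using y i by simp
      then have "?C (snd s ''src'' j) = ?C (snd s ''dst'' j)"
        using sub e(3)[OF jm] d(2) unfolding subtree_pieces_def by blast
      ultimately show False using d by simp
    qed
    moreover have "G (\<rho>(''e'' := Suc i), (snd s)(''c'' := ?C'))"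
      by (rule env_frame[OF env]) (use e \<rho> in simp_all)
    ultimately have "pieces_inv v (Suc i) (\<rho>(''e'' := Suc i), (snd s)(''c'' := ?C'))"
      unfolding pieces_inv_def using \<rho> by simp
    then show "fst (\<rho>, (snd s)(''c'' := ?C')) ''e'' = i \<and> fst (\<rho>, (snd s)(''c'' := ?C')) ''m'' = m \<and>
      pieces_inv v (Suc i) ((fst (\<rho>, (snd s)(''c'' := ?C')))(''e'' := Suc i), snd (\<rho>, (snd s)(''c'' := ?C')))"
      using \<rho> e i by simp
  qed (use nW mW e i u v in auto)
qed

lemma runs_pieces:
  assumes at: "dfs_at st s" and found: "centroid_found st s"
    and Q: "\<And>s' v. G s' \<Longrightarrow> fst s' ''u'' = v \<Longrightarrow> final_pieces n R v (snd s' ''c'') \<Longrightarrow> Q s'"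
  shows "runs W pieces_prog s (600 * (n * m)) Q"
proof -
  obtain v st' where st: "st = v # st'" "fst s ''u'' = v"
    using at unfolding dfs_at_def by (cases st) auto
  interpret dfs_state n R st "snd s ''h''" "snd s ''c''" "snd s ''p''"
    using at unfolding dfs_at_def by blast
  have env: "G s" using at unfolding dfs_at_def by blast
  note e = envD[OF env]
  have v: "v < n" using st st_bound by auto
  have hW: "snd s ''h'' x \<le> W" if "x < n" for x
    using hangs[OF that] st_bound nW by (cases "snd s ''h'' x = 0") auto
  let ?C = "\<lambda>x. if x < n \<and> snd s ''h'' x \<noteq> Suc v then n else snd s ''c'' x"
  have C: "subtree_pieces n R v ?C"
    by (rule subtree_pieces_centroid[OF st(1)]) (use found st in \<open>auto simp: centroid_found_def\<close>)
  have main: "runs W (For ''e'' ''m'' piece_body) (\<rho>, (snd s)(''c'' := ?C)) (m * (79 * Suc n + 68) + 79 * Suc n + 70) Q"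
    if \<rho>: "\<rho> ''n'' = n" "\<rho> ''m'' = m" "\<rho> ''u'' = v" for \<rho>
  proof (rule runs_For[where N = m and T = "79 * Suc n + 60" and I = "pieces_inv v"])
    have "G (\<rho>(''e'' := 0), (snd s)(''c'' := ?C))"
      by (rule env_frame[OF env]) (use \<rho> in simp_all)
    then show "pieces_inv v 0 ((fst (\<rho>, (snd s)(''c'' := ?C)))(''e'' := 0), snd (\<rho>, (snd s)(''c'' := ?C)))"
      unfolding pieces_inv_def using C \<rho> by simp
  next
    fix s' assume inv: "pieces_inv v m s'"
    then have env': "G s'" and u: "fst s' ''u'' = v" unfolding pieces_inv_def by blast+
    have "final_pieces n R v (snd s' ''c'')"
      using inv final_pieces_three final_pieces_subtree[of v "snd s' ''c''"] envD(6)[OF env']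
      unfolding pieces_inv_def by blast
    then show "Q s'" using Q env' u by blast
  qed (use \<rho> mW runs_piece_inv in auto)
  have nm: "n \<le> n * m" "m \<le> n * m" using n2 n_le_m by simp_all
  have "m * (79 * Suc n + 68) + 79 * Suc n + 70 = 79 * (n * m) + 147 * m + 79 * n + 149"
    by (simp add: algebra_simps)
  then have T: "m * (79 * Suc n + 68) + 79 * Suc n + 70 + 30 * Suc n + 10 \<le> 600 * (n * m)"
    using nm nm_pos n2 by linarith
  show ?thesis unfolding pieces_prog_def
    apply (rule runs_Seq_Assign, use v nW st in simp, use T in simp, simp add: st)
    apply (rule runs_Seq[where ?T1.0 = "30 * Suc n" and ?T2.0 = "m * (79 * Suc n + 68) + 79 * Suc n + 70"])
     apply (rule runs_Fill[where n = n and B = "\<lambda>x. snd s ''h'' x \<noteq> Suc v"])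
             apply (use e v nW hW le_W st in \<open>simp_all add: label_is_def cong: if_cong\<close>)
     apply (rule main[simplified], simp_all)
    apply (use T in simp)
    done
qed

end

section \<open>Refinement until all \<open>k\<close> parts are non-empty\<close>

definition split_prog :: com where
  "split_prog = Seq pick_prog (Seq (Assign ''l'' (Load ''part'' (Reg ''y'')))
    (Seq (Assign ''t'' (Const 0)) (Seq (Fill (Equal (Const 0) (Const 0)) ''q'' ''t'')
    (Seq (Store ''q'' (Reg ''y'') (Const 1)) (Seq (Assign ''z'' (Reg ''y''))
    (Seq (For ''i'' ''n'' search_step) (Store ''part'' (Reg ''z'') (Reg ''j''))))))))"

definition refine_body :: com where
  "refine_body = Seq (Count ''r'' (label_is ''part'' ''j''))
    (Cond (Equal (Reg ''r'') (Const 0)) split_prog Skip)"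

definition refine_prog :: "nat \<Rightarrow> com" where
  "refine_prog k = Seq (Assign ''k'' (Const k)) (For ''j'' ''k'' refine_body)"

context word_graph
begin

text \<open>Pays for the quadratic passes that count a class for every name or vertex; it rests on
  \<open>n \<le> m\<close>.\<close>

lemma n_sq: "Suc n * Suc n \<le> 3 * (n * m)"
proof -
  have "Suc n * Suc n = n * n + 2 * n + 1" by simp
  moreover have "n * n \<le> n * m" using n_le_m by simp
  moreover have "2 * n \<le> n * m" using n2 n_le_m mult_le_mono2[of 2 m n] by (simp add: mult.commute)
  moreover have "1 \<le> n * m" by (rule nm_pos)
  ultimately show ?thesis by linarith
qed

text \<open>The root occupies part 0, hence only \<open>k - 1\<close> selections. Some parts may
  still be empty afterwards, which is index 0 of \<open>partial_parts\<close>.\<close>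

lemma runs_select_phase:
  assumes env: "G s" and u: "fst s ''u'' = v" and C: "final_pieces n R v (snd s ''c'')"
    and k: "3 \<le> k" "k \<le> n"
    and Q: "\<And>s'. G s' \<Longrightarrow> partial_parts k 0 (snd s' ''part'') \<Longrightarrow> Q s'"
  shows "runs W (select_prog (k - 1)) s (k * (1000 * (n * m))) Q"
proof -
  note e = envD[OF env]
  define C where "C = snd s ''c''"
  have star: "star_pieces n R v C" using C unfolding final_pieces_def C_def by blast
  have v: "v < n" and Cn: "\<And>x. x < n \<Longrightarrow> C x \<le> n" using star unfolding star_pieces_def by blast+
  define I where "I j \<sigma> \<longleftrightarrow> G \<sigma> \<and> fst \<sigma> ''u'' = v \<and>
    selection n v C j (snd \<sigma> ''part'') (snd \<sigma> ''c'')" for j \<sigma>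
  let ?T = "250 * (Suc n * Suc n)"
  have step: "runs W select_body \<sigma> ?T (\<lambda>s'. fst s' ''j'' = j \<and> fst s' ''k'' = k - 1 \<and>
      I (Suc j) ((fst s')(''j'' := Suc j), snd s'))"
    if j: "j < k - 1" and \<sigma>: "I j \<sigma>" "fst \<sigma> ''j'' = j" "fst \<sigma> ''k'' = k - 1" for j \<sigma>
  proof (rule runs_select[where n = n and u = v])
    have env': "G \<sigma>" and sel: "selection n v C j (snd \<sigma> ''part'') (snd \<sigma> ''c'')"
      using \<sigma> unfolding I_def by blast+
    show "fst \<sigma> ''n'' = n" "fst \<sigma> ''u'' = v" using envD[OF env'] \<sigma> unfolding I_def by auto
    show "2 * n + 2 \<le> W" "v < n" using nW v by auto
    show "Suc (fst \<sigma> ''j'') \<le> W" using j \<sigma>(2) k nW by simp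
    show "snd \<sigma> ''c'' x \<le> n" if "x < n" for x
      using sel Cn[OF that] that v unfolding selection_def by auto
    fix \<rho> :: "string \<Rightarrow> nat" and b
    let ?p = "\<lambda>z. if z < n \<and> snd \<sigma> ''c'' z = b then Suc (fst \<sigma> ''j'') else snd \<sigma> ''part'' z"
    let ?c = "\<lambda>z. if z < n \<and> snd \<sigma> ''c'' z = b then v else snd \<sigma> ''c'' z"
    assume b: "b \<le> n" "b \<noteq> v"
      and max: "\<And>i. i \<le> n \<Longrightarrow> i \<noteq> v \<Longrightarrow>
        card {z. z < n \<and> snd \<sigma> ''c'' z = i} \<le> card {z. z < n \<and> snd \<sigma> ''c'' z = b}"
      and \<rho>: "\<rho> ''n'' = n" "\<rho> ''m'' = fst \<sigma> ''m''" "\<rho> ''u'' = v" "\<rho> ''j'' = fst \<sigma> ''j''"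
        "\<rho> ''k'' = fst \<sigma> ''k''"
    have "selection n v C (Suc j) ?p ?c"
      by (rule selection_step[OF sel b(2) Cn]) (use max \<sigma>(2) in \<open>auto simp: cls_def\<close>)
    moreover have "G (\<rho>(''j'' := Suc j), (snd \<sigma>)(''part'' := ?p, ''c'' := ?c))"
      by (rule env_frame[OF env']) (use envD[OF env'] \<rho> in simp_all)
    ultimately have "I (Suc j) (\<rho>(''j'' := Suc j), (snd \<sigma>)(''part'' := ?p, ''c'' := ?c))"
      unfolding I_def using \<rho> by simp
    then show "fst (\<rho>, (snd \<sigma>)(''part'' := ?p, ''c'' := ?c)) ''j'' = j \<and>
      fst (\<rho>, (snd \<sigma>)(''part'' := ?p, ''c'' := ?c)) ''k'' = k - 1 \<and>
      I (Suc j) ((fst (\<rho>, (snd \<sigma>)(''part'' := ?p, ''c'' := ?c)))(''j'' := Suc j),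
        snd (\<rho>, (snd \<sigma>)(''part'' := ?p, ''c'' := ?c)))"
      using \<rho> \<sigma> by simp
  qed
  have fin: "Q \<sigma>" if "I (k - 1) \<sigma>" for \<sigma>
  proof (rule Q)
    have sel: "selection n v C (k - 1) (snd \<sigma> ''part'') (snd \<sigma> ''c'')" and "G \<sigma>"
      using that unfolding I_def by blast+
    then show "G \<sigma>" by blast
    have "snd \<sigma> ''part'' x < k" if "x < n" for x
    proof -
      have "snd \<sigma> ''part'' x \<le> k - 1" using sel that unfolding selection_def by blast
      then show ?thesis using k by simp
    qed
    moreover have "ratio_le n R k (card (cls n (snd \<sigma> ''part'') i))" for i
      using selection_ratio_le[OF C[folded C_def] sel, of i] k by simp
    ultimately show "partial_parts k 0 (snd \<sigma> ''part'')"
      unfolding partial_parts_def using selection_conn[OF star sel] by blast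
  qed
  have init: "I 0 (\<rho>(''j'' := 0), (snd s)(''part'' := p))"
    if "\<rho> ''n'' = n" "\<rho> ''m'' = m" "\<rho> ''u'' = v" "\<And>x. x < n \<Longrightarrow> p x = 0" for \<rho> p
  proof -
    have "G (\<rho>(''j'' := 0), (snd s)(''part'' := p))" by (rule env_frame[OF env]) (use that in simp_all)
    then show ?thesis unfolding I_def using that by (auto intro: selection_init simp: C_def)
  qed
  have main: "runs W (For ''j'' ''k'' select_body) \<sigma> ((k - 1) * (?T + 8) + ?T + 10) Q"
    if "fst \<sigma> ''k'' = k - 1" "I 0 ((fst \<sigma>)(''j'' := 0), snd \<sigma>)" for \<sigma>
    by (rule runs_For[where I = I, OF that(1) _ _ _ that(2) step fin order_refl])
      (use k nW in simp_all)
  define q where "q = n * m"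
  have "?T \<le> 750 * q" using n_sq unfolding q_def by linarith
  then have "(k - 1) * (?T + 8) + ?T + 10 \<le> (k - 1) * (758 * q) + 760 * q"
    using nm_pos mult_le_mono2[of "?T + 8" "758 * q" "k - 1"] unfolding q_def[symmetric] by linarith
  moreover have "(k - 1) * (758 * q) + 758 * q = k * (758 * q)"
    using k by (cases k) auto
  moreover have "24 * Suc n + 6 \<le> 100 * q"
  proof -
    have "n \<le> q" using n2 n_le_m unfolding q_def by simp
    then show ?thesis using nm_pos unfolding q_def[symmetric] by simp
  qed
  moreover have "k * (758 * q) + 200 * q \<le> k * (1000 * q)"
    using k mult_le_mono1[of 3 k "242 * q"] by (simp add: algebra_simps)
  ultimately have T: "24 * Suc n + 6 + ((k - 1) * (?T + 8) + ?T + 10) \<le> k * (1000 * q)"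
    by linarith
  show ?thesis unfolding select_prog_def q_def[symmetric]
    apply (rule runs_Seq_Assign, simp, use T in simp, simp)
    apply (rule runs_Seq[where ?T1.0 = "24 * Suc n" and ?T2.0 = "2 + ((k - 1) * (?T + 8) + ?T + 10)"])
     apply (rule runs_Fill[where n = n and B = "\<lambda>_. True"])
             apply (use e nW in simp_all)[7]
      apply (rule runs_Seq_Assign)
        apply (use k nW in simp)
       apply simp
      apply (rule runs_mono[OF main])
         apply simp
        subgoal using e u by (simp add: init)
       apply simp
      apply assumption
     apply simp
    apply (use T in simp)
    done
qed

end

context word_graph
begin

lemma runs_search:
  fixes s :: state
  defines "pt \<equiv> snd s ''part''"
  assumes env: "G s" and l: "fst s ''l'' = l" "l \<le> W" and pt: "\<And>x. x < n \<Longrightarrow> pt x \<le> W"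
    and conn: "conn R (cls n pt l)" and search: "search pt l y (snd s ''q'') (fst s ''z'')"
    and Q: "\<And>s'. G s' \<Longrightarrow> snd s' ''part'' = pt \<Longrightarrow> fst s' ''j'' = fst s ''j'' \<Longrightarrow> fst s' ''k'' = fst s ''k'' \<Longrightarrow>
      search pt l y (snd s' ''q'') (fst s' ''z'') \<Longrightarrow> cls n (snd s' ''q'') 1 = cls n pt l \<Longrightarrow> Q s'"
  shows "runs W (For ''i'' ''n'' search_step) s (n * (40 * Suc m + 28) + 40 * Suc m + 30) Q"
proof -
  \<comment> \<open>Before exhaustion, at least \<open>i + 1\<close> vertices are visited after
    \<open>i\<close> passes. For \<open>i = n\<close> this is impossible, so the class is
    exhausted.\<close>
  define J where "J i \<sigma> \<longleftrightarrow> G \<sigma> \<and> snd \<sigma> ''part'' = pt \<and> fst \<sigma> ''l'' = l \<and> fst \<sigma> ''j'' = fst s ''j'' \<and>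
    fst \<sigma> ''k'' = fst s ''k'' \<and> search pt l y (snd \<sigma> ''q'') (fst \<sigma> ''z'') \<and>
    (cls n (snd \<sigma> ''q'') 1 = cls n pt l \<or> Suc i \<le> card (cls n (snd \<sigma> ''q'') 1))" for i and \<sigma> :: state
  have step: "runs W search_step \<sigma> (40 * Suc m + 20)
     (\<lambda>s'. fst s' ''i'' = i \<and> fst s' ''n'' = n \<and> J (Suc i) ((fst s')(''i'' := Suc i), snd s'))"
    if \<sigma>: "J i \<sigma>" "fst \<sigma> ''i'' = i" for i \<sigma>
  proof -
    have env': "G \<sigma>" and p: "snd \<sigma> ''part'' = pt" "fst \<sigma> ''l'' = l"
        "fst \<sigma> ''j'' = fst s ''j''" "fst \<sigma> ''k'' = fst s ''k''"
      and sr: "search pt l y (snd \<sigma> ''q'') (fst \<sigma> ''z'')"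
      and c: "cls n (snd \<sigma> ''q'') 1 = cls n pt l \<or> Suc i \<le> card (cls n (snd \<sigma> ''q'') 1)"
      using \<sigma> unfolding J_def by blast+
    note e = envD[OF env']
    show ?thesis
    proof (rule runs_search_step[where n = n and m = m and l = l])
      show "snd \<sigma> ''q'' x \<le> 1" if "x < n" for x using sr that unfolding search_def by blast
      show "snd \<sigma> ''part'' x \<le> W" if "x < n" for x using pt[OF that] p by simp
    next
      fix \<rho> :: "string \<Rightarrow> nat"
      assume no: "\<And>i. i < m \<Longrightarrow> snd \<sigma> ''q'' (snd \<sigma> ''src'' i) = 1 \<Longrightarrow>
          snd \<sigma> ''q'' (snd \<sigma> ''dst'' i) = 0 \<Longrightarrow> snd \<sigma> ''part'' (snd \<sigma> ''dst'' i) \<noteq> l"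
        and \<rho>: "\<And>r. r \<notin> {''w'', ''e''} \<Longrightarrow> \<rho> r = fst \<sigma> r"
      have "cls n (snd \<sigma> ''q'') 1 = cls n pt l"
        by (rule search_complete[OF sr conn]) (use e(6) no p in blast)
      moreover have "G (\<rho>(''i'' := Suc i), snd \<sigma>)" by (rule env_frame[OF env']) (use \<rho> e in simp_all)
      ultimately have "J (Suc i) (\<rho>(''i'' := Suc i), snd \<sigma>)" unfolding J_def using \<rho> p sr by simp
      then show "fst (\<rho>, snd \<sigma>) ''i'' = i \<and> fst (\<rho>, snd \<sigma>) ''n'' = n \<and>
          J (Suc i) ((fst (\<rho>, snd \<sigma>))(''i'' := Suc i), snd (\<rho>, snd \<sigma>))"
        using \<rho> \<sigma>(2) e by simp
    next
      fix \<rho> :: "string \<Rightarrow> nat" and a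
      assume a: "a < m" "snd \<sigma> ''q'' (snd \<sigma> ''src'' a) = 1" "snd \<sigma> ''q'' (snd \<sigma> ''dst'' a) = 0"
          "snd \<sigma> ''part'' (snd \<sigma> ''dst'' a) = l"
        and \<rho>: "\<And>r. r \<notin> {''w'', ''e'', ''z''} \<Longrightarrow> \<rho> r = fst \<sigma> r" "\<rho> ''z'' = snd \<sigma> ''dst'' a"
      let ?w = "snd \<sigma> ''dst'' a" and ?q = "snd \<sigma> ''q''"
      have w: "?w < n" using e a by simp
      have new: "search pt l y (?q(?w := 1)) ?w"
        by (rule search_insert[OF sr e(3)[OF a(1)] a(2,3)]) (use a p in simp)
      have eq: "cls n (?q(?w := 1)) 1 = insert ?w (cls n ?q 1)" using w by (auto split: if_splits)
      have "?w \<notin> cls n ?q 1" using a by simp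
      moreover have "?w \<in> cls n pt l" using w a p by simp
      ultimately have "Suc i \<le> card (cls n ?q 1)" using c by blast
      then have "Suc (Suc i) \<le> card (cls n (?q(?w := 1)) 1)" unfolding eq using \<open>?w \<notin> cls n ?q 1\<close> by simp
      moreover have "G (\<rho>(''i'' := Suc i), (snd \<sigma>)(''q'' := ?q(?w := 1)))"
        by (rule env_frame[OF env']) (use \<rho> e in simp_all)
      ultimately have "J (Suc i) (\<rho>(''i'' := Suc i), (snd \<sigma>)(''q'' := ?q(?w := 1)))"
        unfolding J_def using \<rho> p new by simp
      then show "fst (\<rho>, (snd \<sigma>)(''q'' := ?q(?w := 1))) ''i'' = i \<and> fst (\<rho>, (snd \<sigma>)(''q'' := ?q(?w := 1))) ''n'' = n \<and>
          J (Suc i) ((fst (\<rho>, (snd \<sigma>)(''q'' := ?q(?w := 1))))(''i'' := Suc i), snd (\<rho>, (snd \<sigma>)(''q'' := ?q(?w := 1))))"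
        using \<rho> \<sigma>(2) e by simp
    qed (use e l p nW mW in simp_all)
  qed
  show ?thesis
  proof (rule runs_For[where I = J and N = n and T = "40 * Suc m + 20"])
    have "G ((fst s)(''i'' := 0), snd s)" by (rule env_frame[OF env]) (use envD[OF env] in simp_all)
    moreover have "y \<in> cls n (snd s ''q'') 1" using search unfolding search_def by blast
    then have "0 < card (cls n (snd s ''q'') 1)" by (auto simp: card_gt_0_iff simp del: mem_cls)
    ultimately show "J 0 ((fst s)(''i'' := 0), snd s)" unfolding J_def using l search pt_def by simp
  next
    fix \<sigma> assume J: "J n \<sigma>"
    have "card (cls n (snd \<sigma> ''q'') 1) \<le> n" unfolding cls_def by (rule card_less_Collect_le)
    then show "Q \<sigma>" using J unfolding J_def by (intro Q) auto
  qed (use envD[OF env] nW step in auto)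
qed

lemma runs_split:
  fixes s :: state
  defines "pt \<equiv> snd s ''part''"
  assumes env: "G s" and parts: "partial_parts k j pt" and empty: "cls n pt j = {}"
    and j: "fst s ''j'' = j" "j < k" and k: "fst s ''k'' = k" "k \<le> n"
    and Q: "\<And>s'. G s' \<Longrightarrow> fst s' ''j'' = j \<Longrightarrow> fst s' ''k'' = k \<Longrightarrow>
      partial_parts k (Suc j) (snd s' ''part'') \<Longrightarrow> Q s'"
  shows "runs W split_prog s (800 * (n * m)) Q"
proof -
  note e = envD[OF env]
  have ptk: "pt x < k" if "x < n" for x using parts that unfolding partial_parts_def by blast
  have ptW: "pt x \<le> W" if "x < n" for x using ptk[OF that] k nW by simp
  have conn: "conn R (cls n pt i)" for i using parts unfolding partial_parts_def by blast
  have split: "runs W (Seq (Assign ''l'' (Load ''part'' (Reg ''y'')))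
    (Seq (Assign ''t'' (Const 0)) (Seq (Fill (Equal (Const 0) (Const 0)) ''q'' ''t'')
    (Seq (Store ''q'' (Reg ''y'') (Const 1)) (Seq (Assign ''z'' (Reg ''y''))
    (Seq (For ''i'' ''n'' search_step) (Store ''part'' (Reg ''z'') (Reg ''j''))))))))
    (\<rho>, snd s) (24 * Suc n + (n * (40 * Suc m + 28) + 40 * Suc m + 30) + 30) Q"
    if y: "\<rho> ''y'' < n" "2 \<le> card {z. z < n \<and> pt z = pt (\<rho> ''y'')}"
      and \<rho>: "\<rho> ''n'' = n" "\<rho> ''m'' = fst s ''m''" "\<rho> ''j'' = fst s ''j''" "\<rho> ''k'' = fst s ''k''" for \<rho>
  proof -
    let ?y = "\<rho> ''y''" and ?l = "pt (\<rho> ''y'')"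
    have yW: "?y \<le> W" "?l \<le> W" using le_W[OF y(1)] ptW[OF y(1)] by auto
    have found: "runs W (Store ''part'' (Reg ''z'') (Reg ''j'')) \<sigma> 4 Q"
      if \<sigma>: "G \<sigma>" "snd \<sigma> ''part'' = pt" "fst \<sigma> ''j'' = j" "fst \<sigma> ''k'' = k"
        "search pt ?l ?y (snd \<sigma> ''q'') (fst \<sigma> ''z'')" "cls n (snd \<sigma> ''q'') 1 = cls n pt ?l" for \<sigma>
    proof (rule runs_Store)
      have "fst \<sigma> ''z'' \<in> cls n (snd \<sigma> ''q'') 1" using \<sigma>(5) unfolding search_def by blast
      then have z: "fst \<sigma> ''z'' < n" by simp
      show "afits W \<sigma> (Reg ''z'')" "afits W \<sigma> (Reg ''j'')" using le_W[OF z] \<sigma> j k nW by simp_all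
      have "partial_parts k (Suc j) (pt(fst \<sigma> ''z'' := j))"
        by (rule partial_parts_split[OF parts j(2) empty \<sigma>(5,6)]) (use y in \<open>simp add: cls_def\<close>)
      moreover have "G (fst \<sigma>, (snd \<sigma>)(''part'' := pt(fst \<sigma> ''z'' := j)))"
        by (rule env_frame[OF \<sigma>(1)]) (use envD[OF \<sigma>(1)] in simp_all)
      ultimately show "Q (fst \<sigma>, (snd \<sigma>)(''part'' := (snd \<sigma> ''part'')(aval \<sigma> (Reg ''z'') := aval \<sigma> (Reg ''j''))))"
        using \<sigma> by (intro Q) simp_all
    qed simp
    show ?thesis
      apply (rule runs_Seq_Assign, use yW in \<open>simp add: pt_def\<close>, simp, simp flip: pt_def)
      apply (rule runs_Seq_Assign, simp, simp, simp)
      apply (rule runs_Seq[where ?T1.0 = "24 * Suc n" and ?T2.0 = "n * (40 * Suc m + 28) + 40 * Suc m + 50"])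
       apply (rule runs_Fill[where n = n and B = "\<lambda>_. True"])
               apply (use \<rho> nW in \<open>simp_all cong: if_cong\<close>)
      apply (rule runs_Seq_Store, use yW in simp, use nW in simp, simp, simp cong: if_cong)
      apply (rule runs_Seq_Assign, use yW in simp, simp, simp cong: if_cong)
      apply (rule runs_Seq[where ?T1.0 = "n * (40 * Suc m + 28) + 40 * Suc m + 30" and ?T2.0 = 4])
       apply (rule runs_search[where l = ?l and y = ?y])
             apply (rule env_frame[OF env])
                 apply (use e \<rho> yW ptW conn j k in \<open>simp_all flip: pt_def\<close>)
       apply (rule search_init)
         apply (use y found in \<open>simp_all\<close>)
      done
  qed
  define q where "q = n * m"
  have nm: "n \<le> q" "m \<le> q" "1 \<le> q" using n2 n_le_m nm_pos unfolding q_def by simp_all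
  have "n * (40 * Suc m + 28) = 40 * q + 68 * n" unfolding q_def by (simp add: algebra_simps)
  moreover have "100 * (Suc n * Suc n) \<le> 300 * q" using n_sq unfolding q_def by linarith
  ultimately have T: "100 * (Suc n * Suc n) + (24 * Suc n + (n * (40 * Suc m + 28) + 40 * Suc m + 30) + 30) \<le> 800 * q"
    using nm by simp
  show ?thesis unfolding split_prog_def q_def[symmetric]
  proof (rule runs_Seq[OF runs_pick[where n = n] T])
    show "\<exists>i<n. 2 \<le> card {z. z < n \<and> snd s ''part'' z = snd s ''part'' i}"
      using partial_parts_two[OF parts j(2) empty k(2)] unfolding cls_def pt_def by simp
  qed (use e nW ptW split in \<open>auto simp: pt_def\<close>)
qed

lemma runs_refine:
  assumes env: "G s" and parts: "partial_parts k 0 (snd s ''part'')" and k: "k \<le> n"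
    and Q: "\<And>s'. G s' \<Longrightarrow> partial_parts k k (snd s' ''part'') \<Longrightarrow> Q s'"
  shows "runs W (refine_prog k) s (Suc k * (1000 * (n * m))) Q"
proof -
  define q where "q = n * m"
  have nm: "n \<le> q" "m \<le> q" "1 \<le> q" using n2 n_le_m nm_pos unfolding q_def by simp_all
  define I where "I j \<sigma> \<longleftrightarrow> G \<sigma> \<and> partial_parts k j (snd \<sigma> ''part'')" for j and \<sigma> :: state
  have step: "runs W refine_body \<sigma> (900 * q) (\<lambda>s'. fst s' ''j'' = j \<and> fst s' ''k'' = k \<and>
      I (Suc j) ((fst s')(''j'' := Suc j), snd s'))"
    if j: "j < k" and \<sigma>: "I j \<sigma>" "fst \<sigma> ''j'' = j" "fst \<sigma> ''k'' = k" for j \<sigma>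
  proof -
    have env': "G \<sigma>" and p: "partial_parts k j (snd \<sigma> ''part'')" using \<sigma> unfolding I_def by blast+
    note e = envD[OF env']
    have ptW: "snd \<sigma> ''part'' x \<le> W" if "x < n" for x
      using p that k nW unfolding partial_parts_def by (meson add_leE less_imp_le order_trans le_W less_le_trans)
    let ?c = "card {x. x < n \<and> snd \<sigma> ''part'' x = j}"
    let ?\<sigma> = "((fst \<sigma>)(''r'' := ?c, ''x'' := n), snd \<sigma>)"
    have c: "?c \<le> W" using card_less_Collect_le[of n "\<lambda>x. snd \<sigma> ''part'' x = j"] nW by simp
    have G': "G ?\<sigma>" by (rule env_frame[OF env']) (use e in simp_all)
    have I_Suc: "I (Suc j) ((fst s')(''j'' := Suc j), snd s')"
      if "G s'" "partial_parts k (Suc j) (snd s' ''part'')" for s'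
      using that env_frame[OF that(1), of "(fst s')(''j'' := Suc j)" "snd s'"] envD[OF that(1)]
      unfolding I_def by simp
    have "runs W (Cond (Equal (Reg ''r'') (Const 0)) split_prog Skip) ?\<sigma> (810 * q)
      (\<lambda>s'. fst s' ''j'' = j \<and> fst s' ''k'' = k \<and> I (Suc j) ((fst s')(''j'' := Suc j), snd s'))"
    proof (rule runs_Cond[where T' = "800 * q"])
      assume "bval ?\<sigma> (Equal (Reg ''r'') (Const 0))"
      then have "cls n (snd \<sigma> ''part'') j = {}" unfolding cls_def by simp
      then show "runs W split_prog ?\<sigma> (800 * q) (\<lambda>s'. fst s' ''j'' = j \<and> fst s' ''k'' = k \<and>
          I (Suc j) ((fst s')(''j'' := Suc j), snd s'))"
        unfolding q_def by (intro runs_split[OF G', where k = k and j = j]) (use p j \<sigma> k I_Suc in simp_all)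
    next
      assume "\<not> bval ?\<sigma> (Equal (Reg ''r'') (Const 0))"
      then have "cls n (snd \<sigma> ''part'') j \<noteq> {}" unfolding cls_def by auto
      then have "partial_parts k (Suc j) (snd \<sigma> ''part'')"
        using p unfolding partial_parts_def less_Suc_eq by blast
      then show "runs W Skip ?\<sigma> (800 * q) (\<lambda>s'. fst s' ''j'' = j \<and> fst s' ''k'' = k \<and>
          I (Suc j) ((fst s')(''j'' := Suc j), snd s'))"
        using G' I_Suc[of ?\<sigma>] \<sigma> nm by (intro runs_Skip) simp_all
    qed (use c nm in auto)
    note cont = this
    show ?thesis unfolding refine_body_def
      apply (rule runs_Seq[where ?T1.0 = "24 * Suc n" and ?T2.0 = "810 * q"])
       apply (rule runs_Count[where n = n and B = "\<lambda>x. snd \<sigma> ''part'' x = j"])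
               apply (use e \<sigma> nW ptW le_W j k nm in \<open>simp_all add: label_is_def cont\<close>)
      done
  qed
  have main: "runs W (For ''j'' ''k'' refine_body) \<sigma> (k * (900 * q + 8) + 900 * q + 10) Q"
    if "fst \<sigma> ''k'' = k" "I 0 ((fst \<sigma>)(''j'' := 0), snd \<sigma>)" for \<sigma>
    by (rule runs_For[where I = I, OF that(1) _ _ _ that(2) step _ order_refl])
      (use k nW Q in \<open>auto simp: I_def\<close>)
  have "k * (900 * q + 8) \<le> k * (1000 * q)" using nm by (intro mult_le_mono2) simp
  moreover have "Suc k * (1000 * q) = k * (1000 * q) + 1000 * q" by simp
  ultimately have T: "k * (900 * q + 8) + 900 * q + 10 + 2 \<le> Suc k * (1000 * q)" using nm by linarith
  have "G ((fst s)(''k'' := k, ''j'' := 0), snd s)" by (rule env_frame[OF env]) (use envD[OF env] in simp_all)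
  then have init: "I 0 ((fst s)(''k'' := k, ''j'' := 0), snd s)" unfolding I_def using parts by simp
  show ?thesis unfolding refine_prog_def q_def[symmetric]
    apply (rule runs_Seq_Assign, use k nW in simp, use T in simp)
    apply (rule runs_mono[OF main])
       apply simp
      apply (use init in simp)
     apply (use T in simp)
    apply assumption
    done
qed

end

subsection \<open>The algorithm\<close>

definition bgp_prog :: "nat \<Rightarrow> com" where
  "bgp_prog k = Seq sym_prog (Seq dfs_prog (Seq pieces_prog (Seq (select_prog (k - 1)) (refine_prog k))))"

lemma (in word_graph) runs_after_sym:
  assumes env: "G s" and init: "fst s ''u'' = 0" "fst s ''f'' = 0" "snd s ''h'' = (\<lambda>_. 0)" "snd s ''c'' = (\<lambda>_. 0)"
    and k: "3 \<le> k" "k \<le> n"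
    and Q: "\<And>s'. partial_parts k k (snd s' ''part'') \<Longrightarrow> Q s'"
  shows "runs W (Seq dfs_prog (Seq pieces_prog (Seq (select_prog (k - 1)) (refine_prog k)))) s
    ((3000 * k) * (n * m)) Q"
proof (rule runs_Seq[where ?T1.0 = "1000 * (n * m)" and ?T2.0 = "600 * (n * m) + (k * (1000 * (n * m)) + Suc k * (1000 * (n * m)))"])
  show "runs W dfs_prog s (1000 * (n * m)) (\<lambda>s'. runs W (Seq pieces_prog (Seq (select_prog (k - 1)) (refine_prog k)))
     s' (600 * (n * m) + (k * (1000 * (n * m)) + Suc k * (1000 * (n * m)))) Q)"
  proof (rule runs_dfs[OF env init], rule runs_Seq[OF runs_pieces order_refl])
    fix s v
    assume "G s" "fst s ''u'' = v" "final_pieces n R v (snd s ''c'')"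
    then show "runs W (Seq (select_prog (k - 1)) (refine_prog k)) s
      (k * (1000 * (n * m)) + Suc k * (1000 * (n * m))) Q"
      by (intro runs_Seq[OF runs_select_phase[OF _ _ _ k runs_refine[OF _ _ k(2) Q]] order_refl])
  qed
  \<comment> \<open>The phases sum to \<open>2600 + 2000 * k\<close> multiples of
    \<open>n * m\<close>, and \<open>k \<ge> 3\<close> absorbs 2600 into
    \<open>1000 * k\<close>.\<close>
  have "3 * (1000 * (n * m)) \<le> k * (1000 * (n * m))" using k(1) by (rule mult_le_mono1)
  moreover have "3000 * k * (n * m) = 3 * (k * (1000 * (n * m)))" by simp
  moreover have "Suc k * (1000 * (n * m)) = k * (1000 * (n * m)) + 1000 * (n * m)" by simp
  ultimately show "1000 * (n * m) + (600 * (n * m) + (k * (1000 * (n * m)) + Suc k * (1000 * (n * m))))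
    \<le> 3000 * k * (n * m)" by linarith
qed

section \<open>Edge counts for time and word size, and the passage from labellings to feasible
  partitions\<close>

lemma simple_graph_card_edges:
  assumes "simple_graph V E"
  shows "card E \<le> card V * card V"
proof -
  have fin: "finite V" using assms unfolding simple_graph_def by blast
  have "E \<subseteq> (\<lambda>(u, v). {u, v}) ` (V \<times> V)"
  proof
    fix e assume "e \<in> E"
    then have "e \<subseteq> V" "card e = 2" using assms unfolding simple_graph_def by auto
    then obtain a b where "e = {a, b}" by (auto simp: card_2_iff)
    then show "e \<in> (\<lambda>(u, v). {u, v}) ` (V \<times> V)" using \<open>e \<subseteq> V\<close> by auto
  qed
  then have "card E \<le> card (V \<times> V)" using fin by (intro surj_card_le) auto
  then show ?thesis by (simp add: card_cartesian_product)
qed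

text \<open>In a connected graph with at least two vertices no \<open>{x}\<close> is closed, so the
  edges cover \<open>V\<close>. The bound is exactly \<open>n \<le> m\<close> for the doubled edge
  list.\<close>

lemma connected_graph_card_edges:
  assumes "simple_graph V E" "conn (\<lambda>x y. {x, y} \<in> E) V" "2 \<le> card V"
  shows "card V \<le> 2 * card E"
proof -
  have fin: "finite V" using assms(1) unfolding simple_graph_def by blast
  have finE: "finite E"
    by (rule finite_subset[of _ "Pow V"]) (use assms(1) fin in \<open>auto simp: simple_graph_def\<close>)
  have "V \<subseteq> \<Union>E"
  proof
    fix x assume x: "x \<in> V"
    have "V \<noteq> {x}" using assms(3) by auto
    then have "\<exists>y. {x, y} \<in> E"
      using assms(2)[unfolded conn_def, rule_format, of "{x}"] x by auto
    then show "x \<in> \<Union>E" by auto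
  qed
  then have "card V \<le> card (\<Union>E)" using finE assms(1) fin
    by (intro card_mono) (auto simp: simple_graph_def intro: finite_subset)
  also have "\<dots> \<le> (\<Sum>e\<in>E. card e)" by (rule card_Union_le_sum_card)
  also have "\<dots> = 2 * card E" using assms(1) unfolding simple_graph_def by simp
  finally show ?thesis .
qed

lemma OPT_attained:
  assumes "finite V" "feasible_partition k V E P"
  obtains Q where "feasible_partition k V E Q" "OPT k V E = partition_size Q"
proof -
  let ?S = "{P. feasible_partition k V E P}"
  have "?S \<subseteq> Pow (Pow V)" unfolding feasible_partition_def partition_on_def by auto
  then have "finite ?S" using assms(1) by (meson finite_Pow_iff finite_subset)
  then have "OPT k V E \<in> partition_size ` ?S"
    unfolding OPT_def using assms(2) by (intro Min_in) auto
  then show ?thesis using that by auto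
qed

text \<open>The output itself witnesses that feasible partitions exist, so \<open>OPT\<close> is
  attained by some \<open>Q\<close>, to which \<open>ratio_le\<close> is applied.\<close>

lemma (in ngraph) partial_parts_feasible:
  assumes "partial_parts k k pt" "0 < k" and R: "R = (\<lambda>x y. {x, y} \<in> E)" and out: "snd s ''part'' = pt"
  shows "feasible_partition k {..<n} E (output_partition k {..<n} s)"
    "2 * partition_size (output_partition k {..<n} s) \<le> k * OPT k {..<n} E"
proof -
  have ptk: "pt x < k" if "x < n" for x using assms(1) that unfolding partial_parts_def by blast
  have conn: "conn R (cls n pt i)" and ratio: "ratio_le n R k (card (cls n pt i))" for i
    using assms(1) unfolding partial_parts_def by blast+
  have ne: "cls n pt i \<noteq> {}" if "i < k" for i using assms(1) that unfolding partial_parts_def by blast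
  have out': "output_partition k {..<n} s = cls n pt ` {..<k}"
    unfolding output_partition_def cls_def out by simp
  have inj: "inj_on (cls n pt) {..<k}"
  proof (rule inj_onI)
    fix i j assume ij: "i \<in> {..<k}" "cls n pt i = cls n pt j"
    with ne[of i] obtain x where "x \<in> cls n pt i" by blast
    moreover from this have "x \<in> cls n pt j" using ij(2) by simp
    ultimately have "pt x = i" "pt x = j" by simp_all
    then show "i = j" by simp
  qed
  have "partition_on {..<n} (cls n pt ` {..<k})"
    unfolding partition_on_def disjoint_def using ptk ne by (auto simp: cls_def)
  moreover have "card (cls n pt ` {..<k}) = k" using card_image[OF inj] by simp
  moreover have "connected_graph U (induced_edges E U)" if "U \<in> cls n pt ` {..<k}" for U
    using that conn ne unfolding connected_graph_iff_conn R by auto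
  ultimately show feasible: "feasible_partition k {..<n} E (output_partition k {..<n} s)"
    unfolding feasible_partition_def out' by blast
  obtain Q where Q: "feasible_partition k {..<n} E Q" "OPT k {..<n} E = partition_size Q"
    using OPT_attained[OF _ feasible] by blast
  have "2 * card (cls n pt i) \<le> k * partition_size Q" for i
    using ratio[of i] Q(1) unfolding ratio_le_def feasible_partition_def connected_graph_iff_conn R by blast
  moreover have "partition_size (cls n pt ` {..<k}) \<in> card ` cls n pt ` {..<k}"
    unfolding partition_size_def using assms(2) by (intro Max_in) auto
  ultimately show "2 * partition_size (output_partition k {..<n} s) \<le> k * OPT k {..<n} E"
    unfolding out' Q(2) by auto
qed

lemma runs_bgp:
  fixes n k :: nat
  assumes simple: "simple_graph V E" and con: "connected_graph V E" and k: "3 \<le> k" "k \<le> card V"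
    and enc: "encodes n es V E"
  shows "runs (card V ^ 3) (bgp_prog k) (input_state n es) (7000 * k * (card V * card E))
    (\<lambda>s. feasible_partition k V E (output_partition k V s) \<and>
      2 * partition_size (output_partition k V s) \<le> k * OPT k V E)"
proof -
  define R where "R x y \<longleftrightarrow> {x, y} \<in> E" for x y
  define l where "l = length es"
  have V: "V = {..<n}" and E: "E = (\<lambda>(u, v). {u, v}) ` set es" and l: "l = card E"
    using enc unfolding encodes_def l_def by auto
  have n3: "3 \<le> n" using k V by simp
  have "induced_edges E V = E" using simple unfolding induced_edges_def simple_graph_def by auto
  then have conn: "conn (\<lambda>x y. {x, y} \<in> E) V" using con connected_graph_iff_conn[of V E] by simp
  have nE: "n \<le> 2 * l" using connected_graph_card_edges[OF simple conn] n3 V l by simp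
  have l_sq: "l \<le> n * n" using simple_graph_card_edges[OF simple] V l by simp
  \<comment> \<open>The exponent 3 comes from the doubled edge list: its length can be of order
    \<open>n * n\<close>, and \<open>n \<ge> 3\<close> turns one more factor \<open>n\<close> into
    room for the constants.\<close>
  have cube: "3 * (n * n) \<le> n ^ 3" using n3 by (simp add: power3_eq_cube)
  have sq: "3 * n \<le> n * n" using n3 by simp
  have W: "2 * l + 2 \<le> n ^ 3" "4 * n + 4 \<le> n ^ 3" "1 \<le> n ^ 3"
    using cube sq l_sq n3 by linarith+
  interpret word_graph n R "2 * l" "n ^ 3"
  proof unfold_locales
    show "symp R" unfolding R_def by (rule sympI) (simp add: insert_commute)
    show "R x y \<Longrightarrow> x < n" for x y using simple V unfolding R_def simple_graph_def by auto
    show "conn R {..<n}" using conn V unfolding R_def by simp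
  qed (use n3 nE W in simp_all)
  have es: "fst (es ! i) < n" "snd (es ! i) < n" "R (fst (es ! i)) (snd (es ! i))" if "i < l" for i
  proof -
    have "es ! i \<in> set es" using that unfolding l_def by simp
    then show "R (fst (es ! i)) (snd (es ! i))" unfolding R_def E by (force simp: case_prod_beta)
    then show "fst (es ! i) < n" "snd (es ! i) < n" using bounded bounded' by auto
  qed
  let ?s = "input_state n es"
  let ?src = "\<lambda>j. if l \<le> j \<and> j < 2 * l then snd ?s ''dst'' (j - l) else snd ?s ''src'' j"
  let ?dst = "\<lambda>j. if l \<le> j \<and> j < 2 * l then snd ?s ''src'' (j - l) else snd ?s ''dst'' j"
  let ?s1 = "((fst ?s)(''e'' := l, ''m'' := 2 * l), (snd ?s)(''src'' := ?src, ''dst'' := ?dst))"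
  have arrays: "snd ?s ''src'' = (\<lambda>i. if i < l then fst (es ! i) else 0)"
    "snd ?s ''dst'' = (\<lambda>i. if i < l then snd (es ! i) else 0)"
    unfolding input_state_def l_def by simp_all
  have env: "G ?s1"
    unfolding env_def
  proof (intro conjI allI impI)
    show "fst ?s1 ''n'' = n" "fst ?s1 ''m'' = 2 * l" unfolding input_state_def by simp_all
    fix i assume "i < 2 * l"
    then show "R (snd ?s1 ''src'' i) (snd ?s1 ''dst'' i)"
      using es(3)[of i] es(3)[of "i - l"] R_sym by (auto simp: arrays)
  next
    fix x y assume xy: "R x y"
    then obtain i where i: "i < l" "{x, y} = {fst (es ! i), snd (es ! i)}"
      unfolding R_def E l_def by (auto simp: in_set_conv_nth case_prod_beta)
    then consider "x = fst (es ! i)" "y = snd (es ! i)" | "x = snd (es ! i)" "y = fst (es ! i)"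
      by (auto simp: doubleton_eq_iff)
    then show "\<exists>i<2 * l. snd ?s1 ''src'' i = x \<and> snd ?s1 ''dst'' i = y"
    proof cases
      case 1
      then show ?thesis using i by (intro exI[of _ i]) (simp add: arrays)
    next
      case 2
      then show ?thesis using i by (intro exI[of _ "l + i"]) (simp add: arrays)
    qed
  qed
  have "runs (n ^ 3) (bgp_prog k) ?s (40 * Suc l + 3000 * k * (n * (2 * l)))
    (\<lambda>s. feasible_partition k V E (output_partition k V s) \<and>
      2 * partition_size (output_partition k V s) \<le> k * OPT k V E)"
    unfolding bgp_prog_def
  proof (rule runs_Seq[OF runs_sym[where m = l] order_refl])
    show "runs (n ^ 3) (Seq dfs_prog (Seq pieces_prog (Seq (select_prog (k - 1)) (refine_prog k)))) ?s1
      (3000 * k * (n * (2 * l))) (\<lambda>s. feasible_partition k V E (output_partition k V s) \<and>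
      2 * partition_size (output_partition k V s) \<le> k * OPT k V E)"
    proof (rule runs_after_sym[OF env])
      fix s' :: state assume p: "partial_parts k k (snd s' ''part'')"
      have "R = (\<lambda>x y. {x, y} \<in> E)" unfolding R_def ..
      then show "feasible_partition k V E (output_partition k V s') \<and>
          2 * partition_size (output_partition k V s') \<le> k * OPT k V E"
        using partial_parts_feasible[OF p _ _ refl] k unfolding V by auto
    qed (use k V in \<open>simp_all add: input_state_def\<close>)
  next
    show "snd ?s ''src'' i \<le> n ^ 3" "snd ?s ''dst'' i \<le> n ^ 3" if "i < l" for i
      using that le_W es by (simp_all add: arrays)
  qed (use W in \<open>simp_all add: input_state_def l_def\<close>)
  \<comment> \<open>The doubled list gives \<open>6000 * k\<close>; the linear cost of
    \<open>sym_prog\<close> fits into the remaining \<open>1000 * k\<close>.\<close>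
  moreover have "40 * Suc l + 3000 * k * (n * (2 * l)) \<le> 7000 * k * (n * l)"
  proof -
    have "1 \<le> l" using nE n3 by simp
    have "3 * l \<le> n * l" using n3 by simp
    moreover have "3 * (n * l) \<le> k * (n * l)" using k by simp
    moreover have "3000 * k * (n * (2 * l)) = 6000 * (k * (n * l))" "7000 * k * (n * l) = 7000 * (k * (n * l))"
      by simp_all
    moreover have "40 * Suc l = 40 * l + 40" by simp
    ultimately show ?thesis using \<open>1 \<le> l\<close> by linarith
  qed
  ultimately show ?thesis using V l by (auto intro: runs_mono)
qed

theorem theorem2:
  fixes k :: nat
  assumes "k \<ge> 3"
  shows "\<exists>(prog :: com) (C :: nat) (d :: nat).
    \<forall>(V :: nat set) (E :: nat set set) (n :: nat) (es :: (nat \<times> nat) list).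
      simple_graph V E \<longrightarrow> connected_graph V E \<longrightarrow> card V \<ge> k \<longrightarrow> encodes n es V E \<longrightarrow>
      (\<exists>t s. exec (card V ^ d) prog (input_state n es) t s \<and>
             t \<le> C * (card V * card E) \<and>
             feasible_partition k V E (output_partition k V s) \<and>
             real (partition_size (output_partition k V s)) \<le> real k / 2 * real (OPT k V E))"
proof (rule exI[of _ "bgp_prog k"], rule exI[of _ "7000 * k"], rule exI[of _ 3], intro allI impI)
  fix V :: "nat set" and E :: "nat set set" and n :: nat and es :: "(nat \<times> nat) list"
  assume "simple_graph V E" "connected_graph V E" "k \<le> card V" "encodes n es V E"
  from runs_bgp[OF this(1,2) assms this(3,4)] obtain t s where
    s: "exec (card V ^ 3) (bgp_prog k) (input_state n es) t s" "t \<le> 7000 * k * (card V * card E)"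
      "feasible_partition k V E (output_partition k V s)"
      "2 * partition_size (output_partition k V s) \<le> k * OPT k V E"
    unfolding runs_def by blast
  have "real (2 * partition_size (output_partition k V s)) \<le> real (k * OPT k V E)"
    using s(4) by (rule of_nat_mono)
  then have "real (partition_size (output_partition k V s)) \<le> real k / 2 * real (OPT k V E)" by simp
  then show "\<exists>t s. exec (card V ^ 3) (bgp_prog k) (input_state n es) t s \<and>
             t \<le> 7000 * k * (card V * card E) \<and>
             feasible_partition k V E (output_partition k V s) \<and>
             real (partition_size (output_partition k V s)) \<le> real k / 2 * real (OPT k V E)"
    using s(1-3) by blast
qed

end
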